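(* Let $\beta \in [0,1)$ be fixed. Then for all sufficiently large $T$, \[ \max_{t \in [T^\beta,T]} \operatorname{Re} \zeta\left(\frac{1}{2}+\mathrm{i}t\right) \ge \exp\left(\left(\sqrt{1-\beta}+o(1)\right)\sqrt{\frac{\log T\, \log\log\log T}{\log\log T}} \right), \] where $o(1)$ denotes a quantity tending to $0$ as $T\to\infty$ (with $\beta$ fixed).
   Context: $\zeta(s)$ denotes the Riemann zeta function (with its meromorphic continuation to $\mathbb{C}$), $\operatorname{Re}$ denotes the real part, and $\log$ is the natural logarithm. *)

theory Defs
  imports "HOL-Complex_Analysis.Complex_Analysis"
begin

text \<open>The Riemann zeta function as the analytic continuation of its Dirichlet series to the
  connected domain \<open>- {1}\<close>. The identity theorem makes the continuation unique there; \<open>1\<close> is its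
  only pole, and the conventional value \<open>0\<close> at that pole makes the description definite.\<close>

definition zeta :: "complex \<Rightarrow> complex" where
  "zeta = (THE f. f holomorphic_on - {1} \<and> f 1 = 0 \<and>
     (\<forall>s. Re s > 1 \<longrightarrow> (\<lambda>n. 1 / of_nat (Suc n) powr s) sums f s))"

end

theory Submission
  imports Defs "HOL-Number_Theory.Number_Theory" "HOL-Probability.Probability" "HOL-Real_Asymp.Real_Asymp"
begin

text \<open>
  The proof is the resonance method. Let \<open>K\<close> be a narrow Gaussian and let \<open>D(t)\<close> be the average of
  \<open>Re \<zeta>(1/2 + i(t + u))\<close> against \<open>K(u)\<close>. Apart from the contribution of the pole, which is harmless
  away from \<open>t = 0\<close>, \<open>D(t)\<close> is a cosine polynomial \<open>\<Sum> k(n) n^(-1/2) cos(t log n)\<close> with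
  nonnegative coefficients; it is essentially at most \<open>V\<close> on \<open>[2 T^\<beta>, T/2]\<close> when the real part of
  zeta is at most \<open>V\<close> on \<open>[T^\<beta>, T]\<close> (\<open>smooth_sum_le\<close>), and it is bounded by a power of \<open>T\<close> with
  exponent tending to \<open>0\<close> everywhere (\<open>smooth_sum_bound\<close>). The average is needed for the last bound:
  the resonator below is not small near \<open>t = 0\<close>, so the range \<open>|t| \<le> 2 T^\<beta>\<close> must be paid for trivially.

  Now let \<open>M\<close> be a set of at most \<open>T^\<kappa>\<close> positive integers, \<open>\<kappa> < 1 - \<beta>\<close>, with weights \<open>f \<ge> 0\<close>, and let
  \<open>R(t)\<close> be a Dirichlet polynomial with frequencies \<open>log m\<close>, \<open>m \<in> M\<close>, and coefficients \<open>f(m)\<close>,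
  with nearby frequencies merged (\<open>binned_correlation_le\<close>).
  Integrate \<open>D(t) |R(t)|^2\<close> against a Gaussian of width about \<open>T\<close>. All Fourier coefficients involved
  are nonnegative, so dropping all but the terms near the diagonal \<open>n m = m'\<close> gives a lower bound, while the
  upper bound for \<open>D\<close> gives an upper bound with the factor \<open>V\<close>. The result is
  \<open>\<Sum> k(n) n^(-1/2) \<Sum> f(m) f(n m) \<le> C V \<Sum> f(m)^2\<close> (\<open>zre_large_of_correlations\<close>). The condition
  \<open>\<beta> + \<kappa> < 1\<close> is what makes the trivially bounded range negligible: there \<open>|R|^2\<close> is at most
  \<open>|M|\<close> times \<open>\<Sum> f(m)^2\<close>.

  It remains to find \<open>M\<close> and \<open>f\<close> with a large ratio (\<open>large_correlations\<close>). With \<open>l = log T\<close>, take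
  squarefree products of primes from blocks \<open>P_i\<close>, the primes between \<open>l exp(h_i)\<close> and
  \<open>l exp(h_(i+1))\<close>, allowing at most \<open>J_i\<close> primes from \<open>P_i\<close>, and let \<open>f\<close> be multiplicative with
  \<open>f(p) = c_i / sqrt p\<close> on \<open>P_i\<close>. Then \<open>f(m) f(n m) / sqrt n = f(n m)^2 / \<Prod> c_i\<close>, the product being over
  the primes of \<open>n\<close>, so an integer with \<open>J_i\<close> primes in each block contributes its \<open>f^2\<close> times
  \<open>\<Prod> (1 + 1/c_i)^(J_i)\<close>; and these full integers carry a sufficient share of the mass of \<open>f^2\<close>
  (\<open>sum_subsets_le_top_layer\<close>). One pays \<open>\<Sum> J_i h_i\<close> for \<open>log |M|\<close> and gains \<open>\<Sum> J_i / c_i\<close>, subject to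
  \<open>J_i \<le> c_i^2 \<Sum> 1/p\<close>. The optimum is a budget divided equally among geometrically growing \<open>h_i\<close>
  between \<open>(log l)^\<delta>\<close> and \<open>(log l)^(1 - \<delta>)\<close>; Mertens' estimate for \<open>\<Sum> log p / p\<close> then gives a gain
  asymptotic to \<open>sqrt (\<kappa> l log log l / log l)\<close> as \<open>\<delta> \<rightarrow> 0\<close>, and \<open>\<kappa> \<rightarrow> 1 - \<beta>\<close> yields the constant of the
  theorem.
\<close>

section \<open>Analytic continuation of the zeta function\<close>

text \<open>The power \<open>x\<close> to the \<open>-s\<close> of a positive real \<open>x\<close>, expressed by the real logarithm so that no branch of
  the complex logarithm enters.\<close>
definition npw :: "complex \<Rightarrow> real \<Rightarrow> complex" where
  "npw s x = exp (- s * of_real (ln x))"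

lemma npw_1 [simp]: "npw s 1 = 1"
  by (simp add: npw_def)

lemma norm_npw: "x > 0 \<Longrightarrow> norm (npw s x) = x powr (- Re s)"
  by (simp add: npw_def powr_def)

lemma inverse_powr_eq_npw: "1 / of_nat (Suc n) powr s = npw s (real (Suc n))"
proof -
  have "Ln (of_nat (Suc n)) = of_real (ln (real (Suc n)))"
    by (metis Ln_of_real' of_nat_0_less_iff of_real_of_nat_eq zero_less_Suc less_irrefl Ln_of_real)
  then show ?thesis
    by (simp add: npw_def powr_def exp_minus field_simps del: of_nat_Suc)
qed

lemma has_vector_derivative_npw:
  assumes "x > 0"
  shows "(npw s has_vector_derivative (- s * npw (s + 1) x)) (at x within A)"
proof -
  have "exp (- (of_real (ln x)) :: complex) = of_real (inverse x)"
    using assms by (simp only: of_real_minus[symmetric] exp_of_real ln_inverse[symmetric]) simp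
  then have e: "npw (s + 1) x = npw s x * of_real (1 / x)"
    by (simp add: npw_def exp_add ring_distribs exp_diff exp_minus field_simps)
  have "((\<lambda>x. exp (- s * of_real (ln x))) has_vector_derivative (- s * of_real (1 / x)) * exp (- s * of_real (ln x))) (at x within A)"
    using assms
    by (intro derivative_eq_intros has_vector_derivative_real_field field_vector_diff_chain_within
          [where g = exp and f = "\<lambda>x. - s * of_real (ln x)", unfolded o_def, THEN has_vector_derivative_eq_rhs] refl | simp)+
  then show ?thesis unfolding e unfolding npw_def[abs_def] by (simp add: mult_ac)
qed

text \<open>The part of \<open>\<integral> P({x}) x^(-s) dx\<close> that comes from the unit cell \<open>[n, n + 1]\<close>, where \<open>{x}\<close> is the
  fractional part.\<close>
definition cell_integral :: "(real \<Rightarrow> complex) \<Rightarrow> nat \<Rightarrow> complex \<Rightarrow> complex" where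
  "cell_integral P n s = integral {0..1} (\<lambda>y. P y * npw s (real n + y))"

lemma continuous_on_npw:
  "n > 0 \<Longrightarrow> continuous_on {0..1} (\<lambda>y. npw s (real n + y))"
  unfolding npw_def by (intro continuous_intros) auto

lemma cell_integrable:
  assumes "continuous_on {0..1} P" "n > 0"
  shows "(\<lambda>y. P y * npw s (real n + y)) integrable_on {0..1}"
  by (intro integrable_continuous_real continuous_on_mult assms continuous_on_npw)

lemma cell_integral_holomorphic:
  assumes "continuous_on {0..1} P" "n > 0"
  shows "cell_integral P n holomorphic_on UNIV"
proof -
  have "(\<lambda>s. integral (cbox 0 1) (\<lambda>y. P y * npw s (real n + y))) holomorphic_on UNIV"
  proof (rule leibniz_rule_holomorphic)
    fix s :: complex and y :: real assume "y \<in> cbox 0 1"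
    show "((\<lambda>s. P y * npw s (real n + y)) has_field_derivative
        (P y * (- of_real (ln (real n + y)) * npw s (real n + y)))) (at s within UNIV)"
      unfolding npw_def by (auto intro!: derivative_eq_intros)
  next
    show "continuous_on (UNIV \<times> cbox 0 1)
       (\<lambda>(s, y). P y * (- of_real (ln (real n + y)) * npw s (real n + y)))"
      unfolding npw_def split_def using assms
      by (intro continuous_intros continuous_on_compose2[OF assms(1)]) auto
  qed (use assms cell_integrable in auto)
  then show ?thesis by (simp add: cell_integral_def[abs_def])
qed

lemma norm_cell_integral_le:
  assumes "continuous_on {0..1} P" "n > 0" "\<And>y. y \<in> {0..1} \<Longrightarrow> norm (P y) \<le> B" "Re s \<ge> 0"
  shows "norm (cell_integral P n s) \<le> B * real n powr (- Re s)"
proof -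
  have B: "0 \<le> B" using assms(3)[of 0] norm_ge_zero[of "P 0"] by (simp del: norm_ge_zero)
  have "norm (integral {0..1} (\<lambda>y. P y * npw s (real n + y))) \<le> (B * real n powr (- Re s)) * (1 - 0)"
  proof (rule integral_bound)
    show "continuous_on {0..1} (\<lambda>y. P y * npw s (real n + y))"
      by (intro continuous_on_mult assms continuous_on_npw)
    fix y :: real assume y: "y \<in> {0..1}"
    have "norm (npw s (real n + y)) \<le> real n powr (- Re s)"
      using y assms by (subst norm_npw) (auto intro!: powr_mono2')
    then show "norm (P y * npw s (real n + y)) \<le> B * real n powr (- Re s)"
      unfolding norm_mult using assms(3)[OF y] B by (intro mult_mono) auto
  qed auto
  then show ?thesis by (simp add: cell_integral_def)
qed

definition cell_sum :: "(real \<Rightarrow> complex) \<Rightarrow> complex \<Rightarrow> complex" where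
  "cell_sum P s = (\<Sum>k. cell_integral P (Suc k) s)"

lemma bounded_on_unit_interval:
  fixes P :: "real \<Rightarrow> complex"
  assumes "continuous_on {0..1} P"
  obtains B where "B \<ge> 0" "\<And>y. y \<in> {0..1} \<Longrightarrow> norm (P y) \<le> B"
proof -
  have "bounded (P ` {0..1})"
    using assms by (intro compact_imp_bounded compact_continuous_image) auto
  then obtain B where "B > 0" "\<And>y. y \<in> {0..1} \<Longrightarrow> norm (P y) \<le> B"
    by (auto simp: bounded_pos)
  then show ?thesis using that[of B] by auto
qed

lemma summable_Suc_powr: "a > 1 \<Longrightarrow> summable (\<lambda>k. real (Suc k) powr (- a))"
  using summable_real_powr_iff[of "-a"] by (subst summable_Suc_iff) auto

lemma summable_cell_integral:
  assumes "continuous_on {0..1} P" "Re s > 1"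
  shows "summable (\<lambda>k. cell_integral P (Suc k) s)"
proof -
  obtain B where B: "B \<ge> 0" "\<And>y. y \<in> {0..1} \<Longrightarrow> norm (P y) \<le> B"
    using bounded_on_unit_interval[OF assms(1)] by blast
  show ?thesis
  proof (rule summable_comparison_test')
    show "summable (\<lambda>k. B * real (Suc k) powr (- Re s))"
      using assms by (intro summable_mult summable_Suc_powr)
    show "norm (cell_integral P (Suc k) s) \<le> B * real (Suc k) powr (- Re s)" for k
      using assms B by (intro norm_cell_integral_le) auto
  qed
qed

lemma cell_sum_holomorphic:
  assumes "continuous_on {0..1} P"
  shows "cell_sum P holomorphic_on {s. Re s > 1}"
proof (rule holomorphic_uniform_sequence[where f = "\<lambda>N s. \<Sum>k<N. cell_integral P (Suc k) s"])
  show "open {s. Re s > 1}" by (rule open_halfspace_Re_gt)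
  show "(\<lambda>s. \<Sum>k<N. cell_integral P (Suc k) s) holomorphic_on {s. Re s > 1}" for N
    by (intro holomorphic_on_sum holomorphic_on_subset[OF cell_integral_holomorphic] assms) auto
  fix z :: complex assume z: "z \<in> {s. Re s > 1}"
  define d where "d = (Re z - 1) / 2"
  have d: "d > 0" using z by (simp add: d_def)
  have Re_ge: "Re s \<ge> 1 + d" if "s \<in> cball z d" for s
  proof -
    have "Re z - Re s \<le> norm (z - s)" using complex_Re_le_cmod[of "z - s"] by simp
    also have "\<dots> \<le> d" using that by (simp add: dist_norm)
    finally show ?thesis by (simp add: d_def field_simps)
  qed
  obtain B where B: "B \<ge> 0" "\<And>y. y \<in> {0..1} \<Longrightarrow> norm (P y) \<le> B"
    using bounded_on_unit_interval[OF assms(1)] by blast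
  have "uniform_limit (cball z d) (\<lambda>N s. \<Sum>k<N. cell_integral P (Suc k) s)
      (\<lambda>s. \<Sum>k. cell_integral P (Suc k) s) sequentially"
  proof (rule Weierstrass_m_test)
    show "summable (\<lambda>k. B * real (Suc k) powr (- (1 + d)))"
      using d by (intro summable_mult summable_Suc_powr) auto
    fix k s assume s: "s \<in> cball z d"
    have "norm (cell_integral P (Suc k) s) \<le> B * real (Suc k) powr (- Re s)"
      using assms B Re_ge[OF s] d by (intro norm_cell_integral_le) auto
    also have "\<dots> \<le> B * real (Suc k) powr (- (1 + d))"
      using Re_ge[OF s] B by (intro mult_left_mono powr_mono) auto
    finally show "norm (cell_integral P (Suc k) s) \<le> B * real (Suc k) powr (- (1 + d))" .
  qed
  moreover have "cball z d \<subseteq> {s. Re s > 1}" using Re_ge d by force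
  ultimately show "\<exists>d>0. cball z d \<subseteq> {s. Re s > 1} \<and>
      uniform_limit (cball z d) (\<lambda>N s. \<Sum>k<N. cell_integral P (Suc k) s) (cell_sum P) sequentially"
    using d by (auto simp: cell_sum_def[abs_def])
qed

lemma cell_integral_by_parts:
  assumes "continuous_on {0..1} P" "n > 0"
    and Q: "\<And>y. y \<in> {0..1} \<Longrightarrow> (Q has_vector_derivative P y) (at y within {0..1})"
  shows "cell_integral P n s = Q 1 * npw s (real n + 1) - Q 0 * npw s (real n) + s * cell_integral Q n (s + 1)"
proof -
  have Qc: "continuous_on {0..1} Q"
    using Q by (rule continuous_on_vector_derivative)
  let ?D = "\<lambda>y. P y * npw s (real n + y) - s * (Q y * npw (s + 1) (real n + y))"
  have "(?D has_integral (Q 1 * npw s (real n + 1) - Q 0 * npw s (real n + 0))) {0..1}"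
  proof (rule fundamental_theorem_of_calculus)
    fix y :: real assume y: "y \<in> {0..1}"
    have "(npw s \<circ> (\<lambda>y. real n + y) has_vector_derivative (1 *\<^sub>R (- s * npw (s + 1) (real n + y)))) (at y within {0..1})"
    proof (rule vector_diff_chain_within)
      show "((\<lambda>y. real n + y) has_vector_derivative 1) (at y within {0..1})"
        by (auto intro!: derivative_eq_intros)
      show "(npw s has_vector_derivative - s * npw (s + 1) (real n + y)) (at (real n + y) within (\<lambda>y. real n + y) ` {0..1})"
        using y assms(2) by (intro has_vector_derivative_npw) auto
    qed
    then have "((\<lambda>y. npw s (real n + y)) has_vector_derivative (- s * npw (s + 1) (real n + y))) (at y within {0..1})"
      by (simp add: o_def)
    from has_vector_derivative_mult[OF Q[OF y] this]
    show "((\<lambda>y. Q y * npw s (real n + y)) has_vector_derivative ?D y) (at y within {0..1})"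
      by (simp add: algebra_simps)
  qed simp
  moreover have "(?D has_integral (cell_integral P n s - s * cell_integral Q n (s + 1))) {0..1}"
    unfolding cell_integral_def
    by (intro has_integral_diff has_integral_mult_right integrable_integral cell_integrable assms Qc)
  ultimately have "cell_integral P n s - s * cell_integral Q n (s + 1) = Q 1 * npw s (real n + 1) - Q 0 * npw s (real n + 0)"
    by (rule has_integral_unique[rotated])
  then show ?thesis by (simp add: algebra_simps)
qed

lemma npw_tendsto_0: "Re s > 0 \<Longrightarrow> (\<lambda>k. npw s (real (Suc k))) \<longlonglongrightarrow> 0"
proof -
  assume s: "Re s > 0"
  have "(\<lambda>k. real (Suc k) powr (- Re s)) \<longlonglongrightarrow> 0" using s by real_asymp
  then have "(\<lambda>k. norm (npw s (real (Suc k)))) \<longlonglongrightarrow> 0" by (simp add: norm_npw)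
  then show ?thesis by (rule tendsto_norm_zero_cancel)
qed

lemma npw_telescope_sums:
  "Re s > 0 \<Longrightarrow> (\<lambda>k. npw s (real (Suc k) + 1) - npw s (real (Suc k))) sums (- 1)"
  using telescope_sums[OF npw_tendsto_0[of s]] by (simp add: add.commute)

text \<open>For an antiderivative with equal end values the boundary terms of neighbouring cells cancel. The sum
  on the right converges for \<open>Re s > 0\<close>, one unit further to the left than the one on the left.\<close>
lemma cell_sum_by_parts:
  assumes "continuous_on {0..1} P" "Re s > 1"
    and Q: "\<And>y. y \<in> {0..1} \<Longrightarrow> (Q has_vector_derivative P y) (at y within {0..1})" and "Q 0 = Q 1"
  shows "cell_sum P s = - Q 0 + s * cell_sum Q (s + 1)"
proof -
  have Qc: "continuous_on {0..1} Q"
    using Q by (rule continuous_on_vector_derivative)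
  have "(\<lambda>k. Q 0 * (npw s (real (Suc k) + 1) - npw s (real (Suc k))) + s * cell_integral Q (Suc k) (s + 1))
      sums (Q 0 * (- 1) + s * cell_sum Q (s + 1))"
    unfolding cell_sum_def using assms Qc
    by (intro sums_add sums_mult npw_telescope_sums summable_sums summable_cell_integral) auto
  also have "(\<lambda>k. Q 0 * (npw s (real (Suc k) + 1) - npw s (real (Suc k))) + s * cell_integral Q (Suc k) (s + 1))
     = (\<lambda>k. cell_integral P (Suc k) s)"
    using assms by (intro ext, subst cell_integral_by_parts[OF assms(1) _ Q]) (auto simp: algebra_simps)
  finally show ?thesis by (simp add: cell_sum_def sums_iff)
qed

text \<open>The constant of integration is spent on making the mean vanish again, so that integration by parts
  can be repeated.\<close>
lemma mean_zero_antiderivative: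
  fixes P :: "real \<Rightarrow> complex"
  assumes "continuous_on {0..1} P" "integral {0..1} P = 0"
  obtains Q where "\<And>y. y \<in> {0..1} \<Longrightarrow> (Q has_vector_derivative P y) (at y within {0..1})"
    "Q 0 = Q 1" "continuous_on {0..1} Q" "integral {0..1} Q = 0"
proof -
  define R where "R = (\<lambda>y. integral {0..y} P)"
  define Q where "Q = (\<lambda>y. R y - integral {0..1} R)"
  have R: "(R has_vector_derivative P y) (at y within {0..1})" if "y \<in> {0..1}" for y
    unfolding R_def using assms(1) that by (rule integral_has_vector_derivative)
  have Rc: "continuous_on {0..1} R"
    using R by (rule continuous_on_vector_derivative)
  show ?thesis
  proof (rule that)
    show "(Q has_vector_derivative P y) (at y within {0..1})" if "y \<in> {0..1}" for y
      unfolding Q_def using R[OF that] by (auto intro!: derivative_eq_intros)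
    show "Q 0 = Q 1" using assms(2) by (simp add: Q_def R_def)
    show "continuous_on {0..1} Q" unfolding Q_def by (intro continuous_intros Rc)
    show "integral {0..1} Q = 0" unfolding Q_def
      using Rc by (subst integral_diff) (auto intro!: integrable_continuous_real)
  qed
qed

text \<open>Each integration by parts gains one unit. The induction has to run over all functions of mean zero,
  because a step replaces \<open>P\<close> by its antiderivative.\<close>
lemma cell_sum_extends_to_halfplane:
  fixes P :: "real \<Rightarrow> complex"
  assumes "continuous_on {0..1} P" "integral {0..1} P = 0"
  shows "\<exists>f. f holomorphic_on {s. Re s > 1 - real k} \<and> (\<forall>s. Re s > 1 \<longrightarrow> f s = cell_sum P s)"
  using assms
proof (induction k arbitrary: P)
  case 0
  then show ?case using cell_sum_holomorphic by auto
next
  case (Suc k)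
  obtain Q where Q: "\<And>y. y \<in> {0..1} \<Longrightarrow> (Q has_vector_derivative P y) (at y within {0..1})"
    "Q 0 = Q 1" "continuous_on {0..1} Q" "integral {0..1} Q = 0"
    using mean_zero_antiderivative[OF Suc.prems] by metis
  obtain g where g: "g holomorphic_on {s. Re s > 1 - real k}" "\<And>s. Re s > 1 \<Longrightarrow> g s = cell_sum Q s"
    using Suc.IH[OF Q(3,4)] by blast
  have "(\<lambda>s. - Q 0 + s * g (s + 1)) holomorphic_on {s. Re s > 1 - real (Suc k)}"
    by (intro holomorphic_intros holomorphic_on_compose_gen[OF _ g(1), unfolded o_def]) auto
  moreover have "- Q 0 + s * g (s + 1) = cell_sum P s" if "Re s > 1" for s
    using cell_sum_by_parts[OF Suc.prems(1) that Q(1,2)] g(2)[of "s + 1"] that by simp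
  ultimately show ?case by blast
qed

text \<open>The extensions to the half-planes agree where two of them are defined, by the identity theorem; every
  point lies in the half-plane of index \<open>2 - Re s\<close>, rounded up.\<close>
lemma cell_sum_extends_entire:
  fixes P :: "real \<Rightarrow> complex"
  assumes "continuous_on {0..1} P" "integral {0..1} P = 0"
  shows "\<exists>f. f holomorphic_on UNIV \<and> (\<forall>s. Re s > 1 \<longrightarrow> f s = cell_sum P s)"
proof -
  let ?H = "\<lambda>k. {s. Re s > 1 - real k}"
  obtain g where g: "\<And>k. g k holomorphic_on ?H k" "\<And>k s. Re s > 1 \<Longrightarrow> g k s = cell_sum P s"
    using cell_sum_extends_to_halfplane[OF assms] by metis
  have agree: "g k s = g m s" if s: "Re s > 1 - real k" "k \<le> m" for k m s
  proof (rule analytic_continuation_open[of "{s. Re s > 1}" "?H k" "g k" "g m"])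
    show "open {s. Re s > 1}" "open (?H k)" by (rule open_halfspace_Re_gt)+
    show "{s. Re s > 1} \<noteq> {}" by (auto intro: exI[of _ 2])
    show "connected (?H k)" by (intro convex_connected convex_halfspace_Re_gt)
    show "{s. Re s > 1} \<subseteq> ?H k" by auto
    show "g k holomorphic_on ?H k" by (rule g)
    show "g m holomorphic_on ?H k" using that by (intro holomorphic_on_subset[OF g(1)]) auto
  qed (use g s in auto)
  define f where "f s = g (nat \<lceil>2 - Re s\<rceil>) s" for s
  have fg: "f s = g k s" if "s \<in> ?H k" for k s
  proof -
    define m where "m = nat \<lceil>2 - Re s\<rceil>"
    have m: "Re s > 1 - real m" unfolding m_def by linarith
    have fm: "f s = g m s" unfolding f_def m_def ..
    show ?thesis
    proof (cases "k \<le> m")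
      case True
      have "g k s = g m s" by (rule agree) (use that True in auto)
      then show ?thesis by (simp only: fm)
    next
      case False
      have "g m s = g k s" by (rule agree) (use m False in auto)
      then show ?thesis by (simp only: fm)
    qed
  qed
  have "f holomorphic_on (\<Union>k. ?H k)"
  proof (rule holomorphic_on_UN_open)
    show "f holomorphic_on ?H k" for k
      by (rule holomorphic_transform[OF g(1)]) (use fg in auto)
    show "open (?H k)" for k by (rule open_halfspace_Re_gt)
  qed
  moreover have "(\<Union>k. ?H k) = UNIV"
  proof -
    have "s \<in> ?H (nat \<lceil>2 - Re s\<rceil>)" for s by simp linarith
    then show ?thesis by blast
  qed
  moreover have "f s = cell_sum P s" if "Re s > 1" for s using fg[of s 0] g(2) that by auto
  ultimately show ?thesis by auto
qed

lemma cell_integral_one: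
  "n > 0 \<Longrightarrow> (1 - s) * cell_integral (\<lambda>_. 1) n s = npw (s - 1) (real n + 1) - npw (s - 1) (real n)"
  using cell_integral_by_parts[of "\<lambda>_. 0" n "\<lambda>_. 1" "s - 1"]
  by (simp add: cell_integral_def algebra_simps)

text \<open>Integration by parts against \<open>y - 1\<close>, which vanishes at the right end of the cell: the first step of
  Euler--Maclaurin summation.\<close>
lemma npw_eq_cell_integrals:
  assumes "n > 0"
  shows "npw s (real n) = cell_integral (\<lambda>_. 1) n s + s * cell_integral (\<lambda>y. 1 - of_real y) n (s + 1)"
proof -
  have "((\<lambda>y. of_real y - 1 :: complex) has_vector_derivative 1) (at y within {0..1})" for y :: real
    by (auto intro!: derivative_eq_intros)
  from cell_integral_by_parts[OF _ assms this, of s]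
  have "cell_integral (\<lambda>_. 1) n s = npw s (real n) + s * cell_integral (\<lambda>y. of_real y - 1) n (s + 1)"
    by simp
  moreover have "cell_integral (\<lambda>y. of_real y - 1) n (s + 1) = - cell_integral (\<lambda>y. 1 - of_real y) n (s + 1)"
    unfolding cell_integral_def integral_neg[symmetric] by (simp add: algebra_simps)
  ultimately show ?thesis by simp
qed

lemma cell_sum_one:
  assumes "Re s > 1"
  shows "cell_sum (\<lambda>_. 1) s = 1 / (s - 1)"
proof -
  have s1: "s \<noteq> 1" using assms by auto
  have "(\<lambda>k. (npw (s - 1) (real (Suc k) + 1) - npw (s - 1) (real (Suc k))) / (1 - s)) sums (- 1 / (1 - s))"
    using assms by (intro sums_divide npw_telescope_sums) auto
  also have "(\<lambda>k. (npw (s - 1) (real (Suc k) + 1) - npw (s - 1) (real (Suc k))) / (1 - s))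
    = (\<lambda>k. cell_integral (\<lambda>_. 1) (Suc k) s)"
  proof
    fix k
    show "(npw (s - 1) (real (Suc k) + 1) - npw (s - 1) (real (Suc k))) / (1 - s) = cell_integral (\<lambda>_. 1) (Suc k) s"
      unfolding cell_integral_one[OF zero_less_Suc, of s k, symmetric] using s1 by simp
  qed
  also have "- 1 / (1 - s) = 1 / (s - 1)" using s1 by (simp add: divide_simps)
  finally show ?thesis by (simp add: cell_sum_def sums_iff)
qed

lemma cell_sum_sawtooth:
  assumes "Re w > 1"
  shows "cell_sum (\<lambda>y. 1 - of_real y) w = cell_sum (\<lambda>y. 1 / 2 - of_real y) w + 1 / (2 * (w - 1))"
proof -
  have c: "continuous_on {0..1} (\<lambda>y::real. 1 / 2 - of_real y :: complex)" by (intro continuous_intros)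
  have "(\<lambda>k. cell_integral (\<lambda>y. 1 / 2 - of_real y) (Suc k) w + 1 / 2 * cell_integral (\<lambda>_. 1) (Suc k) w)
     sums (cell_sum (\<lambda>y. 1 / 2 - of_real y) w + 1 / 2 * cell_sum (\<lambda>_. 1) w)"
    unfolding cell_sum_def using assms c
    by (intro sums_add sums_mult summable_sums summable_cell_integral) auto
  also have "(\<lambda>k. cell_integral (\<lambda>y. 1 / 2 - of_real y) (Suc k) w + 1 / 2 * cell_integral (\<lambda>_. 1) (Suc k) w)
     = (\<lambda>k. cell_integral (\<lambda>y. 1 - of_real y) (Suc k) w)"
  proof
    fix k
    let ?E = "\<lambda>y. npw w (real (Suc k) + y)"
    have "((\<lambda>y. (1 / 2 - of_real y) * ?E y + 1 / 2 * (1 * ?E y)) has_integral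
        (cell_integral (\<lambda>y. 1 / 2 - of_real y) (Suc k) w + 1 / 2 * cell_integral (\<lambda>_. 1) (Suc k) w)) {0..1}"
      unfolding cell_integral_def
      by (intro has_integral_add has_integral_mult_right integrable_integral cell_integrable c) auto
    also have "(\<lambda>y. (1 / 2 - of_real y) * ?E y + 1 / 2 * (1 * ?E y)) = (\<lambda>y. (1 - of_real y) * ?E y)"
      by (simp add: algebra_simps)
    finally show "cell_integral (\<lambda>y. 1 / 2 - of_real y) (Suc k) w + 1 / 2 * cell_integral (\<lambda>_. 1) (Suc k) w
      = cell_integral (\<lambda>y. 1 - of_real y) (Suc k) w"
      unfolding cell_integral_def[of "\<lambda>y. 1 - of_real y"] by (rule integral_unique[symmetric])
  qed
  finally show ?thesis using cell_sum_one[OF assms] by (simp add: cell_sum_def sums_iff)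
qed

lemma zeta_dirichlet_sums:
  assumes "Re s > 1"
  shows "(\<lambda>n. 1 / of_nat (Suc n) powr s) sums (1 / (s - 1) + s * cell_sum (\<lambda>y. 1 - of_real y) (s + 1))"
proof -
  have "(\<lambda>k. cell_integral (\<lambda>_. 1) (Suc k) s + s * cell_integral (\<lambda>y. 1 - of_real y) (Suc k) (s + 1))
     sums (cell_sum (\<lambda>_. 1) s + s * cell_sum (\<lambda>y. 1 - of_real y) (s + 1))"
    unfolding cell_sum_def using assms
    by (intro sums_add sums_mult summable_sums summable_cell_integral continuous_intros) auto
  then show ?thesis
    unfolding inverse_powr_eq_npw using cell_sum_one[OF assms]
    by (subst npw_eq_cell_integrals) auto
qed

text \<open>The sawtooth \<open>1 - y\<close> has mean \<open>1/2\<close>. Subtracting the mean leaves \<open>1/2 - y\<close>, whose cell sum is entire,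
  and contributes the elementary term \<open>1/(2s)\<close>, which the factor \<open>s\<close> turns into the constant \<open>1/2\<close>.\<close>
lemma zeta_exists:
  "\<exists>f. f holomorphic_on - {1} \<and> f 1 = 0 \<and> (\<forall>s. Re s > 1 \<longrightarrow> (\<lambda>n. 1 / of_nat (Suc n) powr s) sums f s) \<and>
     (\<forall>s. Re s > 0 \<longrightarrow> s \<noteq> 1 \<longrightarrow> f s = 1 / (s - 1) + s * cell_sum (\<lambda>y. 1 - of_real y) (s + 1))"
proof -
  have "((\<lambda>y::real. 1 / 2 - y) has_integral ((1 / 2 - 1\<^sup>2 / 2) - (0 / 2 - 0\<^sup>2 / 2))) {0..1}"
    by (rule fundamental_theorem_of_calculus)
       (auto intro!: derivative_eq_intros simp: has_real_derivative_iff_has_vector_derivative[symmetric])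
  from has_integral_linear[OF this bounded_linear_of_real[where 'a = complex]]
  have "integral {0..1} (\<lambda>y::real. 1 / 2 - of_real y :: complex) = 0"
    by (simp add: o_def integral_unique)
  moreover have "continuous_on {0..1} (\<lambda>y::real. 1 / 2 - of_real y :: complex)"
    by (intro continuous_intros)
  ultimately obtain g where g: "g holomorphic_on UNIV" "\<And>s. Re s > 1 \<Longrightarrow> g s = cell_sum (\<lambda>y. 1 / 2 - of_real y) s"
    using cell_sum_extends_entire[of "\<lambda>y. 1 / 2 - of_real y"] by blast
  define f where "f s = (if s = 1 then 0 else 1 / (s - 1) + 1 / 2 + s * g (s + 1))" for s
  have f: "f s = 1 / (s - 1) + s * cell_sum (\<lambda>y. 1 - of_real y) (s + 1)" if "Re s > 0" "s \<noteq> 1" for s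
  proof -
    have "s \<noteq> 0" using that by auto
    moreover have "g (s + 1) = cell_sum (\<lambda>y. 1 - of_real y) (s + 1) - 1 / (2 * s)"
      using g(2)[of "s + 1"] cell_sum_sawtooth[of "s + 1"] that by simp
    ultimately show ?thesis using that by (simp add: f_def ring_distribs)
  qed
  have "(\<lambda>s. 1 / (s - 1) + 1 / 2 + s * g (s + 1)) holomorphic_on - {1}"
    by (intro holomorphic_intros holomorphic_on_compose_gen[OF _ g(1), unfolded o_def]) auto
  then have "f holomorphic_on - {1}"
    by (rule holomorphic_transform) (auto simp: f_def)
  moreover have "(\<lambda>n. 1 / of_nat (Suc n) powr s) sums f s" if "Re s > 1" for s
    using zeta_dirichlet_sums[OF that] f[of s] that by (cases "s = 1") auto
  ultimately show ?thesis using f by (intro exI[of _ f]) (auto simp: f_def)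
qed

lemma zeta_facts:
  "zeta holomorphic_on - {1}"
  "Re s > 0 \<Longrightarrow> s \<noteq> 1 \<Longrightarrow> zeta s = 1 / (s - 1) + s * cell_sum (\<lambda>y. 1 - of_real y) (s + 1)"
proof -
  obtain f where f: "f holomorphic_on - {1}" "f 1 = 0"
      "\<And>s. Re s > 1 \<Longrightarrow> (\<lambda>n. 1 / of_nat (Suc n) powr s) sums f s"
      "\<And>s. Re s > 0 \<Longrightarrow> s \<noteq> 1 \<Longrightarrow> f s = 1 / (s - 1) + s * cell_sum (\<lambda>y. 1 - of_real y) (s + 1)"
    using zeta_exists by blast
  have "zeta = f" unfolding zeta_def
  proof (rule the_equality)
    show "f holomorphic_on - {1} \<and> f 1 = 0 \<and> (\<forall>s. Re s > 1 \<longrightarrow> (\<lambda>n. 1 / of_nat (Suc n) powr s) sums f s)"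
      using f by blast
    fix h assume h: "h holomorphic_on - {1} \<and> h 1 = 0 \<and> (\<forall>s. Re s > 1 \<longrightarrow> (\<lambda>n. 1 / of_nat (Suc n) powr s) sums h s)"
    have "h s = f s" if "s \<noteq> 1" for s
    proof (rule analytic_continuation_open[of "{s. Re s > 1}" "- {1}" h f])
      show "open {s. Re s > 1}" by (rule open_halfspace_Re_gt)
      show "{s. Re s > 1} \<noteq> {}" by (auto intro: exI[of _ 2])
      show "connected (- {1::complex})" by (intro connected_punctured_universe) auto
      show "h z = f z" if "z \<in> {s. Re s > 1}" for z
        using that h f(3) sums_unique2 by blast
    qed (use h f that in auto)
    then show "h = f" using h f(2) by (metis ext)
  qed
  with f show "zeta holomorphic_on - {1}"
    "Re s > 0 \<Longrightarrow> s \<noteq> 1 \<Longrightarrow> zeta s = 1 / (s - 1) + s * cell_sum (\<lambda>y. 1 - of_real y) (s + 1)" by auto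
qed

text \<open>The error is the tail of the cell sum of the sawtooth, hence of a convergent series. As \<open>N\<close> will
  tend to infinity with everything else fixed, convergence of the tail to \<open>0\<close> suffices.\<close>
lemma zeta_truncation:
  "\<exists>\<tau>::nat \<Rightarrow> real. \<tau> \<longlonglongrightarrow> 0 \<and> (\<forall>N s. Re s = 1 / 2 \<longrightarrow>
     norm (zeta s - (\<Sum>n=1..N. npw s (real n)) + npw (s - 1) (real N + 1) / (1 - s)) \<le> norm s * \<tau> N)"
proof (intro exI conjI allI impI)
  let ?a = "\<lambda>k. real (Suc k) powr (- (3/2))"
  have sa: "summable ?a" by (intro summable_Suc_powr) auto
  show "(\<lambda>N. \<Sum>k. ?a (k + N)) \<longlonglongrightarrow> 0" using suminf_exist_split2[OF sa] .
  fix N and s :: complex assume s: "Re s = 1 / 2"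
  have s1: "s \<noteq> 1" using s by auto
  let ?q = "\<lambda>k. cell_integral (\<lambda>y. 1 - of_real y) (Suc k) (s + 1)"
  have sq: "summable ?q" using s by (intro summable_cell_integral continuous_intros) auto
  have "(\<Sum>n=1..N. npw s (real n)) = (\<Sum>k<N. npw s (real (Suc k)))"
    by (rule sum.reindex_bij_witness[of _ Suc "\<lambda>n. n - 1"]) auto
  also have "\<dots> = (\<Sum>k<N. cell_integral (\<lambda>_. 1) (Suc k) s) + s * (\<Sum>k<N. ?q k)"
    unfolding sum_distrib_left sum.distrib[symmetric] by (intro sum.cong refl npw_eq_cell_integrals) simp
  also have "(\<Sum>k<N. cell_integral (\<lambda>_. 1) (Suc k) s) = (npw (s - 1) (real N + 1) - 1) / (1 - s)"
  proof -
    have "(\<Sum>k<N. cell_integral (\<lambda>_. 1) (Suc k) s)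
        = (\<Sum>k<N. (npw (s - 1) (real (Suc (Suc k))) - npw (s - 1) (real (Suc k))) / (1 - s))"
      using s1 cell_integral_one[of "Suc _" s] by (intro sum.cong refl) (simp add: field_simps)
    also have "\<dots> = (npw (s - 1) (real (Suc N)) - npw (s - 1) (real (Suc 0))) / (1 - s)"
      unfolding sum_divide_distrib[symmetric] by (subst sum_lessThan_telescope) simp
    finally show ?thesis by (simp add: add.commute)
  qed
  finally have "(\<Sum>n=1..N. npw s (real n)) = (npw (s - 1) (real N + 1) - 1) / (1 - s) + s * (\<Sum>k<N. ?q k)" .
  then have "zeta s - (\<Sum>n=1..N. npw s (real n)) + npw (s - 1) (real N + 1) / (1 - s)
     = s * (cell_sum (\<lambda>y. 1 - of_real y) (s + 1) - (\<Sum>k<N. ?q k))"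
  proof -
    have "1 / (s - 1) = - (1 / (1 - s))" using s1 by (simp add: divide_simps)
    moreover have "zeta s = 1 / (s - 1) + s * cell_sum (\<lambda>y. 1 - of_real y) (s + 1)"
      using s s1 by (intro zeta_facts(2)) auto
    moreover note \<open>(\<Sum>n=1..N. npw s (real n)) = (npw (s - 1) (real N + 1) - 1) / (1 - s) + s * (\<Sum>k<N. ?q k)\<close>
    ultimately show ?thesis by (simp add: diff_divide_distrib right_diff_distrib)
  qed
  also have "cell_sum (\<lambda>y. 1 - of_real y) (s + 1) - (\<Sum>k<N. ?q k) = (\<Sum>k. ?q (k + N))"
    unfolding cell_sum_def using suminf_split_initial_segment[OF sq, of N] by simp
  also have "norm (s * (\<Sum>k. ?q (k + N))) \<le> norm s * (\<Sum>k. ?a (k + N))"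
    unfolding norm_mult
  proof (intro mult_left_mono)
    have c: "continuous_on {0..1} (\<lambda>y::real. 1 - of_real y :: complex)" by (intro continuous_intros)
    have b: "norm (1 - of_real y :: complex) \<le> 1" if "y \<in> {0..1}" for y :: real
    proof -
      have "norm (1 - of_real y :: complex) = norm (of_real (1 - y) :: complex)" by simp
      also have "\<dots> = \<bar>1 - y\<bar>" by (rule norm_of_real)
      finally show ?thesis using that by simp
    qed
    have le: "norm (?q k) \<le> ?a k" for k
    proof -
      have "norm (?q k) \<le> 1 * real (Suc k) powr (- Re (s + 1))"
        using s by (intro norm_cell_integral_le c b) auto
      then show ?thesis using s by simp
    qed
    show "norm (\<Sum>k. ?q (k + N)) \<le> (\<Sum>k. ?a (k + N))"
      by (rule norm_suminf_le[OF le summable_ignore_initial_segment[OF sa]])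
  qed auto
  finally show "norm (zeta s - (\<Sum>n=1..N. npw s (real n)) + npw (s - 1) (real N + 1) / (1 - s))
      \<le> norm s * (\<Sum>k. ?a (k + N))" .
qed

section \<open>Gaussian averages along the critical line\<close>

text \<open>The characteristic function of the normal distribution, split into real and imaginary parts.\<close>
lemma std_normal_cos_sin:
  shows "integrable lborel (\<lambda>x. std_normal_density x * cos (u * x))"
    and "integrable lborel (\<lambda>x. std_normal_density x * sin (u * x))"
    and "(\<integral>x. std_normal_density x * cos (u * x) \<partial>lborel) = exp (- u\<^sup>2 / 2)"
    and "(\<integral>x. std_normal_density x * sin (u * x) \<partial>lborel) = 0"
proof -
  have m: "integrable lborel (\<lambda>x. std_normal_density x)" by simp
  show i: "integrable lborel (\<lambda>x. std_normal_density x * cos (u * x))"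
    by (rule Bochner_Integration.integrable_bound[OF m])
       (auto simp: abs_mult mult_left_le normal_density_nonneg)
  show i': "integrable lborel (\<lambda>x. std_normal_density x * sin (u * x))"
    by (rule Bochner_Integration.integrable_bound[OF m])
       (auto simp: abs_mult mult_left_le normal_density_nonneg)
  have "char std_normal_distribution u = (\<integral>x. std_normal_density x *\<^sub>R iexp (u * x) \<partial>lborel)"
    unfolding char_def by (subst integral_density) (auto simp: normal_density_nonneg)
  also have "(\<lambda>x. std_normal_density x *\<^sub>R iexp (u * x))
     = (\<lambda>x. Complex (std_normal_density x * cos (u * x)) (std_normal_density x * sin (u * x)))"
    by (auto simp: fun_eq_iff complex_eq_iff Re_exp Im_exp)
  also have "(\<integral>x. Complex (std_normal_density x * cos (u * x)) (std_normal_density x * sin (u * x)) \<partial>lborel)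
     = Complex (\<integral>x. std_normal_density x * cos (u * x) \<partial>lborel) (\<integral>x. std_normal_density x * sin (u * x) \<partial>lborel)"
  proof -
    have "(\<lambda>x. Complex (std_normal_density x * cos (u * x)) (std_normal_density x * sin (u * x)))
      = (\<lambda>x. of_real (std_normal_density x * cos (u * x)) + \<i> * of_real (std_normal_density x * sin (u * x)))"
      by (simp add: Complex_eq)
    then show ?thesis
      using i i' by (simp add: Bochner_Integration.integral_add Complex_eq del: of_real_mult)
  qed
  finally have "Complex (\<integral>x. std_normal_density x * cos (u * x) \<partial>lborel) (\<integral>x. std_normal_density x * sin (u * x) \<partial>lborel)
      = of_real (exp (- u\<^sup>2 / 2))"
    by (simp add: char_std_normal_distribution)
  then show "(\<integral>x. std_normal_density x * cos (u * x) \<partial>lborel) = exp (- u\<^sup>2 / 2)"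
    "(\<integral>x. std_normal_density x * sin (u * x) \<partial>lborel) = 0"
    by (auto simp: complex_eq_iff)
qed

lemma std_normal_cos_shift:
  shows "integrable lborel (\<lambda>x. std_normal_density x * cos (v * (t + x / a)))"
    and "(\<integral>x. std_normal_density x * cos (v * (t + x / a)) \<partial>lborel) = exp (- v\<^sup>2 / (2 * a\<^sup>2)) * cos (v * t)"
proof -
  have e: "(\<lambda>x. std_normal_density x * cos (v * (t + x / a)))
    = (\<lambda>x. cos (v * t) * (std_normal_density x * cos ((v / a) * x)) - sin (v * t) * (std_normal_density x * sin ((v / a) * x)))"
    by (simp add: fun_eq_iff ring_distribs cos_add mult_ac)
  show "integrable lborel (\<lambda>x. std_normal_density x * cos (v * (t + x / a)))"
    unfolding e by (intro Bochner_Integration.integrable_diff integrable_mult_right std_normal_cos_sin)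
  show "(\<integral>x. std_normal_density x * cos (v * (t + x / a)) \<partial>lborel) = exp (- v\<^sup>2 / (2 * a\<^sup>2)) * cos (v * t)"
    unfolding e
    by (simp only: Bochner_Integration.integral_diff[OF integrable_mult_right[OF std_normal_cos_sin(1)]
          integrable_mult_right[OF std_normal_cos_sin(2)]] integral_mult_right_zero std_normal_cos_sin(3,4))
       (simp add: power_divide)
qed

definition zre :: "real \<Rightarrow> real" where
  "zre w = Re (zeta (1 / 2 + \<i> * of_real w))"

lemma half_line_neq_1: "1 / 2 + \<i> * of_real w \<noteq> (1::complex)"
  by (auto simp: complex_eq_iff)

lemma zre_continuous [continuous_intros]: "continuous_on A zre"
proof -
  have "continuous_on A (\<lambda>w. zeta (1 / 2 + \<i> * of_real w))"
    by (rule continuous_on_compose2[OF holomorphic_on_imp_continuous_on[OF zeta_facts(1)]])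
       (use half_line_neq_1 in \<open>auto intro!: continuous_intros\<close>)
  then show ?thesis unfolding zre_def[abs_def] by (intro continuous_intros)
qed

lemma norm_half_line_le: "norm (1 / 2 + \<i> * of_real w :: complex) \<le> 1 / 2 + \<bar>w\<bar>"
  using norm_triangle_ineq[of "1/2" "\<i> * of_real w"] by (simp add: norm_mult)

lemma zre_linear_bound: "\<exists>C\<ge>1. \<forall>w. \<bar>zre w\<bar> \<le> C * (1 + \<bar>w\<bar>)"
proof -
  obtain \<tau> where \<tau>: "\<And>N s. Re s = 1 / 2 \<Longrightarrow>
     norm (zeta s - (\<Sum>n=1..N. npw s (real n)) + npw (s - 1) (real N + 1) / (1 - s)) \<le> norm s * (\<tau> N :: real)"
    using zeta_truncation by blast
  have "\<bar>zre w\<bar> \<le> (2 + \<bar>\<tau> 0\<bar>) * (1 + \<bar>w\<bar>)" for w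
  proof -
    define s where "s = 1 / 2 + \<i> * of_real w"
    have s: "Re s = 1 / 2" by (simp add: s_def)
    have "\<bar>zre w\<bar> \<le> norm (zeta s)" unfolding zre_def s_def by (rule abs_Re_le_cmod)
    also have "zeta s = (zeta s + 1 / (1 - s)) - 1 / (1 - s)" by simp
    also have "norm \<dots> \<le> norm (zeta s + 1 / (1 - s)) + norm (1 / (1 - s))" by (rule norm_triangle_ineq4)
    also have "norm (zeta s + 1 / (1 - s)) \<le> norm s * \<tau> 0" using \<tau>[OF s, of 0] by simp
    also have "norm s * \<tau> 0 \<le> norm s * \<bar>\<tau> 0\<bar>" by (intro mult_left_mono) auto
    also have "\<dots> \<le> (1 / 2 + \<bar>w\<bar>) * \<bar>\<tau> 0\<bar>"
      using norm_half_line_le[of w] by (intro mult_right_mono) (auto simp: s_def)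
    also have "norm (1 / (1 - s)) \<le> 2"
    proof -
      have "1 / 2 \<le> norm (1 - s)" using complex_Re_le_cmod[of "1 - s"] s by simp
      then show ?thesis by (simp add: norm_divide divide_simps)
    qed
    also have "(1 / 2 + \<bar>w\<bar>) * \<bar>\<tau> 0\<bar> + 2 \<le> (1 + \<bar>w\<bar>) * \<bar>\<tau> 0\<bar> + 2 * (1 + \<bar>w\<bar>)"
      by (intro add_mono mult_right_mono) auto
    finally show ?thesis by (simp add: algebra_simps)
  qed
  then show ?thesis by (intro exI[of _ "2 + \<bar>\<tau> 0\<bar>"]) auto
qed

abbreviation pole_waves :: "real \<Rightarrow> real \<Rightarrow> real" where
  "pole_waves L w \<equiv> (\<integral>v. indicator {0..L} v * (exp (v / 2) * cos (v * w)) \<partial>lborel)"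

text \<open>Writes the pole term of the truncated series as a superposition of the waves \<open>cos (v w)\<close>, to which a
  Gaussian average can be applied wave by wave.\<close>
lemma truncated_pole_eq_integral:
  assumes "0 \<le> L"
  shows "Re (exp ((1 / 2 - \<i> * of_real w) * of_real L) / (1 / 2 - \<i> * of_real w))
    = Re (1 / (1 / 2 - \<i> * of_real w)) + pole_waves L w"
proof -
  define z :: complex where "z = 1 / 2 - \<i> * of_real w"
  have z0: "z \<noteq> 0" by (auto simp: z_def complex_eq_iff)
  have d: "((\<lambda>v. Re (exp (z * of_real v) / z)) has_vector_derivative (exp (v / 2) * cos (v * w))) (at v within {0..L})" for v
  proof -
    have "((\<lambda>v. exp (z * of_real v) / z) has_vector_derivative exp (z * of_real v)) (at v within {0..L})"
      by (rule has_vector_derivative_real_field) (use z0 in \<open>auto intro!: derivative_eq_intros\<close>)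
    then have "((\<lambda>v. Re (exp (z * of_real v) / z)) has_vector_derivative Re (exp (z * of_real v))) (at v within {0..L})"
      by (rule bounded_linear.has_vector_derivative[OF bounded_linear_Re])
    then show ?thesis by (simp add: Re_exp z_def mult.commute)
  qed
  have "(\<integral>v. indicator {0..L} v *\<^sub>R (exp (v / 2) * cos (v * w)) \<partial>lborel)
      = Re (exp (z * of_real L) / z) - Re (exp (z * of_real 0) / z)"
    by (rule integral_FTC_atLeastAtMost[OF assms d]) (auto intro!: continuous_intros)
  then show ?thesis by (simp add: z_def)
qed

lemma abs_integral_cos_le:
  fixes t a b :: real
  assumes "t > 0" "a \<le> b"
  shows "\<bar>integral {a..b} (\<lambda>v. cos (v * t))\<bar> \<le> 2 / t"
proof -
  have "((\<lambda>v. cos (v * t)) has_integral (sin (b * t) / t - sin (a * t) / t)) {a..b}"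
    using assms by (intro fundamental_theorem_of_calculus)
      (auto intro!: derivative_eq_intros simp: has_real_derivative_iff_has_vector_derivative[symmetric])
  then have "integral {a..b} (\<lambda>v. cos (v * t)) = (sin (b * t) - sin (a * t)) / t"
    by (simp add: integral_unique diff_divide_distrib)
  moreover have "\<bar>sin (b * t) - sin (a * t)\<bar> \<le> 2"
    using abs_sin_le_one[of "b * t"] abs_sin_le_one[of "a * t"] by linarith
  ultimately show ?thesis using assms by (simp add: divide_right_mono)
qed

lemma abs_integral_mono_cos_le:
  fixes t a b :: real
  assumes "t > 0" "a \<le> b" and g: "\<And>x y. a \<le> x \<Longrightarrow> x \<le> y \<Longrightarrow> y \<le> b \<Longrightarrow> g x \<le> g y"
    and bd: "\<bar>g a\<bar> \<le> B" "\<bar>g b\<bar> \<le> B"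
  shows "\<bar>integral {a..b} (\<lambda>v. g v * cos (v * t))\<bar> \<le> 4 * B / t"
proof -
  have I: "(\<lambda>v. cos (v * t)) integrable_on {a..b}"
    by (intro integrable_continuous_real continuous_intros)
  obtain c where c: "c \<in> {a..b}"
    "integral {a..b} (\<lambda>v. g v * cos (v * t)) = g a * integral {a..c} (\<lambda>v. cos (v * t)) + g b * integral {c..b} (\<lambda>v. cos (v * t))"
    by (rule second_mean_value_theorem[OF I assms(2) g]) auto
  have "\<bar>integral {a..b} (\<lambda>v. g v * cos (v * t))\<bar>
      \<le> \<bar>g a\<bar> * \<bar>integral {a..c} (\<lambda>v. cos (v * t))\<bar> + \<bar>g b\<bar> * \<bar>integral {c..b} (\<lambda>v. cos (v * t))\<bar>"
    unfolding c(2) abs_mult[symmetric] by (rule abs_triangle_ineq)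
  also have "\<dots> \<le> B * (2 / t) + B * (2 / t)"
    using c(1) assms by (intro add_mono mult_mono abs_integral_cos_le) auto
  finally show ?thesis by simp
qed

text \<open>The exponent is \<open>a^2/8\<close> minus a square centred at \<open>a^2/2\<close>. So the amplitude is monotone on either side
  of \<open>a^2/2\<close>, and the second mean value theorem bounds the oscillating integral on each side by its
  maximum \<open>exp (a^2/8)\<close> divided by the frequency.\<close>
lemma gaussian_tilt_oscillation:
  fixes t a L :: real
  assumes "t > 0" "a > 0" "a\<^sup>2 / 2 \<le> L"
  shows "\<bar>integral {0..L} (\<lambda>v. exp (v / 2 - v\<^sup>2 / (2 * a\<^sup>2)) * cos (v * t))\<bar> \<le> 8 * exp (a\<^sup>2 / 8) / t"
proof -
  define m where "m = a\<^sup>2 / 2"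
  define g where "g v = exp (v / 2 - v\<^sup>2 / (2 * a\<^sup>2))" for v
  have sq: "v / 2 - v\<^sup>2 / (2 * a\<^sup>2) = a\<^sup>2 / 8 - (v - m)\<^sup>2 / (2 * a\<^sup>2)" for v
    using assms by (simp add: m_def field_simps power2_eq_square)
  have gle: "\<bar>g v\<bar> \<le> exp (a\<^sup>2 / 8)" for v by (simp add: g_def sq)
  have m0: "0 \<le> m" "m \<le> L" using assms by (auto simp: m_def)
  have up: "g x \<le> g y" if "x \<le> y" "y \<le> m" for x y
  proof -
    have "(y - m)\<^sup>2 \<le> (x - m)\<^sup>2" using that by (simp add: abs_le_square_iff[symmetric])
    then show ?thesis using assms by (simp add: g_def sq divide_right_mono)
  qed
  have dn: "g y \<le> g x" if "m \<le> x" "x \<le> y" for x y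
  proof -
    have "(x - m)\<^sup>2 \<le> (y - m)\<^sup>2" using that by (intro power_mono) auto
    then show ?thesis using assms by (simp add: g_def sq divide_right_mono)
  qed
  have I: "(\<lambda>v. g v * cos (v * t)) integrable_on {0..L}"
    unfolding g_def using assms by (intro integrable_continuous_real continuous_intros) auto
  have "integral {0..L} (\<lambda>v. g v * cos (v * t))
      = integral {0..m} (\<lambda>v. g v * cos (v * t)) + integral {m..L} (\<lambda>v. g v * cos (v * t))"
    using m0 I by (intro Henstock_Kurzweil_Integration.integral_combine[symmetric])
  moreover have "\<bar>integral {0..m} (\<lambda>v. g v * cos (v * t))\<bar> \<le> 4 * exp (a\<^sup>2 / 8) / t"
    using assms m0 gle up by (intro abs_integral_mono_cos_le) auto
  moreover have "\<bar>integral {m..L} (\<lambda>v. (- g v) * cos (v * t))\<bar> \<le> 4 * exp (a\<^sup>2 / 8) / t"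
    using assms m0 gle dn by (intro abs_integral_mono_cos_le) auto
  ultimately show ?thesis unfolding g_def by simp
qed

text \<open>Interchanging the two integrations damps the wave of frequency \<open>v\<close> by \<open>exp (-v^2/(2 a^2))\<close>.\<close>
lemma std_normal_truncated_pole:
  assumes "L \<ge> 0"
  shows "integrable lborel (\<lambda>x. std_normal_density x * pole_waves L (t + x / a))"
    and "(\<integral>x. std_normal_density x * pole_waves L (t + x / a) \<partial>lborel)
     = integral {0..L} (\<lambda>v. exp (v / 2 - v\<^sup>2 / (2 * a\<^sup>2)) * cos (v * t))"
proof -
  define h where "h v = indicator {0..L} v * exp (v / 2)" for v :: real
  have hi: "integrable lborel h"
  proof -
    have "continuous_on {0..L} (\<lambda>v::real. exp (v / 2))" by (intro continuous_intros) auto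
    from borel_integrable_atLeastAtMost'[OF this] show ?thesis
      by (simp add: set_integrable_def h_def[abs_def])
  qed
  have h0: "0 \<le> h v" for v by (simp add: h_def)
  have hm[measurable]: "h \<in> borel_measurable borel" unfolding h_def[abs_def] by measurable
  define f where "f x v = std_normal_density x * (h v * cos (v * (t + x / a)))" for x v
  have fm[measurable]: "(\<lambda>p. f (fst p) (snd p)) \<in> borel_measurable (lborel \<Otimes>\<^sub>M lborel)"
    unfolding f_def by measurable
  have dom: "integrable (lborel \<Otimes>\<^sub>M lborel) (\<lambda>p. std_normal_density (fst p) * h (snd p))"
  proof (rule lborel_pair.Fubini_integrable)
    show "integrable lborel (\<lambda>x. \<integral>y. norm (std_normal_density (fst (x, y)) * h (snd (x, y))) \<partial>lborel)"
      by (simp add: abs_mult h0 normal_density_nonneg)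
    show "AE x in lborel. integrable lborel (\<lambda>y. std_normal_density (fst (x, y)) * h (snd (x, y)))"
      using hi by simp
  qed measurable
  have fi: "integrable (lborel \<Otimes>\<^sub>M lborel) (\<lambda>(x, v). f x v)"
  proof (rule Bochner_Integration.integrable_bound[OF dom])
    show "AE p in lborel \<Otimes>\<^sub>M lborel. norm (case p of (x, v) \<Rightarrow> f x v) \<le> norm (std_normal_density (fst p) * h (snd p))"
    proof (rule AE_I2)
      fix p :: "real \<times> real"
      obtain x v where p: "p = (x, v)" by (cases p)
      have "std_normal_density x * (h v * \<bar>cos (v * (t + x / a))\<bar>) \<le> std_normal_density x * h v"
        by (intro mult_left_mono mult_left_le) (auto simp: h0 normal_density_nonneg)
      then show "norm (case p of (x, v) \<Rightarrow> f x v) \<le> norm (std_normal_density (fst p) * h (snd p))"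
        by (simp add: p f_def abs_mult h0 normal_density_nonneg)
    qed
  qed (use fm in \<open>simp add: split_def\<close>)
  have inner: "(\<integral>v. f x v \<partial>lborel)
     = std_normal_density x * pole_waves L (t + x / a)" for x
    unfolding f_def h_def by (simp add: mult.assoc)
  show "integrable lborel (\<lambda>x. std_normal_density x * pole_waves L (t + x / a))"
    using lborel_pair.integrable_fst[OF fi] unfolding inner .
  have "(\<integral>x. (\<integral>v. f x v \<partial>lborel) \<partial>lborel) = (\<integral>v. (\<integral>x. f x v \<partial>lborel) \<partial>lborel)"
    using lborel_pair.Fubini_integral[OF fi] by simp
  also have "(\<lambda>v. \<integral>x. f x v \<partial>lborel) = (\<lambda>v. indicator {0..L} v *\<^sub>R (exp (v / 2 - v\<^sup>2 / (2 * a\<^sup>2)) * cos (v * t)))"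
  proof
    fix v
    have "(\<integral>x. f x v \<partial>lborel) = (\<integral>x. h v * (std_normal_density x * cos (v * (t + x / a))) \<partial>lborel)"
      unfolding f_def by (simp add: mult_ac)
    also have "\<dots> = h v * (exp (- v\<^sup>2 / (2 * a\<^sup>2)) * cos (v * t))"
      by (simp only: integral_mult_right_zero std_normal_cos_shift)
    finally have fv: "(\<integral>x. f x v \<partial>lborel) = h v * (exp (- v\<^sup>2 / (2 * a\<^sup>2)) * cos (v * t))" .
    show "(\<integral>x. f x v \<partial>lborel) = indicator {0..L} v *\<^sub>R (exp (v / 2 - v\<^sup>2 / (2 * a\<^sup>2)) * cos (v * t))"
    proof -
      have "exp (v / 2 - v\<^sup>2 / (2 * a\<^sup>2)) = exp (v / 2) * exp (- v\<^sup>2 / (2 * a\<^sup>2))"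
        by (simp add: exp_add[symmetric])
      then show ?thesis by (simp add: h_def fv)
    qed
  qed
  also have "(\<integral>v. indicator {0..L} v *\<^sub>R (exp (v / 2 - v\<^sup>2 / (2 * a\<^sup>2)) * cos (v * t)) \<partial>lborel)
     = integral {0..L} (\<lambda>v. exp (v / 2 - v\<^sup>2 / (2 * a\<^sup>2)) * cos (v * t))"
  proof -
    have "set_integrable lborel {0..L} (\<lambda>v. exp (v / 2 - v\<^sup>2 / (2 * a\<^sup>2)) * cos (v * t))"
    proof (cases "a = 0")
      case True
      then show ?thesis by (intro borel_integrable_atLeastAtMost') (auto intro!: continuous_intros)
    qed (intro borel_integrable_atLeastAtMost' continuous_intros, auto)
    from set_borel_integral_eq_integral(2)[OF this] show ?thesis by (simp add: set_lebesgue_integral_def)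
  qed
  finally show "(\<integral>x. std_normal_density x * pole_waves L (t + x / a) \<partial>lborel)
     = integral {0..L} (\<lambda>v. exp (v / 2 - v\<^sup>2 / (2 * a\<^sup>2)) * cos (v * t))"
    unfolding inner .
qed


lemma zre_truncation:
  "\<exists>\<tau>::nat \<Rightarrow> real. \<tau> \<longlonglongrightarrow> 0 \<and> (\<forall>N w.
     \<bar>zre w - ((\<Sum>n=1..N. cos (ln (real n) * w) / sqrt (real n)) - Re (1 / (1 / 2 - \<i> * of_real w))
        - pole_waves (ln (real N + 1)) w)\<bar> \<le> (1 / 2 + \<bar>w\<bar>) * \<tau> N)"
proof -
  obtain \<tau> :: "nat \<Rightarrow> real" where \<tau>: "\<tau> \<longlonglongrightarrow> 0" "\<And>N s. Re s = 1 / 2 \<Longrightarrow>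
     norm (zeta s - (\<Sum>n=1..N. npw s (real n)) + npw (s - 1) (real N + 1) / (1 - s)) \<le> norm s * (\<tau> N)"
    using zeta_truncation by blast
  show ?thesis
  proof (intro exI[of _ "\<lambda>N. \<bar>\<tau> N\<bar>"] conjI allI)
    show "(\<lambda>N. \<bar>\<tau> N\<bar>) \<longlonglongrightarrow> 0" using \<tau>(1) by (rule tendsto_rabs_zero)
    fix N w
    define s where "s = 1 / 2 + \<i> * of_real w"
    define L where "L = ln (real N + 1)"
    have L: "L \<ge> 0" by (simp add: L_def)
    have s: "Re s = 1 / 2" by (simp add: s_def)
    have t: "Re (npw s (real n)) = cos (ln (real n) * w) / sqrt (real n)" if "n \<in> {1..N}" for n
    proof -
      have "Re (npw s (real n)) = exp (- (ln (real n) / 2)) * cos (ln (real n) * w)"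
        by (simp add: npw_def Re_exp s_def mult.commute)
      also have "exp (- (ln (real n) / 2)) = 1 / sqrt (real n)"
        using that by (simp add: exp_minus ln_sqrt[symmetric] field_simps)
      finally show ?thesis by simp
    qed
    have "npw (s - 1) (real N + 1) / (1 - s)
        = exp ((1 / 2 - \<i> * of_real w) * of_real L) / (1 / 2 - \<i> * of_real w)"
      by (simp add: npw_def s_def L_def algebra_simps)
    then have p: "Re (npw (s - 1) (real N + 1) / (1 - s)) = Re (1 / (1 / 2 - \<i> * of_real w))
        + pole_waves L w"
      by (simp only: truncated_pole_eq_integral[OF L])
    have "zre w - ((\<Sum>n=1..N. cos (ln (real n) * w) / sqrt (real n)) - Re (1 / (1 / 2 - \<i> * of_real w))
        - pole_waves L w)
      = Re (zeta s - (\<Sum>n=1..N. npw s (real n)) + npw (s - 1) (real N + 1) / (1 - s))"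
      using p t by (simp add: zre_def s_def[symmetric])
    also have "\<bar>\<dots>\<bar> \<le> norm s * \<tau> N" using abs_Re_le_cmod \<tau>(2)[OF s, of N] by (rule order_trans)
    also have "\<dots> \<le> norm s * \<bar>\<tau> N\<bar>" by (intro mult_left_mono) auto
    also have "\<dots> \<le> (1 / 2 + \<bar>w\<bar>) * \<bar>\<tau> N\<bar>"
      using norm_half_line_le[of w] by (intro mult_right_mono) (auto simp: s_def)
    finally show "\<bar>zre w - ((\<Sum>n=1..N. cos (ln (real n) * w) / sqrt (real n)) - Re (1 / (1 / 2 - \<i> * of_real w))
        - pole_waves (ln (real N + 1)) w)\<bar> \<le> (1 / 2 + \<bar>w\<bar>) * \<bar>\<tau> N\<bar>"
      unfolding L_def .
  qed
qed

abbreviation log_gauss :: "real \<Rightarrow> nat \<Rightarrow> real" where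
  "log_gauss v n \<equiv> exp (- (ln (real n))\<^sup>2 / (2 * v))"

text \<open>The cosine polynomial obtained from the real part of the Dirichlet series on the critical line by
  averaging over a Gaussian of standard deviation \<open>1/a\<close>.\<close>
definition smooth_sum :: "real \<Rightarrow> nat \<Rightarrow> real \<Rightarrow> real" where
  "smooth_sum a N t = (\<Sum>n=1..N. log_gauss (a\<^sup>2) n / sqrt (real n) * cos (ln (real n) * t))"

lemma std_normal_linear_growth:
  fixes F :: "real \<Rightarrow> real"
  assumes "F \<in> borel_measurable borel" "\<And>x. \<bar>F x\<bar> \<le> A + B * \<bar>x\<bar>" "0 \<le> B"
  shows "integrable lborel (\<lambda>x. std_normal_density x * F x)"
    and "\<bar>\<integral>x. std_normal_density x * F x \<partial>lborel\<bar> \<le> A + B"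
proof -
  have i0: "integrable lborel (\<lambda>x. std_normal_density x)" by simp
  have i1: "integrable lborel (\<lambda>x. std_normal_density x * \<bar>x\<bar>)"
    using integrable_std_normal_moment_abs[of 1] by simp
  have m1: "(\<integral>x. std_normal_density x * \<bar>x\<bar> \<partial>lborel) \<le> 1"
  proof -
    have "(\<integral>x. std_normal_density x * \<bar>x\<bar> \<partial>lborel) = sqrt (2 / pi)"
      using integral_std_normal_moment_abs_odd[of 0] by simp
    also have "\<dots> \<le> 1" using pi_gt3 by simp
    finally show ?thesis .
  qed
  have i: "integrable lborel (\<lambda>x. A * std_normal_density x + B * (std_normal_density x * \<bar>x\<bar>))"
    by (intro Bochner_Integration.integrable_add integrable_mult_right i0 i1)
  have bd: "\<bar>std_normal_density x * F x\<bar> \<le> A * std_normal_density x + B * (std_normal_density x * \<bar>x\<bar>)" for x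
    using mult_left_mono[OF assms(2)[of x] normal_density_nonneg[of 0 1 x]]
    by (simp add: abs_mult normal_density_nonneg algebra_simps)
  show int: "integrable lborel (\<lambda>x. std_normal_density x * F x)"
    by (rule Bochner_Integration.integrable_bound[OF i]) (use assms(1) bd in \<open>auto intro: order_trans[OF _ abs_ge_self]\<close>)
  have "\<bar>\<integral>x. std_normal_density x * F x \<partial>lborel\<bar> \<le> (\<integral>x. \<bar>std_normal_density x * F x\<bar> \<partial>lborel)"
    by (rule integral_abs_bound)
  also have "\<dots> \<le> (\<integral>x. A * std_normal_density x + B * (std_normal_density x * \<bar>x\<bar>) \<partial>lborel)"
    by (intro integral_mono integrable_abs int i bd)
  also have "\<dots> = A + B * (\<integral>x. std_normal_density x * \<bar>x\<bar> \<partial>lborel)"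
    using i0 i1 by (subst Bochner_Integration.integral_add) auto
  also have "\<dots> \<le> A + B * 1" using m1 assms(3) by (intro add_left_mono mult_left_mono)
  finally show "\<bar>\<integral>x. std_normal_density x * F x \<partial>lborel\<bar> \<le> A + B" by simp
qed

lemma zre_measurable [measurable]: "zre \<in> borel_measurable borel"
  by (intro borel_measurable_continuous_onI zre_continuous)

lemma abs_add_divide_le: "a \<ge> 1 \<Longrightarrow> \<bar>t + x / a\<bar> \<le> \<bar>t\<bar> + \<bar>x :: real\<bar>"
proof -
  assume a: "a \<ge> 1"
  have "\<bar>t + x / a\<bar> \<le> \<bar>t\<bar> + \<bar>x\<bar> / a" using a abs_triangle_ineq[of t "x / a"] by (simp add: abs_divide)
  also have "\<bar>x\<bar> / a \<le> \<bar>x\<bar> / 1" using a by (intro divide_left_mono) auto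
  finally show ?thesis by simp
qed

abbreviation zre_average :: "real \<Rightarrow> real \<Rightarrow> real" where
  "zre_average a t \<equiv> (\<integral>x. std_normal_density x * zre (t + x / a) \<partial>lborel)"

lemma zre_shift_integrable:
  assumes "a \<ge> 1"
  shows "integrable lborel (\<lambda>x. std_normal_density x * zre (t + x / a))"
proof -
  obtain C where C: "C \<ge> 1" "\<And>w. \<bar>zre w\<bar> \<le> C * (1 + \<bar>w\<bar>)" using zre_linear_bound by blast
  show ?thesis
  proof (rule std_normal_linear_growth(1)[where A = "C * (1 + \<bar>t\<bar>)" and B = C])
    fix x
    have "C * (1 + \<bar>t + x / a\<bar>) \<le> C * (1 + (\<bar>t\<bar> + \<bar>x\<bar>))" using C(1) abs_add_divide_le[OF assms, of t x] by (intro mult_left_mono) auto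
    then show "\<bar>zre (t + x / a)\<bar> \<le> C * (1 + \<bar>t\<bar>) + C * \<bar>x\<bar>"
      using C(2)[of "t + x / a"] by (simp add: algebra_simps)
  qed (use C in auto)
qed

text \<open>Averages the truncated series for zeta. The pole term costs the bound of \<open>gaussian_tilt_oscillation\<close>
  and a bounded end contribution, and \<open>N\<close> is taken so large that the remainder is at most \<open>1\<close> for all
  \<open>t \<le> R\<close> at once.\<close>
lemma smooth_sum_approximates_zre_average:
  assumes a: "a \<ge> 1" and "R \<ge> 0"
  shows "\<exists>N\<^sub>0. \<forall>N\<ge>N\<^sub>0. \<forall>t. 0 < t \<and> t \<le> R \<longrightarrow>
     \<bar>smooth_sum a N t - zre_average a t\<bar> \<le> 3 + 8 * exp (a\<^sup>2 / 8) / t"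
proof -
  obtain \<tau> :: "nat \<Rightarrow> real" where \<tau>: "\<tau> \<longlonglongrightarrow> 0" "\<And>N w.
     \<bar>zre w - ((\<Sum>n=1..N. cos (ln (real n) * w) / sqrt (real n)) - Re (1 / (1 / 2 - \<i> * of_real w))
        - pole_waves (ln (real N + 1)) w)\<bar> \<le> (1 / 2 + \<bar>w\<bar>) * \<tau> N"
    using zre_truncation by blast
  have "\<forall>\<^sub>F N in sequentially. \<tau> N < 1 / (2 + R)"
    using \<tau>(1) assms by (intro order_tendstoD) auto
  moreover have "\<forall>\<^sub>F N in sequentially. ln (real N + 1) \<ge> a\<^sup>2 / 2" by real_asymp
  ultimately obtain N\<^sub>0 where N0: "\<And>N. N \<ge> N\<^sub>0 \<Longrightarrow> \<tau> N < 1 / (2 + R)" "\<And>N. N \<ge> N\<^sub>0 \<Longrightarrow> ln (real N + 1) \<ge> a\<^sup>2 / 2"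
    unfolding eventually_sequentially by (metis le_trans linorder_le_cases)
  show ?thesis
  proof (intro exI allI impI)
    fix N t assume N: "N \<ge> N\<^sub>0" and t: "0 < t \<and> t \<le> R"
    define L where "L = ln (real N + 1)"
    have L: "L \<ge> 0" "a\<^sup>2 / 2 \<le> L" using N0(2)[OF N] by (auto simp: L_def)
    let ?S = "\<lambda>w. \<Sum>n=1..N. cos (ln (real n) * w) / sqrt (real n)"
    let ?p = "\<lambda>w. Re (1 / (1 / 2 - \<i> * of_real w))"
    let ?q = "\<lambda>w. \<integral>v. indicator {0..L} v * (exp (v / 2) * cos (v * w)) \<partial>lborel"
    let ?\<phi> = std_normal_density
    define E where "E w = zre w - (?S w - ?p w - ?q w)" for w
    have \<tau>0: "0 \<le> \<tau> N"
    proof -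
      have "0 \<le> (1 / 2 + \<bar>0\<bar>) * \<tau> N" using \<tau>(2)[of 0 N] by (rule order_trans[OF abs_ge_zero])
      then show ?thesis by simp
    qed
    have pm [measurable]: "?p \<in> borel_measurable borel"
      by (intro borel_measurable_continuous_onI continuous_intros) (auto simp: complex_eq_iff)
    have pb: "\<bar>?p w\<bar> \<le> 2" for w
    proof -
      have "1 / 2 \<le> norm (1 / 2 - \<i> * of_real w)" using complex_Re_le_cmod[of "1 / 2 - \<i> * of_real w"] by simp
      then have "norm (1 / (1 / 2 - \<i> * of_real w)) \<le> 2" by (simp add: norm_divide divide_simps)
      then show ?thesis using abs_Re_le_cmod order_trans by blast
    qed
    have I1: "integrable lborel (\<lambda>x. ?\<phi> x * ?S (t + x / a))"
      unfolding sum_distrib_left times_divide_eq_right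
      by (intro Bochner_Integration.integrable_sum Bochner_Integration.integrable_divide std_normal_cos_shift(1))
    have V1: "(\<integral>x. ?\<phi> x * ?S (t + x / a) \<partial>lborel) = smooth_sum a N t"
      unfolding sum_distrib_left times_divide_eq_right smooth_sum_def
      by (subst Bochner_Integration.integral_sum)
         (auto intro!: Bochner_Integration.integrable_divide std_normal_cos_shift(1) sum.cong simp: std_normal_cos_shift(2))
    have pm': "(\<lambda>x. ?p (t + x / a)) \<in> borel_measurable borel"
      by (rule measurable_compose[OF _ pm]) measurable
    have pb': "\<bar>?p (t + x / a)\<bar> \<le> 2 + 0 * \<bar>x\<bar>" for x
      using pb[of "t + x / a"] by (simp only: mult_zero_left add_0_right)
    note G = std_normal_linear_growth[OF pm' pb' order_refl]
    have I2: "integrable lborel (\<lambda>x. ?\<phi> x * ?p (t + x / a))" by (rule G(1))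
    have V2: "\<bar>\<integral>x. ?\<phi> x * ?p (t + x / a) \<partial>lborel\<bar> \<le> 2" using G(2) by (simp only: add_0_right)
    have I3: "integrable lborel (\<lambda>x. ?\<phi> x * ?q (t + x / a))"
      and V3: "\<bar>\<integral>x. ?\<phi> x * ?q (t + x / a) \<partial>lborel\<bar> \<le> 8 * exp (a\<^sup>2 / 8) / t"
      using std_normal_truncated_pole[OF L(1), of t a] gaussian_tilt_oscillation[of t a L] t a L by auto
    have I0: "integrable lborel (\<lambda>x. ?\<phi> x * zre (t + x / a))" by (rule zre_shift_integrable[OF a])
    have eqE: "?\<phi> x * E (t + x / a) = ?\<phi> x * zre (t + x / a)
        - (?\<phi> x * ?S (t + x / a) - ?\<phi> x * ?p (t + x / a) - ?\<phi> x * ?q (t + x / a))" for x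
      unfolding E_def by (simp only: right_diff_distrib)
    have IE: "integrable lborel (\<lambda>x. ?\<phi> x * E (t + x / a))"
      unfolding eqE by (intro Bochner_Integration.integrable_diff I0 I1 I2 I3)
    have VE: "(\<integral>x. ?\<phi> x * E (t + x / a) \<partial>lborel) = zre_average a t
        - (smooth_sum a N t - (\<integral>x. ?\<phi> x * ?p (t + x / a) \<partial>lborel) - (\<integral>x. ?\<phi> x * ?q (t + x / a) \<partial>lborel))"
      unfolding eqE
      by (simp only: Bochner_Integration.integral_diff[OF I0 Bochner_Integration.integrable_diff[OF Bochner_Integration.integrable_diff[OF I1 I2] I3]]
         Bochner_Integration.integral_diff[OF Bochner_Integration.integrable_diff[OF I1 I2] I3]
         Bochner_Integration.integral_diff[OF I1 I2] V1)
    have Eb: "\<bar>E (t + x / a)\<bar> \<le> (1 / 2 + R) * \<tau> N + \<tau> N * \<bar>x\<bar>" for x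
    proof -
      have "1 / 2 + \<bar>t + x / a\<bar> \<le> (1 / 2 + R) + \<bar>x\<bar>" using t abs_add_divide_le[OF a, of t x] by simp
      then have "(1 / 2 + \<bar>t + x / a\<bar>) * \<tau> N \<le> ((1 / 2 + R) + \<bar>x\<bar>) * \<tau> N"
        using \<tau>0 by (rule mult_right_mono)
      then show ?thesis using \<tau>(2)[of "t + x / a" N] unfolding E_def L_def by (simp add: algebra_simps)
    qed
    have "\<bar>\<integral>x. ?\<phi> x * E (t + x / a) \<partial>lborel\<bar> \<le> (\<integral>x. \<bar>?\<phi> x * E (t + x / a)\<bar> \<partial>lborel)"
      by (rule integral_abs_bound)
    also have "\<dots> \<le> (\<integral>x. ?\<phi> x * ((1 / 2 + R) * \<tau> N + \<tau> N * \<bar>x\<bar>) \<partial>lborel)"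
    proof (intro integral_mono integrable_abs IE)
      show "integrable lborel (\<lambda>x. ?\<phi> x * ((1 / 2 + R) * \<tau> N + \<tau> N * \<bar>x\<bar>))"
        using \<tau>0 assms by (intro std_normal_linear_growth(1)[where A = "(1 / 2 + R) * \<tau> N" and B = "\<tau> N"]) auto
      show "\<bar>?\<phi> x * E (t + x / a)\<bar> \<le> ?\<phi> x * ((1 / 2 + R) * \<tau> N + \<tau> N * \<bar>x\<bar>)" for x
        using mult_left_mono[OF Eb normal_density_nonneg[of 0 1 x]] by (simp add: abs_mult normal_density_nonneg)
    qed
    also have "\<dots> \<le> (1 / 2 + R) * \<tau> N + \<tau> N"
    proof -
      have "\<bar>\<integral>x. ?\<phi> x * ((1 / 2 + R) * \<tau> N + \<tau> N * \<bar>x\<bar>) \<partial>lborel\<bar> \<le> (1 / 2 + R) * \<tau> N + \<tau> N"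
        using \<tau>0 assms by (intro std_normal_linear_growth(2)) auto
      then show ?thesis by simp
    qed
    also have "\<dots> = (3 / 2 + R) * \<tau> N" by (simp add: algebra_simps)
    also have "\<dots> \<le> (2 + R) * \<tau> N" using \<tau>0 by (intro mult_right_mono) auto
    also have "\<dots> \<le> 1" using N0(1)[OF N] assms by (simp add: field_simps)
    finally have "\<bar>\<integral>x. ?\<phi> x * E (t + x / a) \<partial>lborel\<bar> \<le> 1" .
    then show "\<bar>smooth_sum a N t - zre_average a t\<bar> \<le> 3 + 8 * exp (a\<^sup>2 / 8) / t"
      using V2 V3 unfolding VE by linarith
  qed
qed

text \<open>As long as the Gaussian variable is at most \<open>U\<close> in size, the argument stays inside \<open>[U, T]\<close>. Beyond that
  the linear growth of zeta is absorbed by one part of the Gaussian, and another part leaves the factor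
  \<open>exp (-U^2/8)\<close>.\<close>
lemma zre_average_le:
  "\<exists>C\<ge>0. \<forall>a U T V t. a \<ge> 1 \<longrightarrow> U \<ge> 1 \<longrightarrow> V \<ge> 0 \<longrightarrow> (\<forall>w\<in>{U..T}. zre w \<le> V) \<longrightarrow> 2 * U \<le> t \<longrightarrow> t \<le> T / 2 \<longrightarrow>
     zre_average a t \<le> V + C * (1 + T) * exp (- U\<^sup>2 / 8)"
proof -
  obtain C where C: "C \<ge> 1" "\<And>w. \<bar>zre w\<bar> \<le> C * (1 + \<bar>w\<bar>)" using zre_linear_bound by blast
  show ?thesis
  proof (intro exI conjI allI impI)
    show "0 \<le> 3 * sqrt 2 * C" using C by simp
    fix a U T V t :: real
    assume a: "a \<ge> 1" and U: "U \<ge> 1" and V: "V \<ge> 0" and le: "\<forall>w\<in>{U..T}. zre w \<le> V" and t: "2 * U \<le> t" "t \<le> T / 2"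
    \<comment> \<open>The constant is 3 from \<open>1 + |x| \<le> 3 exp (x^2/8)\<close>, and \<open>sqrt 2\<close> from comparing the two normal densities.\<close>
    define K where "K = 3 * sqrt 2 * C * (1 + T) * exp (- U\<^sup>2 / 8)"
    have T: "T > 0" using t U by simp
    have pt: "std_normal_density x * zre (t + x / a) \<le> V * std_normal_density x + K * normal_density 0 (sqrt 2) x" for x
    proof (cases "\<bar>x\<bar> \<le> U")
      case True
      have "\<bar>x / a\<bar> \<le> U" using True abs_add_divide_le[OF a, of 0 x] by simp
      then have "- U \<le> x / a" "x / a \<le> U" unfolding abs_le_iff by linarith+
      then have "t + x / a \<in> {U..T}" using t U unfolding atLeastAtMost_iff by linarith
      then have "std_normal_density x * zre (t + x / a) \<le> std_normal_density x * V"
        using le by (intro mult_left_mono normal_density_nonneg) auto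
      moreover have "0 \<le> K * normal_density 0 (sqrt 2) x"
        using C T by (simp add: K_def normal_density_nonneg)
      ultimately show ?thesis by (simp add: mult.commute)
    next
      case False
      have "1 + \<bar>t + x / a\<bar> \<le> 1 + T + \<bar>x\<bar>" using t U abs_add_divide_le[OF a, of t x] by simp
      also have "\<dots> \<le> (1 + T) * (1 + \<bar>x\<bar>)" using T by (simp add: algebra_simps)
      also have "1 + \<bar>x\<bar> \<le> 3 * exp (x\<^sup>2 / 8)"
      proof -
        have "0 \<le> (\<bar>x\<bar> - 2)\<^sup>2" by simp
        then have "\<bar>x\<bar> \<le> 1 + x\<^sup>2 / 4" by (simp add: power2_diff)
        then have "1 + \<bar>x\<bar> \<le> 3 * (1 + x\<^sup>2 / 8)" by simp
        also have "\<dots> \<le> 3 * exp (x\<^sup>2 / 8)" by (intro mult_left_mono exp_ge_add_one_self) auto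
        finally show ?thesis .
      qed
      finally have 1: "1 + \<bar>t + x / a\<bar> \<le> (1 + T) * (3 * exp (x\<^sup>2 / 8))" using T by (simp add: mult_left_mono)
      have "zre (t + x / a) \<le> C * (1 + \<bar>t + x / a\<bar>)" using C(2)[of "t + x / a"] by simp
      also have "\<dots> \<le> C * ((1 + T) * (3 * exp (x\<^sup>2 / 8)))" using 1 C by (intro mult_left_mono) auto
      also have "\<dots> \<le> C * ((1 + T) * (3 * exp (x\<^sup>2 / 8))) * exp (x\<^sup>2 / 8 - U\<^sup>2 / 8)"
      proof -
        have "U\<^sup>2 \<le> \<bar>x\<bar>\<^sup>2" using False U by (intro power_mono) auto
        then have "1 \<le> exp (x\<^sup>2 / 8 - U\<^sup>2 / 8)" by simp
        moreover have "0 \<le> C * ((1 + T) * (3 * exp (x\<^sup>2 / 8)))" using C T by simp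
        ultimately have "C * ((1 + T) * (3 * exp (x\<^sup>2 / 8))) * 1
            \<le> C * ((1 + T) * (3 * exp (x\<^sup>2 / 8))) * exp (x\<^sup>2 / 8 - U\<^sup>2 / 8)"
          by (rule mult_left_mono)
        then show ?thesis by (simp only: mult_1_right)
      qed
      finally have "std_normal_density x * zre (t + x / a)
         \<le> std_normal_density x * (C * ((1 + T) * (3 * exp (x\<^sup>2 / 8))) * exp (x\<^sup>2 / 8 - U\<^sup>2 / 8))"
        by (intro mult_left_mono normal_density_nonneg)
      also have "\<dots> = K * normal_density 0 (sqrt 2) x"
      proof -
        define e where "e = exp (- x\<^sup>2 / 2) * (exp (x\<^sup>2 / 8) * exp (x\<^sup>2 / 8 - U\<^sup>2 / 8))"
        have e: "e = exp (- U\<^sup>2 / 8) * exp (- x\<^sup>2 / 4)"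
          unfolding e_def exp_add[symmetric] by (rule arg_cong[of _ _ exp]) (simp add: field_simps)
        have "normal_density 0 (sqrt 2) x = 1 / (sqrt 2 * sqrt (2 * pi)) * exp (- x\<^sup>2 / 4)"
          by (simp add: normal_density_def real_sqrt_mult)
        then have "K * normal_density 0 (sqrt 2) x = 3 * C * (1 + T) * (1 / sqrt (2 * pi)) * e"
          unfolding K_def e by simp
        then show ?thesis unfolding std_normal_density_def e_def by (simp only: mult_ac)
      qed
      finally show ?thesis using V normal_density_nonneg[of 0 1 x] by (simp add: add_increasing)
    qed
    have "zre_average a t
       \<le> (\<integral>x. V * std_normal_density x + K * normal_density 0 (sqrt 2) x \<partial>lborel)"
      by (intro integral_mono pt zre_shift_integrable a Bochner_Integration.integrable_add integrable_mult_right) auto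
    also have "\<dots> = V + K" by (subst Bochner_Integration.integral_add) auto
    finally show "zre_average a t \<le> V + 3 * sqrt 2 * C * (1 + T) * exp (- U\<^sup>2 / 8)"
      by (simp add: K_def)
  qed
qed

lemma smooth_sum_le:
  "\<exists>C\<ge>0. \<forall>a U T V. a \<ge> 1 \<longrightarrow> U \<ge> 1 \<longrightarrow> V \<ge> 0 \<longrightarrow> (\<forall>w\<in>{U..T}. zre w \<le> V) \<longrightarrow>
     (\<exists>N\<^sub>0. \<forall>N\<ge>N\<^sub>0. \<forall>t. 2 * U \<le> \<bar>t\<bar> \<longrightarrow> \<bar>t\<bar> \<le> T / 2 \<longrightarrow>
        smooth_sum a N t \<le> V + 3 + 8 * exp (a\<^sup>2 / 8) / U + C * (1 + T) * exp (- U\<^sup>2 / 8))"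
proof -
  obtain C where C: "C \<ge> 0" "\<And>a U T V t. a \<ge> 1 \<Longrightarrow> U \<ge> 1 \<Longrightarrow> V \<ge> 0 \<Longrightarrow> (\<forall>w\<in>{U..T}. zre w \<le> V) \<Longrightarrow> 2 * U \<le> t \<Longrightarrow> t \<le> T / 2 \<Longrightarrow>
     zre_average a t \<le> V + C * (1 + T) * exp (- U\<^sup>2 / 8)"
    using zre_average_le by blast
  show ?thesis
  proof (intro exI[of _ C] conjI allI impI C(1))
    fix a U T V :: real assume H: "a \<ge> 1" "U \<ge> 1" "V \<ge> 0" "\<forall>w\<in>{U..T}. zre w \<le> V"
    obtain N\<^sub>0 where N0: "\<And>N t. N \<ge> N\<^sub>0 \<Longrightarrow> 0 < t \<Longrightarrow> t \<le> \<bar>T\<bar> \<Longrightarrow>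
     \<bar>smooth_sum a N t - zre_average a t\<bar> \<le> 3 + 8 * exp (a\<^sup>2 / 8) / t"
      using smooth_sum_approximates_zre_average[OF H(1), of "\<bar>T\<bar>"] by auto
    show "\<exists>N\<^sub>0. \<forall>N\<ge>N\<^sub>0. \<forall>t. 2 * U \<le> \<bar>t\<bar> \<longrightarrow> \<bar>t\<bar> \<le> T / 2 \<longrightarrow>
        smooth_sum a N t \<le> V + 3 + 8 * exp (a\<^sup>2 / 8) / U + C * (1 + T) * exp (- U\<^sup>2 / 8)"
    proof (intro exI[of _ N\<^sub>0] allI impI)
      fix N t assume N: "N \<ge> N\<^sub>0" and t: "2 * U \<le> \<bar>t\<bar>" "\<bar>t\<bar> \<le> T / 2"
      have "smooth_sum a N \<bar>t\<bar> \<le> zre_average a \<bar>t\<bar> + (3 + 8 * exp (a\<^sup>2 / 8) / \<bar>t\<bar>)"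
        using N0[OF N, of "\<bar>t\<bar>"] t H by (simp add: abs_le_iff) linarith
      also have "\<dots> \<le> (V + C * (1 + T) * exp (- U\<^sup>2 / 8)) + (3 + 8 * exp (a\<^sup>2 / 8) / U)"
        using t H by (intro add_mono C(2) divide_left_mono) auto
      also have "smooth_sum a N \<bar>t\<bar> = smooth_sum a N t"
        unfolding smooth_sum_def by (intro sum.cong refl) (simp add: abs_if)
      finally show "smooth_sum a N t \<le> V + 3 + 8 * exp (a\<^sup>2 / 8) / U + C * (1 + T) * exp (- U\<^sup>2 / 8)"
        by simp
    qed
  qed
qed

section \<open>The resonance inequality\<close>

lemma gaussian_cos_integral:
  fixes Y \<omega> :: real
  assumes "Y > 0"
  shows "integrable lborel (\<lambda>t. exp (- t\<^sup>2 / (2 * Y\<^sup>2)) * cos (\<omega> * t))"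
    and "(\<integral>t. exp (- t\<^sup>2 / (2 * Y\<^sup>2)) * cos (\<omega> * t) \<partial>lborel) = Y * sqrt (2 * pi) * exp (- (\<omega> * Y)\<^sup>2 / 2)"
proof -
  let ?f = "\<lambda>t. exp (- t\<^sup>2 / (2 * Y\<^sup>2)) * cos (\<omega> * t)"
  have e: "?f (0 + Y * x) = sqrt (2 * pi) * (std_normal_density x * cos ((\<omega> * Y) * x))" for x
    using assms by (simp add: std_normal_density_def power_mult_distrib mult.assoc)
  have "integrable lborel (\<lambda>x. ?f (0 + Y * x))"
    unfolding e by (intro integrable_mult_right std_normal_cos_sin)
  then show "integrable lborel ?f"
    using assms lborel_integrable_real_affine_iff[of Y ?f 0] by simp
  have "(\<integral>t. ?f t \<partial>lborel) = \<bar>Y\<bar> *\<^sub>R (\<integral>x. ?f (0 + Y * x) \<partial>lborel)"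
    using assms by (intro lborel_integral_real_affine) auto
  also have "\<dots> = Y * (sqrt (2 * pi) * exp (- (\<omega> * Y)\<^sup>2 / 2))"
    unfolding e using assms by (simp add: std_normal_cos_sin)
  finally show "(\<integral>t. ?f t \<partial>lborel) = Y * sqrt (2 * pi) * exp (- (\<omega> * Y)\<^sup>2 / 2)" by simp
qed

lemma sqrt_two_pi_bounds: "2 \<le> sqrt (2 * pi)" "sqrt (2 * pi) \<le> 3"
proof -
  have "sqrt 4 \<le> sqrt (2 * pi)" using pi_gt3 by (intro real_sqrt_le_mono) simp
  then show "2 \<le> sqrt (2 * pi)" by simp
  have "sqrt (2 * pi) \<le> sqrt 9" using pi_less_4 by (intro real_sqrt_le_mono) simp
  then show "sqrt (2 * pi) \<le> 3" by simp
qed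

text \<open>This is \<open>|R(t)|^2\<close> for \<open>R(t) = \<Sum> r_j exp (i j t / Y)\<close>. Taking multiples of \<open>1/Y\<close> as frequencies keeps them
  separated on the scale of the Gaussian of width \<open>Y\<close>.\<close>
definition weight :: "real \<Rightarrow> nat set \<Rightarrow> (nat \<Rightarrow> real) \<Rightarrow> real \<Rightarrow> real" where
  "weight Y J r t = (\<Sum>j\<in>J. \<Sum>l\<in>J. r j * r l * cos ((real j - real l) / Y * t))"

lemma weight_eq_norm_square:
  "weight Y J r t = (\<Sum>j\<in>J. r j * cos (real j / Y * t))\<^sup>2 + (\<Sum>j\<in>J. r j * sin (real j / Y * t))\<^sup>2"
  unfolding weight_def power2_eq_square sum_product sum.distrib[symmetric]
  by (intro sum.cong refl) (simp add: diff_divide_distrib left_diff_distrib cos_diff algebra_simps)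

lemma weight_nonneg: "0 \<le> weight Y J r t"
  unfolding weight_eq_norm_square by simp

lemma weight_le:
  assumes "\<And>j. 0 \<le> r j"
  shows "weight Y J r t \<le> real (card J) * (\<Sum>j\<in>J. (r j)\<^sup>2)"
proof -
  have "weight Y J r t \<le> (\<Sum>j\<in>J. \<Sum>l\<in>J. r j * r l * 1)"
    unfolding weight_def using assms by (intro sum_mono mult_left_mono) auto
  also have "\<dots> = (\<Sum>j\<in>J. 1 * r j)\<^sup>2"
    by (simp add: power2_eq_square sum_product)
  also have "\<dots> \<le> (\<Sum>j\<in>J. 1\<^sup>2) * (\<Sum>j\<in>J. (r j)\<^sup>2)" by (rule Cauchy_Schwarz_ineq_sum)
  finally show ?thesis by simp
qed

text \<open>On either side of \<open>j\<close> the sum is dominated by a geometric series of ratio \<open>2/3 \<ge> exp (-1/2)\<close>.\<close>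
lemma sum_geometric_distance_le:
  assumes "finite J"
  shows "(\<Sum>l\<in>J. exp (- (real j - real l)\<^sup>2 / 2)) \<le> 6"
proof -
  define x :: real where "x = 2 / 3"
  have sx: "summable (\<lambda>k. x ^ k)" "(\<Sum>k. x ^ k) = 3"
    using suminf_geometric[of x] by (auto simp: x_def intro!: summable_geometric)
  have ex: "exp (- (1/2)) \<le> x"
  proof -
    have "3 / 2 \<le> exp (1/2 :: real)" using exp_ge_add_one_self[of "1/2"] by simp
    then have "inverse (exp (1/2)) \<le> inverse (3/2 :: real)" by (intro le_imp_inverse_le) auto
    then show ?thesis by (simp add: x_def exp_minus)
  qed
  have tb: "exp (- (real k)\<^sup>2 / 2) \<le> x ^ k" for k
  proof -
    have "real k \<le> (real k)\<^sup>2" by (cases k) (auto simp: power2_eq_square)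
    then have "exp (- (real k)\<^sup>2 / 2) \<le> exp (real k * (- (1/2)))" by simp
    also have "\<dots> = exp (- (1/2)) ^ k" by (rule exp_of_nat_mult)
    also have "\<dots> \<le> x ^ k" using ex by (intro power_mono) auto
    finally show ?thesis .
  qed
  have half: "(\<Sum>l\<in>K. exp (- (real j - real l)\<^sup>2 / 2)) \<le> 3"
    if K: "K \<subseteq> J" "inj_on d K" "\<And>l. l \<in> K \<Longrightarrow> (real j - real l)\<^sup>2 = (real (d l))\<^sup>2" for K and d :: "nat \<Rightarrow> nat"
  proof -
    have "(\<Sum>l\<in>K. exp (- (real j - real l)\<^sup>2 / 2)) \<le> (\<Sum>l\<in>K. x ^ d l)"
      using K(3) tb by (intro sum_mono) simp
    also have "\<dots> = (\<Sum>k\<in>d ` K. x ^ k)" using K(2) by (simp add: sum.reindex)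
    also have "\<dots> \<le> (\<Sum>k. x ^ k)"
      using sx(1) K(1) assms by (intro sum_le_suminf) (auto simp: x_def intro: finite_subset)
    finally show ?thesis using sx by simp
  qed
  have "(\<Sum>l\<in>J. exp (- (real j - real l)\<^sup>2 / 2))
     = (\<Sum>l\<in>{l\<in>J. j \<le> l}. exp (- (real j - real l)\<^sup>2 / 2)) + (\<Sum>l\<in>{l\<in>J. l < j}. exp (- (real j - real l)\<^sup>2 / 2))"
    using assms by (subst sum.union_disjoint[symmetric]) (auto intro!: sum.cong)
  also have "\<dots> \<le> 3 + 3"
  proof (intro add_mono)
    show "(\<Sum>l\<in>{l\<in>J. j \<le> l}. exp (- (real j - real l)\<^sup>2 / 2)) \<le> 3"
      by (rule half[of _ "\<lambda>l. l - j"]) (auto simp: inj_on_def of_nat_diff power2_commute)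
    show "(\<Sum>l\<in>{l\<in>J. l < j}. exp (- (real j - real l)\<^sup>2 / 2)) \<le> 3"
      by (rule half[of _ "\<lambda>l. j - l"]) (auto simp: inj_on_def of_nat_diff)
  qed
  finally show ?thesis by simp
qed

text \<open>The integral is a quadratic form in \<open>r\<close> whose matrix has rapidly decaying entries away from the
  diagonal, so by the inequality between arithmetic and geometric means only row sums matter.\<close>
lemma weight_gaussian_integral:
  assumes "Y > 0" "finite J" "\<And>j. 0 \<le> r j"
  shows "integrable lborel (\<lambda>t. exp (- t\<^sup>2 / (2 * Y\<^sup>2)) * weight Y J r t)"
    and "(\<integral>t. exp (- t\<^sup>2 / (2 * Y\<^sup>2)) * weight Y J r t \<partial>lborel) \<le> 18 * Y * (\<Sum>j\<in>J. (r j)\<^sup>2)"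
proof -
  let ?G = "\<lambda>t. exp (- t\<^sup>2 / (2 * Y\<^sup>2))"
  let ?e = "\<lambda>j l. exp (- (real j - real l)\<^sup>2 / 2)"
  have e: "?G t * weight Y J r t = (\<Sum>j\<in>J. \<Sum>l\<in>J. r j * r l * (?G t * cos ((real j - real l) / Y * t)))" for t
    unfolding weight_def sum_distrib_left by (intro sum.cong refl) simp
  show "integrable lborel (\<lambda>t. ?G t * weight Y J r t)"
    unfolding e by (intro Bochner_Integration.integrable_sum integrable_mult_right gaussian_cos_integral assms)
  have "(\<integral>t. ?G t * weight Y J r t \<partial>lborel)
     = (\<Sum>j\<in>J. \<Sum>l\<in>J. r j * r l * (\<integral>t. ?G t * cos ((real j - real l) / Y * t) \<partial>lborel))"
    unfolding e
    by (subst Bochner_Integration.integral_sum Bochner_Integration.integral_sum,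
        (intro Bochner_Integration.integrable_sum integrable_mult_right gaussian_cos_integral assms)+)+ simp
  also have "\<dots> = (\<Sum>j\<in>J. \<Sum>l\<in>J. r j * r l * (Y * sqrt (2 * pi) * ?e j l))"
  proof -
    have "((real j - real l) / Y * Y)\<^sup>2 = (real j - real l)\<^sup>2" for j l using assms(1) by simp
    then show ?thesis by (simp only: gaussian_cos_integral(2)[OF assms(1)])
  qed
  also have "\<dots> = Y * sqrt (2 * pi) * (\<Sum>j\<in>J. \<Sum>l\<in>J. r j * r l * ?e j l)"
    unfolding sum_distrib_left by (intro sum.cong refl) simp
  also have "(\<Sum>j\<in>J. \<Sum>l\<in>J. r j * r l * ?e j l) \<le> (\<Sum>j\<in>J. \<Sum>l\<in>J. ((r j)\<^sup>2 / 2 + (r l)\<^sup>2 / 2) * ?e j l)"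
  proof (intro sum_mono mult_right_mono)
    fix j l show "r j * r l \<le> (r j)\<^sup>2 / 2 + (r l)\<^sup>2 / 2"
      using sum_squares_bound[of "r j" "r l"] by simp
  qed auto
  also have "\<dots> = (\<Sum>j\<in>J. \<Sum>l\<in>J. (r j)\<^sup>2 / 2 * ?e j l) + (\<Sum>j\<in>J. \<Sum>l\<in>J. (r l)\<^sup>2 / 2 * ?e j l)"
    by (simp only: distrib_right sum.distrib)
  also have "(\<Sum>j\<in>J. \<Sum>l\<in>J. (r l)\<^sup>2 / 2 * ?e j l) = (\<Sum>j\<in>J. \<Sum>l\<in>J. (r j)\<^sup>2 / 2 * ?e j l)"
    by (subst sum.swap) (simp add: power2_commute)
  also have "(\<Sum>j\<in>J. \<Sum>l\<in>J. (r j)\<^sup>2 / 2 * ?e j l) + (\<Sum>j\<in>J. \<Sum>l\<in>J. (r j)\<^sup>2 / 2 * ?e j l)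
     = (\<Sum>j\<in>J. (r j)\<^sup>2 * (\<Sum>l\<in>J. ?e j l))"
    unfolding sum.distrib[symmetric] sum_distrib_left by (intro sum.cong refl) simp
  also have "\<dots> \<le> (\<Sum>j\<in>J. (r j)\<^sup>2 * 6)"
    using assms by (intro sum_mono mult_left_mono sum_geometric_distance_le) auto
  also have "Y * sqrt (2 * pi) * \<dots> \<le> Y * 3 * (\<Sum>j\<in>J. (r j)\<^sup>2 * 6)"
    using assms sqrt_two_pi_bounds by (intro mult_right_mono mult_left_mono sum_nonneg) auto
  also have "\<dots> = 18 * Y * (\<Sum>j\<in>J. (r j)\<^sup>2)" by (simp add: sum_distrib_left mult_ac)
  finally show "(\<integral>t. ?G t * weight Y J r t \<partial>lborel) \<le> 18 * Y * (\<Sum>j\<in>J. (r j)\<^sup>2)"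
    using assms by (simp add: mult_left_mono)
qed

text \<open>Every term of the expanded product has a nonnegative integral, so all may be dropped except those
  whose frequency is within \<open>1/Y\<close> of \<open>0\<close>.\<close>
lemma weight_cos_integral_ge:
  assumes Y: "Y > 0" and "finite J" "\<And>j. 0 \<le> r j"
  shows "integrable lborel (\<lambda>t. exp (- t\<^sup>2 / (2 * Y\<^sup>2)) * weight Y J r t * cos (\<alpha> * t))"
    and "(\<integral>t. exp (- t\<^sup>2 / (2 * Y\<^sup>2)) * weight Y J r t * cos (\<alpha> * t) \<partial>lborel)
        \<ge> Y / 2 * (\<Sum>(j, l)\<in>{(j, l). j \<in> J \<and> l \<in> J \<and> \<bar>Y * \<alpha> - (real l - real j)\<bar> \<le> 1}. r j * r l)"
proof -
  let ?G = "\<lambda>t. exp (- t\<^sup>2 / (2 * Y\<^sup>2))"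
  let ?g = "\<lambda>\<omega>. Y * sqrt (2 * pi) * exp (- (\<omega> * Y)\<^sup>2 / 2)"
  let ?S = "{(j, l). j \<in> J \<and> l \<in> J \<and> \<bar>Y * \<alpha> - (real l - real j)\<bar> \<le> 1}"
  let ?\<delta> = "\<lambda>j l. (real j - real l) / Y"
  have c: "cos (\<delta> * t) * cos (\<alpha> * t) = (cos ((\<delta> - \<alpha>) * t) + cos ((\<delta> + \<alpha>) * t)) / 2" for \<delta> t
    by (simp add: cos_times_cos left_diff_distrib distrib_right)
  have e: "?G t * weight Y J r t * cos (\<alpha> * t)
     = (\<Sum>j\<in>J. \<Sum>l\<in>J. r j * r l / 2 * (?G t * cos ((?\<delta> j l - \<alpha>) * t) + ?G t * cos ((?\<delta> j l + \<alpha>) * t)))" for t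
    unfolding weight_def sum_distrib_left sum_distrib_right
  proof (intro sum.cong refl)
    fix j l
    have "?G t * (r j * r l * cos (?\<delta> j l * t)) * cos (\<alpha> * t)
        = r j * r l * (?G t * (cos (?\<delta> j l * t) * cos (\<alpha> * t)))" by (simp only: mult_ac)
    then show "?G t * (r j * r l * cos (?\<delta> j l * t)) * cos (\<alpha> * t)
        = r j * r l / 2 * (?G t * cos ((?\<delta> j l - \<alpha>) * t) + ?G t * cos ((?\<delta> j l + \<alpha>) * t))"
      unfolding c by (simp add: distrib_left)
  qed
  show "integrable lborel (\<lambda>t. ?G t * weight Y J r t * cos (\<alpha> * t))"
    unfolding e by (intro Bochner_Integration.integrable_sum integrable_mult_right
        Bochner_Integration.integrable_add gaussian_cos_integral Y)
  have I: "(\<integral>t. ?G t * weight Y J r t * cos (\<alpha> * t) \<partial>lborel)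
     = (\<Sum>j\<in>J. \<Sum>l\<in>J. r j * r l / 2 * (?g (?\<delta> j l - \<alpha>) + ?g (?\<delta> j l + \<alpha>)))"
  proof -
    have i: "integrable lborel (\<lambda>t. r j * r l / 2 * (?G t * cos ((?\<delta> j l - \<alpha>) * t) + ?G t * cos ((?\<delta> j l + \<alpha>) * t)))" for j l
      by (intro integrable_mult_right Bochner_Integration.integrable_add gaussian_cos_integral Y)
    have v: "(\<integral>t. r j * r l / 2 * (?G t * cos ((?\<delta> j l - \<alpha>) * t) + ?G t * cos ((?\<delta> j l + \<alpha>) * t)) \<partial>lborel)
        = r j * r l / 2 * (?g (?\<delta> j l - \<alpha>) + ?g (?\<delta> j l + \<alpha>))" for j l
      by (simp only: integral_mult_right_zero Bochner_Integration.integral_add[OF gaussian_cos_integral(1)[OF Y] gaussian_cos_integral(1)[OF Y]]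
          gaussian_cos_integral(2)[OF Y])
    show ?thesis unfolding e
      by (simp only: Bochner_Integration.integral_sum[OF Bochner_Integration.integrable_sum[OF i]]
          Bochner_Integration.integral_sum[OF i] v)
  qed
  have g0: "0 \<le> ?g \<omega>" for \<omega> using Y by simp
  have gS: "Y \<le> ?g \<omega>" if "\<bar>\<omega> * Y\<bar> \<le> 1" for \<omega>
  proof -
    have "(\<omega> * Y)\<^sup>2 \<le> 1" using that by (simp add: abs_square_le_1)
    then have "exp (- (1/2)) \<le> exp (- (\<omega> * Y)\<^sup>2 / 2)" by simp
    moreover have "1 / 2 \<le> exp (- (1/2) :: real)" using exp_ge_add_one_self[of "- (1/2)"] by simp
    ultimately have "1 / 2 \<le> exp (- (\<omega> * Y)\<^sup>2 / 2)" by linarith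
    then have "2 * (1 / 2) \<le> sqrt (2 * pi) * exp (- (\<omega> * Y)\<^sup>2 / 2)"
      using sqrt_two_pi_bounds by (intro mult_mono) auto
    then have "Y * 1 \<le> Y * (sqrt (2 * pi) * exp (- (\<omega> * Y)\<^sup>2 / 2))" using Y by (intro mult_left_mono) auto
    then show ?thesis by (simp add: mult.assoc)
  qed
  have "Y / 2 * (\<Sum>(j, l)\<in>?S. r j * r l) = (\<Sum>(j, l)\<in>?S. r j * r l / 2 * (0 + Y))"
    by (simp add: sum_distrib_left split_def mult_ac)
  also have "\<dots> \<le> (\<Sum>(j, l)\<in>?S. r j * r l / 2 * (?g (?\<delta> j l - \<alpha>) + ?g (?\<delta> j l + \<alpha>)))"
  proof (intro sum_mono, clarify, intro mult_left_mono add_mono g0 gS)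
    fix j l assume "\<bar>Y * \<alpha> - (real l - real j)\<bar> \<le> 1"
    moreover have "(?\<delta> j l + \<alpha>) * Y = Y * \<alpha> - (real l - real j)" using Y by (simp add: field_simps)
    ultimately show "\<bar>(?\<delta> j l + \<alpha>) * Y\<bar> \<le> 1" by simp
  qed (use assms in auto)
  also have "\<dots> \<le> (\<Sum>(j, l)\<in>J \<times> J. r j * r l / 2 * (?g (?\<delta> j l - \<alpha>) + ?g (?\<delta> j l + \<alpha>)))"
    using assms g0 by (intro sum_mono2) (auto intro!: mult_nonneg_nonneg add_nonneg_nonneg)
  also have "\<dots> = (\<integral>t. ?G t * weight Y J r t * cos (\<alpha> * t) \<partial>lborel)"
    unfolding I by (simp only: sum.cartesian_product)
  finally show "(\<integral>t. ?G t * weight Y J r t * cos (\<alpha> * t) \<partial>lborel) \<ge> Y / 2 * (\<Sum>(j, l)\<in>?S. r j * r l)" .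
qed

abbreviation dilation_sum :: "nat set \<Rightarrow> (nat \<Rightarrow> real) \<Rightarrow> nat \<Rightarrow> real" where
  "dilation_sum M f n \<equiv> (\<Sum>m | m \<in> M \<and> n * m \<in> M. f m * f (n * m))"

text \<open>The elements of \<open>M\<close> may be too close to each other for their logarithms to be used as frequencies.
  They are therefore collected in bins of logarithmic length \<open>1/Y\<close>, each with the Euclidean norm of its
  weights. By the Cauchy--Schwarz inequality this does not decrease correlations, and dilation by \<open>n\<close>
  shifts the bin index by \<open>Y log n\<close> up to rounding.\<close>
lemma binned_correlation_le:
  fixes f :: "nat \<Rightarrow> real" and M :: "nat set"
  assumes Y: "Y > 0" and M: "finite M" "0 \<notin> M" and f: "\<And>m. 0 \<le> f m" and n: "1 \<le> n"
  defines "bin \<equiv> \<lambda>m. nat \<lfloor>Y * ln (real m)\<rfloor>"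
  defines "r \<equiv> \<lambda>j. sqrt (\<Sum>m | m \<in> M \<and> bin m = j. (f m)\<^sup>2)"
  shows "dilation_sum M f n
     \<le> (\<Sum>(j, l)\<in>{(j, l). j \<in> bin ` M \<and> l \<in> bin ` M \<and> \<bar>Y * ln (real n) - (real l - real j)\<bar> \<le> 1}. r j * r l)"
proof -
  define A where "A = {m. m \<in> M \<and> n * m \<in> M}"
  define S where "S = {(j, l). j \<in> bin ` M \<and> l \<in> bin ` M \<and> \<bar>Y * ln (real n) - (real l - real j)\<bar> \<le> 1}"
  have finA: "finite A" using M by (auto simp: A_def)
  have finS: "finite S" by (rule finite_subset[of _ "bin ` M \<times> bin ` M"]) (use M in \<open>auto simp: S_def\<close>)
  have bin: "real (bin m) \<le> Y * ln (real m)" "Y * ln (real m) < real (bin m) + 1" if "m \<ge> 1" for m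
  proof -
    have "0 \<le> Y * ln (real m)" using Y that by simp
    then show "real (bin m) \<le> Y * ln (real m)" "Y * ln (real m) < real (bin m) + 1"
      unfolding bin_def by linarith+
  qed
  have inS: "(bin m, bin (n * m)) \<in> S" if "m \<in> A" for m
  proof -
    have m: "m \<ge> 1" "m \<in> M" "n * m \<in> M" using that M by (auto simp: A_def intro!: Suc_leI gr0I)
    have "Y * ln (real (n * m)) = Y * ln (real n) + Y * ln (real m)"
      using m n by (simp add: ln_mult distrib_left)
    then have "\<bar>Y * ln (real n) - (real (bin (n * m)) - real (bin m))\<bar> \<le> 1"
      using bin[of m] bin[of "n * m"] m n by (simp add: abs_le_iff)
    then show ?thesis using m by (auto simp: S_def)
  qed
  have "(\<Sum>m\<in>A. f m * f (n * m)) = (\<Sum>y\<in>S. \<Sum>m\<in>{m \<in> A. (bin m, bin (n * m)) = y}. f m * f (n * m))"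
    using finA finS inS by (intro sum.group[symmetric]) auto
  also have "\<dots> \<le> (\<Sum>(j, l)\<in>S. r j * r l)"
  proof (intro sum_mono)
    fix y assume "y \<in> S"
    obtain j l where y: "y = (j, l)" by (cases y)
    let ?B = "{m \<in> A. (bin m, bin (n * m)) = y}"
    have "(\<Sum>m\<in>?B. f m * f (n * m))\<^sup>2 \<le> (\<Sum>m\<in>?B. (f m)\<^sup>2) * (\<Sum>m\<in>?B. (f (n * m))\<^sup>2)"
      by (rule Cauchy_Schwarz_ineq_sum)
    also have "\<dots> \<le> (r j)\<^sup>2 * (r l)\<^sup>2"
    proof (intro mult_mono)
      have "(\<Sum>m\<in>?B. (f m)\<^sup>2) \<le> (\<Sum>m | m \<in> M \<and> bin m = j. (f m)\<^sup>2)"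
        using M by (intro sum_mono2) (auto simp: A_def y)
      then show "(\<Sum>m\<in>?B. (f m)\<^sup>2) \<le> (r j)\<^sup>2" by (simp add: r_def sum_nonneg)
      have "(\<Sum>m\<in>?B. (f (n * m))\<^sup>2) = (\<Sum>k\<in>(\<lambda>m. n * m) ` ?B. (f k)\<^sup>2)"
        using n by (subst sum.reindex) (auto simp: inj_on_def)
      also have "\<dots> \<le> (\<Sum>m | m \<in> M \<and> bin m = l. (f m)\<^sup>2)"
        using M by (intro sum_mono2) (auto simp: A_def y)
      finally show "(\<Sum>m\<in>?B. (f (n * m))\<^sup>2) \<le> (r l)\<^sup>2" by (simp add: r_def sum_nonneg)
    qed (auto intro: sum_nonneg)
    finally have "(\<Sum>m\<in>?B. f m * f (n * m))\<^sup>2 \<le> (r j * r l)\<^sup>2" by (simp add: power_mult_distrib)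
    then have "(\<Sum>m\<in>?B. f m * f (n * m)) \<le> r j * r l"
      by (rule power2_le_imp_le) (simp add: r_def sum_nonneg)
    then show "(\<Sum>m\<in>?B. f m * f (n * m)) \<le> (case y of (j, l) \<Rightarrow> r j * r l)" by (simp add: y)
  qed
  finally show ?thesis unfolding A_def S_def .
qed

text \<open>Completing the square gives \<open>-v^2/(2 a^2) - v/2 \<le> 9 a^2/8 - 2 v\<close> for \<open>v = log n\<close>, so that the coefficients are dominated
  by those of \<open>\<Sum> 1/n^2\<close>.\<close>
lemma smooth_sum_bound:
  assumes "a > 0"
  shows "smooth_sum a N t \<le> 4 * exp (9 * a\<^sup>2 / 8)"
proof -
  have "smooth_sum a N t \<le> (\<Sum>n=1..N. exp (9 * a\<^sup>2 / 8) * (1 / (real n)\<^sup>2))"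
    unfolding smooth_sum_def
  proof (intro sum_mono)
    fix n assume n: "n \<in> {1..N}"
    define v where "v = ln (real n)"
    have ev: "exp v = real n" using n by (simp add: v_def)
    have "- v\<^sup>2 / (2 * a\<^sup>2) - v / 2 \<le> 9 * a\<^sup>2 / 8 - 2 * v"
    proof -
      have "0 \<le> (v - 3 / 2 * a\<^sup>2)\<^sup>2 / (2 * a\<^sup>2)" by simp
      also have "\<dots> = 9 * a\<^sup>2 / 8 - 2 * v + v / 2 + v\<^sup>2 / (2 * a\<^sup>2)"
        using assms by (simp add: field_simps power2_eq_square)
      finally show ?thesis by simp
    qed
    then have "exp (- v\<^sup>2 / (2 * a\<^sup>2) - v / 2) \<le> exp (9 * a\<^sup>2 / 8 - 2 * v)" by simp
    also have "exp (9 * a\<^sup>2 / 8 - 2 * v) = exp (9 * a\<^sup>2 / 8) * (1 / (real n)\<^sup>2)"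
      using ev exp_of_nat_mult[of 2 v] by (simp add: exp_diff)
    also have "exp (- v\<^sup>2 / (2 * a\<^sup>2) - v / 2) = exp (- v\<^sup>2 / (2 * a\<^sup>2)) / sqrt (real n)"
    proof -
      have "exp (v / 2) = sqrt (real n)"
      proof -
        have "(exp (v / 2))\<^sup>2 = real n" by (simp add: power2_eq_square exp_add[symmetric] ev)
        then show ?thesis by (intro real_sqrt_unique[symmetric]) auto
      qed
      then show ?thesis by (simp add: exp_diff)
    qed
    finally have le: "exp (- v\<^sup>2 / (2 * a\<^sup>2)) / sqrt (real n) \<le> exp (9 * a\<^sup>2 / 8) * (1 / (real n)\<^sup>2)" .
    have "exp (- v\<^sup>2 / (2 * a\<^sup>2)) / sqrt (real n) * cos (v * t) \<le> exp (- v\<^sup>2 / (2 * a\<^sup>2)) / sqrt (real n) * 1"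
      by (intro mult_left_mono) auto
    with le show "log_gauss (a\<^sup>2) n / sqrt (real n) * cos (ln (real n) * t)
       \<le> exp (9 * a\<^sup>2 / 8) * (1 / (real n)\<^sup>2)"
      unfolding v_def by simp
  qed
  also have "\<dots> = exp (9 * a\<^sup>2 / 8) * (\<Sum>n=1..N. 1 / (real n)\<^sup>2)" by (simp add: sum_distrib_left)
  also have "(\<Sum>n=1..N. 1 / (real n)\<^sup>2) \<le> 4"
  proof -
    have "(\<Sum>n=1..N. 1 / (real n)\<^sup>2) \<le> 2 - 2 / (real N + 1)"
    proof (induction N)
      case (Suc N)
      have "1 / (real N + 1)\<^sup>2 \<le> 2 / ((real N + 1) * (real N + 2))"
        by (simp add: divide_simps power2_eq_square)
      also have "\<dots> = 2 / (real N + 1) - 2 / (real N + 2)"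
        by (simp add: divide_simps)
      finally have "1 / (real N + 1)\<^sup>2 \<le> 2 / (real N + 1) - 2 / (real N + 2)" .
      then show ?case using Suc by (simp add: add_ac)
    qed auto
    moreover have "0 \<le> 2 / (real N + 1)" by simp
    ultimately show ?thesis by linarith
  qed
  finally show ?thesis by (simp add: mult_ac)
qed


text \<open>Both sides come from the integral of the cosine polynomial against \<open>|R(t)|^2\<close> and a Gaussian of width
  \<open>Y\<close>. From below, only the correlations survive. From above, the polynomial is at most \<open>V\<close> in the good
  range; near \<open>0\<close> and beyond \<open>T/2\<close> it is bounded trivially, and so is \<open>|R|^2\<close>, by \<open>card M\<close> times the
  sum of squares.\<close>
lemma resonance_inequality:
  fixes f :: "nat \<Rightarrow> real" and M Q :: "nat set"
  assumes Y: "Y > 0" and a: "a > 0" and M: "finite M" "0 \<notin> M" and f: "\<And>m. 0 \<le> f m"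
    and Q: "Q \<subseteq> {1..N}" and U: "U \<ge> 0" and T: "T > 0" and V: "V \<ge> 0"
    and le: "\<And>t. 2 * U \<le> \<bar>t\<bar> \<Longrightarrow> \<bar>t\<bar> \<le> T / 2 \<Longrightarrow> smooth_sum a N t \<le> V"
  shows "(\<Sum>n\<in>Q. log_gauss (a\<^sup>2) n / sqrt (real n) * dilation_sum M f n)
     \<le> (36 * V + 2 * (4 * exp (9 * a\<^sup>2 / 8)) * real (card M) * (4 * U / Y + 6 * exp (- T\<^sup>2 / (16 * Y\<^sup>2)))) * (\<Sum>m\<in>M. (f m)\<^sup>2)"
proof -
  define bin where "bin m = nat \<lfloor>Y * ln (real m)\<rfloor>" for m :: nat
  define J where "J = bin ` M"
  define r where "r j = sqrt (\<Sum>m | m \<in> M \<and> bin m = j. (f m)\<^sup>2)" for j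
  have fJ: "finite J" using M by (simp add: J_def)
  have r0: "0 \<le> r j" for j by (simp add: r_def sum_nonneg)
  define W where "W = weight Y J r"
  define G where "G t = exp (- t\<^sup>2 / (2 * Y\<^sup>2))" for t
  define F where "F = (\<Sum>m\<in>M. (f m)\<^sup>2)"
  define B where "B = 4 * exp (9 * a\<^sup>2 / 8)"
  define c where "c n = log_gauss (a\<^sup>2) n / sqrt (real n)" for n :: nat
  define A where "A n = dilation_sum M f n" for n
  \<comment> \<open>A majorant of the Gaussian on the complement of the good range: beyond \<open>T/2\<close>, half of its exponent is frozen.\<close>
  let ?maj = "\<lambda>t. indicator {- (2 * U)..2 * U} t
      + exp (- T\<^sup>2 / (16 * Y\<^sup>2)) * (exp (- t\<^sup>2 / (2 * (sqrt 2 * Y)\<^sup>2)) * cos (0 * t))"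
  have F0: "0 \<le> F" by (simp add: F_def sum_nonneg)
  have c0: "0 \<le> c n" for n by (simp add: c_def)
  have sumr: "(\<Sum>j\<in>J. (r j)\<^sup>2) = F"
  proof -
    have "(\<Sum>j\<in>J. (r j)\<^sup>2) = (\<Sum>j\<in>J. \<Sum>m\<in>{m \<in> M. bin m = j}. (f m)\<^sup>2)"
      by (intro sum.cong refl) (simp add: r_def sum_nonneg)
    also have "\<dots> = F" unfolding F_def using M fJ by (intro sum.group) (auto simp: J_def)
    finally show ?thesis .
  qed
  have WG: "integrable lborel (\<lambda>t. G t * W t)" "(\<integral>t. G t * W t \<partial>lborel) \<le> 18 * Y * F"
    unfolding G_def W_def sumr[symmetric] using weight_gaussian_integral[OF Y fJ r0] by auto
  have W0: "0 \<le> W t" for t unfolding W_def by (rule weight_nonneg)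
  have Wle: "W t \<le> real (card M) * F" for t
  proof -
    have "W t \<le> real (card J) * F" unfolding W_def sumr[symmetric] by (rule weight_le[OF r0])
    also have "\<dots> \<le> real (card M) * F" using M F0 by (intro mult_right_mono) (auto simp: J_def card_image_le)
    finally show ?thesis .
  qed
  have WC: "integrable lborel (\<lambda>t. G t * W t * cos (ln (real n) * t))"
    and WCge: "1 \<le> n \<Longrightarrow> Y / 2 * A n \<le> (\<integral>t. G t * W t * cos (ln (real n) * t) \<partial>lborel)" for n
  proof -
    show "integrable lborel (\<lambda>t. G t * W t * cos (ln (real n) * t))"
      unfolding G_def W_def by (rule weight_cos_integral_ge(1)[OF Y fJ r0])
    assume n: "1 \<le> n"
    have "A n \<le> (\<Sum>(j, l)\<in>{(j, l). j \<in> J \<and> l \<in> J \<and> \<bar>Y * ln (real n) - (real l - real j)\<bar> \<le> 1}. r j * r l)"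
      unfolding A_def J_def r_def bin_def by (rule binned_correlation_le[OF Y M f n])
    then have "Y / 2 * A n \<le> Y / 2 * (\<Sum>(j, l)\<in>{(j, l). j \<in> J \<and> l \<in> J \<and> \<bar>Y * ln (real n) - (real l - real j)\<bar> \<le> 1}. r j * r l)"
      using Y by (intro mult_left_mono) auto
    also have "\<dots> \<le> (\<integral>t. G t * W t * cos (ln (real n) * t) \<partial>lborel)"
      unfolding G_def W_def by (rule weight_cos_integral_ge(2)[OF Y fJ r0])
    finally show "Y / 2 * A n \<le> (\<integral>t. G t * W t * cos (ln (real n) * t) \<partial>lborel)" .
  qed
  have A0: "0 \<le> A n" for n unfolding A_def using f by (intro sum_nonneg) auto
  have De: "G t * W t * smooth_sum a N t = (\<Sum>n=1..N. c n * (G t * W t * cos (ln (real n) * t)))" for t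
    unfolding smooth_sum_def c_def sum_distrib_left by (intro sum.cong refl) (simp only: mult_ac)
  have DI: "integrable lborel (\<lambda>t. G t * W t * smooth_sum a N t)"
    unfolding De by (intro Bochner_Integration.integrable_sum integrable_mult_right WC)
  have "Y / 2 * (\<Sum>n\<in>Q. c n * A n) = (\<Sum>n\<in>Q. c n * (Y / 2 * A n))"
    by (simp add: sum_distrib_left mult_ac)
  also have "\<dots> \<le> (\<Sum>n=1..N. c n * (Y / 2 * A n))"
    using Q Y A0 c0 by (intro sum_mono2) auto
  also have "\<dots> \<le> (\<Sum>n=1..N. c n * (\<integral>t. G t * W t * cos (ln (real n) * t) \<partial>lborel))"
    using c0 by (intro sum_mono mult_left_mono WCge) auto
  also have "\<dots> = (\<integral>t. G t * W t * smooth_sum a N t \<partial>lborel)"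
    unfolding De by (simp only: Bochner_Integration.integral_sum[OF integrable_mult_right[OF WC]] integral_mult_right_zero)
  also have "\<dots> \<le> (\<integral>t. V * (G t * W t) + B * (real (card M) * F) * ?maj t \<partial>lborel)"
  proof (rule integral_mono[OF DI])
    have sY: "sqrt 2 * Y > 0" using Y by simp
    show "integrable lborel (\<lambda>t. V * (G t * W t) + B * (real (card M) * F) * ?maj t)"
      using U by (intro Bochner_Integration.integrable_add integrable_mult_right WG(1) gaussian_cos_integral(1)[OF sY])
        (auto intro!: integrable_real_indicator)
    fix t
    have B0: "0 \<le> B" by (simp add: B_def)
    have CF: "0 \<le> B * (real (card M) * F)" using B0 F0 by simp
    have GW: "0 \<le> G t * W t" using W0 by (simp add: G_def)
    have E0: "0 \<le> exp (- T\<^sup>2 / (16 * Y\<^sup>2)) * (exp (- t\<^sup>2 / (2 * (sqrt 2 * Y)\<^sup>2)) * cos (0 * t))" by simp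
    show "G t * W t * smooth_sum a N t \<le> V * (G t * W t) + B * (real (card M) * F) * ?maj t"
    proof (cases "2 * U \<le> \<bar>t\<bar> \<and> \<bar>t\<bar> \<le> T / 2")
      case True
      then have "G t * W t * smooth_sum a N t \<le> G t * W t * V" using GW le by (intro mult_left_mono) auto
      moreover have "0 \<le> B * (real (card M) * F) * ?maj t"
        by (rule mult_nonneg_nonneg[OF CF add_nonneg_nonneg[OF _ E0]]) simp
      ultimately show ?thesis by (simp add: mult.commute)
    next
      case False
      have "G t * W t * smooth_sum a N t \<le> G t * W t * B"
        using GW smooth_sum_bound[OF a] unfolding B_def by (intro mult_left_mono) auto
      also have "\<dots> = B * (W t * G t)" by simp
      also have "\<dots> \<le> B * (real (card M) * F * G t)"
        using B0 Wle by (intro mult_left_mono mult_right_mono) (auto simp: G_def)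
      also have "\<dots> = B * (real (card M) * F) * G t" by simp
      also have "\<dots> \<le> B * (real (card M) * F) * ?maj t"
      proof (intro mult_left_mono CF)
        show "G t \<le> indicator {- (2 * U)..2 * U} t + exp (- T\<^sup>2 / (16 * Y\<^sup>2)) * (exp (- t\<^sup>2 / (2 * (sqrt 2 * Y)\<^sup>2)) * cos (0 * t))"
        proof (cases "2 * U \<le> \<bar>t\<bar>")
          case True
          then have "(T / 2)\<^sup>2 \<le> \<bar>t\<bar>\<^sup>2" using False T by (intro power_mono) auto
          then have "T\<^sup>2 / (16 * Y\<^sup>2) \<le> t\<^sup>2 / (4 * Y\<^sup>2)" using Y by (simp add: divide_simps power_divide)
          then have "- t\<^sup>2 / (2 * Y\<^sup>2) \<le> - T\<^sup>2 / (16 * Y\<^sup>2) + - t\<^sup>2 / (2 * (sqrt 2 * Y)\<^sup>2)"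
            by (simp add: power_mult_distrib)
          then have "G t \<le> exp (- T\<^sup>2 / (16 * Y\<^sup>2) + - t\<^sup>2 / (2 * (sqrt 2 * Y)\<^sup>2))"
            unfolding G_def by (simp only: exp_le_cancel_iff)
          also have "\<dots> = exp (- T\<^sup>2 / (16 * Y\<^sup>2)) * (exp (- t\<^sup>2 / (2 * (sqrt 2 * Y)\<^sup>2)) * cos (0 * t))"
            by (simp only: exp_add mult_zero_left cos_zero mult_1_right)
          finally show ?thesis by (simp add: add_increasing)
        next
          case False
          then have "t \<in> {- (2 * U)..2 * U}" by auto
          then have "indicator {- (2 * U)..2 * U} t = (1::real)" by simp
          moreover have "G t \<le> 1" by (simp add: G_def)
          ultimately show ?thesis using E0 by linarith
        qed
      qed
      finally show ?thesis using V GW by (simp add: add_increasing)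
    qed
  qed
  also have "\<dots> = V * (\<integral>t. G t * W t \<partial>lborel) + B * (real (card M) * F) *
      (4 * U + exp (- T\<^sup>2 / (16 * Y\<^sup>2)) * (sqrt 2 * Y * sqrt (2 * pi)))"
  proof -
    have sY: "sqrt 2 * Y > 0" using Y by simp
    have i1: "integrable lborel (\<lambda>t. indicator {- (2 * U)..2 * U} t :: real)"
      by (rule integrable_real_indicator) (use U in auto)
    have v1: "(\<integral>t. indicator {- (2 * U)..2 * U} t \<partial>lborel) = 4 * U" using U by simp
    note i2 = gaussian_cos_integral(1)[OF sY, of 0] and v2 = gaussian_cos_integral(2)[OF sY, of 0]
    show ?thesis
      by (simp only: Bochner_Integration.integral_add[OF integrable_mult_right[OF WG(1)]
            integrable_mult_right[OF Bochner_Integration.integrable_add[OF i1 integrable_mult_right[OF i2]]]]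
          Bochner_Integration.integral_add[OF i1 integrable_mult_right[OF i2]] integral_mult_right_zero v1 v2) simp
  qed
  also have "\<dots> \<le> V * (18 * Y * F) + B * (real (card M) * F) * (4 * U + exp (- T\<^sup>2 / (16 * Y\<^sup>2)) * (6 * Y))"
  proof (intro add_mono mult_left_mono WG(2) V)
    have "sqrt 2 * sqrt (2 * pi) \<le> 2 * 3"
      using sqrt_two_pi_bounds sqrt2_less_2 by (intro mult_mono) auto
    then have "sqrt 2 * sqrt (2 * pi) * Y \<le> 6 * Y" using Y by (intro mult_right_mono) auto
    then show "sqrt 2 * Y * sqrt (2 * pi) \<le> 6 * Y" by (simp only: mult_ac)
    show "0 \<le> B * (real (card M) * F)" using F0 by (simp add: B_def)
  qed (use F0 in \<open>auto simp: B_def\<close>)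
  also have "\<dots> = Y / 2 * ((36 * V + 2 * B * real (card M) * (4 * U / Y + 6 * exp (- T\<^sup>2 / (16 * Y\<^sup>2)))) * F)"
    using Y by (simp add: field_simps)
  finally have "(\<Sum>n\<in>Q. c n * A n) \<le> (36 * V + 2 * B * real (card M) * (4 * U / Y + 6 * exp (- T\<^sup>2 / (16 * Y\<^sup>2)))) * F"
    using Y by (simp only: mult_le_cancel_left_pos half_gt_zero)
  then show ?thesis unfolding c_def A_def B_def F_def .
qed

text \<open>The correlations of \<open>f\<close> with its dilations by the elements of \<open>Q\<close> exceed its sum of squares by the factor
  \<open>G\<close>; \<open>w\<close> is the smoothing weight.\<close>
definition resonates :: "(nat \<Rightarrow> real) \<Rightarrow> nat set \<Rightarrow> (nat \<Rightarrow> real) \<Rightarrow> nat set \<Rightarrow> real \<Rightarrow> bool" where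
  "resonates w M f Q G \<longleftrightarrow> finite M \<and> 0 \<notin> M \<and> finite Q \<and> 0 \<notin> Q \<and> (\<forall>n. 0 \<le> f n) \<and>
     0 < (\<Sum>m\<in>M. (f m)\<^sup>2) \<and>
     G * (\<Sum>m\<in>M. (f m)\<^sup>2) \<le> (\<Sum>n\<in>Q. w n / sqrt (real n) * dilation_sum M f n)"

lemma resonates_mono: "resonates w M f Q G \<Longrightarrow> G' \<le> G \<Longrightarrow> resonates w M f Q G'"
  unfolding resonates_def by (auto intro: order_trans[OF mult_right_mono])

text \<open>The parameters are \<open>U = T^\<beta>\<close>, \<open>Y = T / log T\<close> and \<open>a^2 = (log T)^(3/4)\<close>. Any exponent below \<open>1\<close> for
  \<open>a^2\<close> makes \<open>exp (9 a^2/8)\<close> smaller than every power of \<open>T\<close>; an exponent above \<open>1/2\<close> will be needed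
  later, for the smoothing weight to be harmless on the integers that matter.\<close>
lemma zre_large_of_correlations:
  fixes \<beta> \<kappa> :: real
  assumes "0 < \<beta>" "0 < \<kappa>" "\<beta> + \<kappa> < 1"
  shows "\<exists>C>0. \<forall>\<^sub>F T in at_top. \<forall>V\<ge>1. (\<forall>w\<in>{T powr \<beta>..T}. zre w \<le> V) \<longrightarrow>
    (\<forall>M f Q G. resonates (log_gauss (ln T powr (3/4))) M f Q G \<longrightarrow> real (card M) \<le> T powr \<kappa> \<longrightarrow> G \<le> C * V)"
proof -
  obtain C where C: "C \<ge> 0" "\<And>a U T V. a \<ge> 1 \<Longrightarrow> U \<ge> 1 \<Longrightarrow> V \<ge> 0 \<Longrightarrow> (\<forall>w\<in>{U..T}. zre w \<le> V) \<Longrightarrow>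
     (\<exists>N\<^sub>0. \<forall>N\<ge>N\<^sub>0. \<forall>t. 2 * U \<le> \<bar>t\<bar> \<longrightarrow> \<bar>t\<bar> \<le> T / 2 \<longrightarrow>
        smooth_sum a N t \<le> V + 3 + 8 * exp (a\<^sup>2 / 8) / U + C * (1 + T) * exp (- U\<^sup>2 / 8))"
    using smooth_sum_le by blast
  have e1: "\<forall>\<^sub>F T in at_top. 8 * exp (ln T powr (3/4) / 8) / T powr \<beta> \<le> 1"
    using assms by real_asymp
  have e2: "\<forall>\<^sub>F T in at_top. C * (1 + T) * exp (- (T powr \<beta>)\<^sup>2 / 8) \<le> 1"
  proof -
    have "((\<lambda>T. C * (1 + T) * exp (- (T powr \<beta>)\<^sup>2 / 8)) \<longlongrightarrow> 0) at_top"
      using assms by real_asymp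
    then have "\<forall>\<^sub>F T in at_top. C * (1 + T) * exp (- (T powr \<beta>)\<^sup>2 / 8) < 1"
      by (rule order_tendstoD) simp
    then show ?thesis by eventually_elim simp
  qed
  have e3: "\<forall>\<^sub>F T in at_top. 2 * (4 * exp (9 * ln T powr (3/4) / 8)) * T powr \<kappa> *
      (4 * T powr \<beta> / (T / ln T) + 6 * exp (- T\<^sup>2 / (16 * (T / ln T)\<^sup>2))) \<le> 1"
    using assms by real_asymp
  have e4: "\<forall>\<^sub>F T::real in at_top. T \<ge> exp 1" by (rule eventually_ge_at_top)
  show ?thesis
  \<comment> \<open>\<open>V + 5 \<le> 6 V\<close> bounds the polynomial in the good range, and the remaining range contributes at most \<open>1\<close>.\<close>
  proof (intro exI[of _ "36 * 6 + 1"] conjI)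
    show "\<forall>\<^sub>F T in at_top. \<forall>V\<ge>1. (\<forall>w\<in>{T powr \<beta>..T}. zre w \<le> V) \<longrightarrow>
    (\<forall>M f Q G. resonates (log_gauss (ln T powr (3/4))) M f Q G \<longrightarrow> real (card M) \<le> T powr \<kappa> \<longrightarrow> G \<le> (36 * 6 + 1) * V)"
      using e1 e2 e3 e4
    proof (eventually_elim, intro allI impI)
      fix T V G :: real and M Q :: "nat set" and f :: "nat \<Rightarrow> real"
      assume E1: "8 * exp (ln T powr (3/4) / 8) / T powr \<beta> \<le> 1"
        and E2: "C * (1 + T) * exp (- (T powr \<beta>)\<^sup>2 / 8) \<le> 1"
        and E3: "2 * (4 * exp (9 * ln T powr (3/4) / 8)) * T powr \<kappa> *
      (4 * T powr \<beta> / (T / ln T) + 6 * exp (- T\<^sup>2 / (16 * (T / ln T)\<^sup>2))) \<le> 1"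
        and E4: "exp 1 \<le> T" and V: "1 \<le> V" and le: "\<forall>w\<in>{T powr \<beta>..T}. zre w \<le> V"
        and res: "resonates (log_gauss (ln T powr (3/4))) M f Q G" and cM: "real (card M) \<le> T powr \<kappa>"
      have H: "finite M" "0 \<notin> M" "finite Q" "0 \<notin> Q" "\<forall>n. 0 \<le> f n"
        and Fpos: "0 < (\<Sum>m\<in>M. (f m)\<^sup>2)"
        and ge: "G * (\<Sum>m\<in>M. (f m)\<^sup>2) \<le> (\<Sum>n\<in>Q. log_gauss (ln T powr (3/4)) n / sqrt (real n) * dilation_sum M f n)"
        using res unfolding resonates_def by auto
      have T: "T > 0" "T \<ge> 1" using E4 exp_ge_add_one_self[of 1] by linarith+
      have lT: "ln T \<ge> 1" using E4 T by (subst ln_ge_iff) auto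
      have "0 < ln T" using lT by linarith
      with T(1) have Y: "T / ln T > 0" by (rule divide_pos_pos)
      define a where "a = sqrt (ln T powr (3/4))"
      have a2: "a\<^sup>2 = ln T powr (3/4)" by (simp add: a_def)
      have a: "a \<ge> 1" unfolding a_def using lT by (simp add: ge_one_powr_ge_zero)
      have U: "T powr \<beta> \<ge> 1" using T assms by (simp add: ge_one_powr_ge_zero)
      obtain N\<^sub>0 where N0: "\<And>N t. N \<ge> N\<^sub>0 \<Longrightarrow> 2 * T powr \<beta> \<le> \<bar>t\<bar> \<Longrightarrow> \<bar>t\<bar> \<le> T / 2 \<Longrightarrow>
        smooth_sum a N t \<le> V + 3 + 8 * exp (a\<^sup>2 / 8) / T powr \<beta> + C * (1 + T) * exp (- (T powr \<beta>)\<^sup>2 / 8)"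
        using C(2)[OF a U _ le] V by auto
      define N where "N = Max (insert N\<^sub>0 Q)"
      have N: "N \<ge> N\<^sub>0" "Q \<subseteq> {1..N}" using H unfolding N_def by (auto intro!: Suc_leI gr0I)
      let ?F = "\<Sum>m\<in>M. (f m)\<^sup>2"
      have F0: "0 \<le> ?F" by (simp add: sum_nonneg)
      have "(\<Sum>n\<in>Q. log_gauss (a\<^sup>2) n / sqrt (real n) * dilation_sum M f n)
        \<le> (36 * (6 * V) + 2 * (4 * exp (9 * a\<^sup>2 / 8)) * real (card M) * (4 * T powr \<beta> / (T / ln T) + 6 * exp (- T\<^sup>2 / (16 * (T / ln T)\<^sup>2)))) * ?F"
      proof (rule resonance_inequality)
        fix t assume t: "2 * T powr \<beta> \<le> \<bar>t\<bar>" "\<bar>t\<bar> \<le> T / 2"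
        show "smooth_sum a N t \<le> 6 * V"
          using N0[OF N(1) t] E1 E2 V unfolding a2 by linarith
      qed (use H T Y a N V in auto)
      also have "\<dots> \<le> (36 * (6 * V) + 1) * ?F"
      proof (intro mult_right_mono add_left_mono F0)
        have "2 * (4 * exp (9 * a\<^sup>2 / 8)) * real (card M) * (4 * T powr \<beta> / (T / ln T) + 6 * exp (- T\<^sup>2 / (16 * (T / ln T)\<^sup>2)))
           \<le> 2 * (4 * exp (9 * a\<^sup>2 / 8)) * T powr \<kappa> * (4 * T powr \<beta> / (T / ln T) + 6 * exp (- T\<^sup>2 / (16 * (T / ln T)\<^sup>2)))"
          using cM T lT by (intro mult_right_mono mult_left_mono) auto
        also have "\<dots> \<le> 1" using E3 unfolding a2 .
        finally show "2 * (4 * exp (9 * a\<^sup>2 / 8)) * real (card M) * (4 * T powr \<beta> / (T / ln T) + 6 * exp (- T\<^sup>2 / (16 * (T / ln T)\<^sup>2))) \<le> 1" .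
      qed
      also have "\<dots> \<le> ((36 * 6 + 1) * V) * ?F" using V by (intro mult_right_mono F0) auto
      finally have "(\<Sum>n\<in>Q. log_gauss (ln T powr (3/4)) n / sqrt (real n) * dilation_sum M f n)
        \<le> (36 * 6 + 1) * V * ?F"
        unfolding a2 .
      with ge have "G * ?F \<le> (36 * 6 + 1) * V * ?F" by (rule order_trans)
      then show "G \<le> (36 * 6 + 1) * V" using Fpos by (simp only: mult_le_cancel_right_pos)
    qed
  qed simp
qed

section \<open>Primes in logarithmic windows\<close>

text \<open>Sums \<open>log k = \<Sum> \<Lambda>(d)\<close>, \<open>d\<close> dividing \<open>k\<close>, over \<open>k \<le> n\<close>.\<close>
lemma ln_fact_eq_sum_mangoldt:
  "ln (fact n :: real) = (\<Sum>d=1..n. mangoldt d * real (n div d))"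
proof -
  have "ln (fact n :: real) = (\<Sum>k=1..n. ln (real k))"
    by (induction n) (auto simp: ln_mult)
  also have "\<dots> = (\<Sum>k=1..n. \<Sum>d | d dvd k. mangoldt d)"
    by (intro sum.cong refl) (subst mangoldt_sum, auto)
  also have "\<dots> = (\<Sum>k=1..n. \<Sum>d | d \<in> {1..n} \<and> d dvd k. mangoldt d)"
    by (intro sum.cong refl) (auto dest: dvd_imp_le intro!: Nat.gr0I)
  also have "\<dots> = (\<Sum>d=1..n. \<Sum>k | k \<in> {1..n} \<and> d dvd k. mangoldt d)"
    by (rule sum.swap_restrict) auto
  also have "\<dots> = (\<Sum>d=1..n. mangoldt d * real (n div d))"
  proof (intro sum.cong refl)
    fix d assume d: "d \<in> {1..n}"
    have "{k. k \<in> {1..n} \<and> d dvd k} = (\<lambda>i. d * i) ` {1..n div d}"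
    proof (intro equalityI subsetI)
      fix k assume "k \<in> {k. k \<in> {1..n} \<and> d dvd k}"
      then obtain i where i: "k = d * i" "1 \<le> k" "k \<le> n" by auto
      then have "i \<in> {1..n div d}" using d
        by (auto simp: less_eq_div_iff_mult_less_eq mult.commute intro!: Nat.gr0I)
      then show "k \<in> (\<lambda>i. d * i) ` {1..n div d}" using i by auto
    next
      fix k assume "k \<in> (\<lambda>i. d * i) ` {1..n div d}"
      then show "k \<in> {k. k \<in> {1..n} \<and> d dvd k}" using d
        by (auto simp: less_eq_div_iff_mult_less_eq mult.commute)
    qed
    moreover have "inj_on (\<lambda>i. d * i) {1..n div d}" using d by (auto simp: inj_on_def)
    ultimately have "card {k. k \<in> {1..n} \<and> d dvd k} = n div d" by (simp add: card_image)
    then show "(\<Sum>k | k \<in> {1..n} \<and> d dvd k. mangoldt d) = mangoldt d * real (n div d)" by simp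
  qed
  finally show ?thesis .
qed

text \<open>Chebyshev's argument: in \<open>log (2n choose n) = \<Sum> \<Lambda>(d) (\<lfloor>2n/d\<rfloor> - 2 \<lfloor>n/d\<rfloor>)\<close> all coefficients are nonnegative, and
  those with \<open>n < d \<le> 2n\<close> are \<open>1\<close>.\<close>
lemma mangoldt_sum_dyadic_le:
  "(\<Sum>d=n+1..2*n. mangoldt d) \<le> 2 * real n * ln 2"
proof -
  have "(\<Sum>d=n+1..2*n. mangoldt d)
      = (\<Sum>d=n+1..2*n. mangoldt d * (real (2*n div d) - 2 * real (n div d)))"
  proof (intro sum.cong refl)
    fix d assume d: "d \<in> {n+1..2*n}"
    then have "n div d = 0" by auto
    moreover have "2 * n div d = 1" using d by (intro div_nat_eqI) auto
    ultimately show "mangoldt d = mangoldt d * (real (2*n div d) - 2 * real (n div d))" by simp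
  qed
  also have "\<dots> \<le> (\<Sum>d=1..2*n. mangoldt d * (real (2*n div d) - 2 * real (n div d)))"
  proof (intro sum_mono2 mult_nonneg_nonneg mangoldt_nonneg)
    fix d
    have "2 * (n div d) \<le> 2 * n div d"
    proof (cases "d = 0")
      case False
      have "n div d * d \<le> n" by (rule div_times_less_eq_dividend)
      then have "2 * (n div d) * d \<le> 2 * n" by linarith
      then show ?thesis using False by (subst less_eq_div_iff_mult_less_eq) auto
    qed simp
    then show "0 \<le> real (2*n div d) - 2 * real (n div d)" by linarith
  qed auto
  also have "\<dots> = ln (fact (2*n)) - 2 * (\<Sum>d=1..2*n. mangoldt d * real (n div d))"
    unfolding ln_fact_eq_sum_mangoldt[of "2*n"] sum_distrib_left sum_subtractf[symmetric]
    by (intro sum.cong refl) (simp add: algebra_simps)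
  also have "(\<Sum>d=1..2*n. mangoldt d * real (n div d)) = (\<Sum>d=1..n. mangoldt d * real (n div d))"
    by (intro sum.mono_neutral_right) auto
  also have "\<dots> = ln (fact n)" by (rule ln_fact_eq_sum_mangoldt[symmetric])
  also have "ln (fact (2*n)) - 2 * ln (fact n) = ln (real ((2*n) choose n))"
  proof -
    have "2 * n - n = n" by simp
    then have "real ((2*n) choose n) = fact (2*n) / (fact n * fact n)"
      using binomial_fact[of n "2*n", where 'a = real] by simp
    then show ?thesis by (simp add: ln_div ln_mult)
  qed
  also have "\<dots> \<le> ln (2 ^ (2*n))"
  proof -
    have "real ((2*n) choose n) \<le> real (2 ^ (2*n))"
      using binomial_le_pow2[of "2*n" n] by (simp only: of_nat_le_iff)
    then show ?thesis by (subst ln_le_cancel_iff) auto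
  qed
  also have "\<dots> = 2 * real n * ln 2" by (simp add: ln_realpow)
  finally show ?thesis .
qed

text \<open>Strong induction by halving. Rounding \<open>n / 2\<close> up to \<open>m\<close> is affordable with the constant \<open>4 ln 2\<close> instead of
  \<open>2 ln 2\<close>, because \<open>6 m \<le> 4 n\<close> for \<open>n \<ge> 2\<close>.\<close>
lemma chebyshev_psi_le:
  "(\<Sum>d=1..n. mangoldt d) \<le> 4 * ln 2 * real n"
proof (induction n rule: less_induct)
  case (less n)
  define m where "m = (n + 1) div 2"
  have nm: "n \<le> 2 * m" "2 * m \<le> n + 1" unfolding m_def by presburger+
  show ?case
  proof (cases "n \<le> 1")
    case True
    then have "n = 0 \<or> n = 1" by auto
    then show ?thesis by auto
  next
    case False
    then have "m < n" "1 \<le> m" using nm by auto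
    have "(\<Sum>d=1..n. mangoldt d) \<le> (\<Sum>d=1..2*m. mangoldt d :: real)"
      using nm by (intro sum_mono2 mangoldt_nonneg) auto
    also have "{1..2*m} = {1..m} \<union> {m+1..2*m}" using \<open>1 \<le> m\<close> by auto
    also have "(\<Sum>d\<in>\<dots>. mangoldt d) = (\<Sum>d=1..m. mangoldt d) + (\<Sum>d=m+1..2*m. mangoldt d :: real)"
      by (intro sum.union_disjoint) auto
    also have "\<dots> \<le> 4 * ln 2 * real m + 2 * real m * ln 2"
      by (intro add_mono less.IH mangoldt_sum_dyadic_le \<open>m < n\<close>)
    also have "\<dots> = (6 * real m) * ln 2" by simp
    also have "\<dots> \<le> (4 * real n) * ln 2"
    proof (intro mult_right_mono)
      have "n = 2 * m \<or> n + 1 = 2 * m" using nm by linarith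
      then have "6 * m \<le> 4 * n" using False by auto
      then show "6 * real m \<le> 4 * real n" by linarith
    qed auto
    finally show ?thesis by (simp add: mult_ac)
  qed
qed

text \<open>Mertens' argument: dropping the integer parts in \<open>log n! = \<Sum> \<Lambda>(d) \<lfloor>n/d\<rfloor>\<close> costs at most \<open>\<Sum> \<Lambda>(d)\<close>, which is
  \<open>O(n)\<close> by Chebyshev's bound.\<close>
lemma mangoldt_div_sum_bounds:
  assumes "n \<ge> 1"
  shows "(\<Sum>d=1..n. mangoldt d / real d) \<ge> ln (real n) - 1"
    and "(\<Sum>d=1..n. mangoldt d / real d) \<le> ln (real n) + 4"
proof -
  define S where "S = (\<Sum>d=1..n. mangoldt d / real d)"
  have up: "ln (fact n) \<le> real n * S"
    unfolding ln_fact_eq_sum_mangoldt S_def sum_distrib_left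
  proof (intro sum_mono)
    fix d assume "d \<in> {1..n}"
    have "mangoldt d * real (n div d) \<le> mangoldt d * (real n / real d)"
      by (intro mult_left_mono of_nat_div_le_of_nat mangoldt_nonneg)
    then show "mangoldt d * real (n div d) \<le> real n * (mangoldt d / real d)" by (simp add: mult_ac)
  qed
  have "real n * S - (\<Sum>d=1..n. mangoldt d) \<le> ln (fact n)"
    unfolding ln_fact_eq_sum_mangoldt S_def sum_distrib_left sum_subtractf[symmetric]
  proof (intro sum_mono)
    fix d assume d: "d \<in> {1..n}"
    have "mangoldt d * (real n / real d - 1) \<le> mangoldt d * real (n div d)"
    proof (intro mult_left_mono mangoldt_nonneg)
      have "n < d + d * (n div d)" using d by (intro dividend_less_times_div) auto
      then have "real n < real d + real d * real (n div d)"
        by (metis of_nat_add of_nat_less_iff of_nat_mult)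
      then show "real n / real d - 1 \<le> real (n div d)" using d by (simp add: field_simps)
    qed
    then show "real n * (mangoldt d / real d) - mangoldt d \<le> mangoldt d * real (n div d)"
      by (simp add: algebra_simps)
  qed
  moreover have "ln (fact n :: real) \<le> real n * ln (real n)"
  proof -
    have "fact n \<le> (real n) ^ n" using fact_le_power[of n, where 'a=real] by simp
    then have "ln (fact n :: real) \<le> ln (real n ^ n)" using assms by (subst ln_le_cancel_iff) auto
    then show ?thesis using assms by (simp add: ln_realpow)
  qed
  ultimately have "real n * S \<le> real n * ln (real n) + 4 * ln 2 * real n"
    using chebyshev_psi_le[of n] by linarith
  also have "\<dots> = real n * (ln (real n) + 4 * ln 2)" by (simp add: algebra_simps)
  finally have "S \<le> ln (real n) + 4 * ln 2" using assms by simp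
  also have "4 * ln 2 \<le> (4::real)" using ln_2_less_1 by simp
  finally show "S \<le> ln (real n) + 4" by simp
  have "real n * ln (real n) - real n \<le> ln (fact n :: real)"
  proof -
    have "real n ^ n / fact n \<le> exp (real n)"
    proof -
      have "(\<Sum>k\<in>{n}. inverse (fact k) *\<^sub>R (real n) ^ k) \<le> (\<Sum>k. inverse (fact k) *\<^sub>R (real n) ^ k)"
        by (intro sum_le_suminf summable_exp_generic) auto
      then show ?thesis by (simp add: exp_def field_simps)
    qed
    then have "ln (real n ^ n / fact n) \<le> real n"
      using assms ln_le_cancel_iff[of "real n ^ n / fact n" "exp (real n)"] by simp
    then show ?thesis using assms by (simp add: ln_div ln_realpow)
  qed
  with up have "real n * (ln (real n) - 1) \<le> real n * S" by (simp add: algebra_simps)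
  then show "S \<ge> ln (real n) - 1" using assms by simp
qed

text \<open>The prime powers \<open>p^k\<close> with \<open>k \<ge> 2\<close> contribute at most \<open>2 log p / p^2\<close> for each \<open>p\<close>, and \<open>log p \<le> 2 sqrt p\<close>.\<close>
lemma mangoldt_higher_powers_bounded:
  "\<exists>C\<ge>0. \<forall>n. (\<Sum>d | d \<in> {1..n} \<and> \<not> prime d. mangoldt d / real d) \<le> (C::real)"
proof (intro exI conjI allI)
  define g where "g = (\<lambda>n. 4 * real n powr (-3/2))"
  have sg: "summable g" unfolding g_def
    by (intro summable_mult) (simp add: summable_real_powr_iff)
  show "0 \<le> suminf g" using sg by (intro suminf_nonneg) (auto simp: g_def)
  fix n :: nat
  define D where "D = {d. d \<in> {1..n} \<and> \<not> prime d \<and> primepow d}"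
  define Pr where "Pr = {p \<in> {..n}. prime p}"
  have "(\<Sum>d | d \<in> {1..n} \<and> \<not> prime d. mangoldt d / real d) = (\<Sum>d\<in>D. mangoldt d / real d)"
    unfolding D_def by (intro sum.mono_neutral_right) (auto simp: mangoldt_def)
  also have "\<dots> \<le> (\<Sum>d\<in>(\<lambda>(p,k). p ^ k) ` (Pr \<times> {2..n}). mangoldt d / real d)"
  proof (intro sum_mono2)
    show "D \<subseteq> (\<lambda>(p,k). p ^ k) ` (Pr \<times> {2..n})"
    proof
      fix d assume d: "d \<in> D"
      then obtain p k where pk: "prime p" "k > 0" "d = p ^ k" unfolding D_def primepow_def by auto
      have "k \<noteq> 1" using d pk by (auto simp: D_def)
      have p2: "p \<ge> 2" using pk(1) prime_ge_2_nat by auto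
      have "p ^ 1 \<le> p ^ k" using p2 pk(2) by (intro power_increasing) auto
      then have "p \<le> n" using d pk by (auto simp: D_def)
      have "k < 2 ^ k" by (rule less_exp)
      also have "\<dots> \<le> p ^ k" using p2 by (intro power_mono) auto
      finally have "k \<le> n" using d pk by (auto simp: D_def)
      have "(p, k) \<in> Pr \<times> {2..n}" using pk \<open>k \<noteq> 1\<close> \<open>p \<le> n\<close> \<open>k \<le> n\<close> by (auto simp: Pr_def)
      then show "d \<in> (\<lambda>(p,k). p ^ k) ` (Pr \<times> {2..n})" using pk(3) by force
    qed
  qed (auto simp: Pr_def intro!: divide_nonneg_nonneg mangoldt_nonneg)
  also have "\<dots> \<le> (\<Sum>x\<in>Pr \<times> {2..n}. ((\<lambda>d. mangoldt d / real d) \<circ> (\<lambda>(p,k). p ^ k)) x)"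
    by (intro sum_image_le) (auto simp: Pr_def intro!: divide_nonneg_nonneg mangoldt_nonneg)
  also have "\<dots> = (\<Sum>p\<in>Pr. \<Sum>k\<in>{2..n}. mangoldt (p ^ k) / real (p ^ k))"
    by (subst sum.cartesian_product) (auto intro!: sum.cong)
  also have "\<dots> \<le> (\<Sum>p\<in>Pr. g p)"
  proof (intro sum_mono)
    fix p assume p: "p \<in> Pr"
    then have pp: "prime p" and p2: "real p \<ge> 2" using prime_ge_2_nat by (auto simp: Pr_def)
    have sg': "summable (\<lambda>k. (1 / real p) ^ k)" using p2 by (intro summable_geometric) auto
    have "(\<Sum>k\<in>{2..n}. mangoldt (p ^ k) / real (p ^ k)) = (\<Sum>k\<in>{2..n}. ln (real p) * (1 / real p) ^ k)"
      using pp by (intro sum.cong refl) (auto simp: field_simps)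
    also have "\<dots> = ln (real p) * (\<Sum>k\<in>{2..n}. (1 / real p) ^ k)" by (simp add: sum_distrib_left)
    also have "(\<Sum>k\<in>{2..n}. (1 / real p) ^ k) \<le> (\<Sum>k\<in>{2..n+2}. (1 / real p) ^ k)"
      by (intro sum_mono2) auto
    also have "\<dots> = (\<Sum>k\<in>{0..n}. (1 / real p) ^ (k+2))"
      by (rule sum.reindex_bij_witness[where i = "\<lambda>k. k + 2" and j = "\<lambda>k. k - 2"])
         (auto simp del: power_Suc add_2_eq_Suc')
    also have "\<dots> = (1 / real p) ^ 2 * (\<Sum>k\<in>{0..n}. (1 / real p) ^ k)"
      by (simp add: power_add sum_distrib_left power2_eq_square mult_ac)
    also have "(\<Sum>k\<in>{0..n}. (1 / real p) ^ k) \<le> (\<Sum>k. (1 / real p) ^ k)"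
      using sg' by (intro sum_le_suminf) auto
    also have "\<dots> = 1 / (1 - 1 / real p)" using p2 by (intro suminf_geometric) auto
    also have "\<dots> \<le> 2" using p2 by (simp add: field_simps)
    finally have "(\<Sum>k\<in>{2..n}. mangoldt (p ^ k) / real (p ^ k)) \<le> ln (real p) * ((1 / real p) ^ 2 * 2)"
      using p2 by (simp add: mult_left_mono)
    also have "ln (real p) = 2 * ln (sqrt (real p))" using p2 by (simp add: ln_sqrt)
    also have "\<dots> \<le> 2 * sqrt (real p)" using p2 ln_bound[of "sqrt (real p)"] by simp
    also have "2 * sqrt (real p) * ((1 / real p) ^ 2 * 2) = 4 * (real p powr (1/2) * real p powr (-2))"
      using p2 by (simp add: powr_half_sqrt powr_minus powr_numeral field_simps)
    also have "\<dots> = g p" using p2 unfolding g_def by (simp add: powr_add[symmetric])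
    finally show "(\<Sum>k\<in>{2..n}. mangoldt (p ^ k) / real (p ^ k)) \<le> g p"
      using p2 by (simp add: mult_right_mono)
  qed
  also have "\<dots> \<le> suminf g" using sg by (intro sum_le_suminf) (auto simp: g_def Pr_def)
  finally show "(\<Sum>d | d \<in> {1..n} \<and> \<not> prime d. mangoldt d / real d) \<le> suminf g" .
qed

lemma mertens_interval_lower:
  "\<exists>C\<ge>0. \<forall>x y::real. 1 \<le> x \<longrightarrow> x \<le> y \<longrightarrow>
      (\<Sum>p | prime p \<and> x < real p \<and> real p \<le> y. ln (real p) / real p) \<ge> ln y - ln x - C"
proof -
  obtain C where C: "C \<ge> 0" "\<And>n. (\<Sum>d | d \<in> {1..n} \<and> \<not> prime d. mangoldt d / real d) \<le> C"
    using mangoldt_higher_powers_bounded by blast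
  show ?thesis
  proof (intro exI conjI allI impI)
    \<comment> \<open>\<open>6\<close> is more than \<open>1 + 4\<close>, from the two sides of Mertens' estimate, plus \<open>ln 2\<close> for replacing \<open>y\<close> by its integer part.\<close>
    show "C + 6 \<ge> 0" using C by simp
    fix x y :: real assume xy: "1 \<le> x" "x \<le> y"
    define m n where "m = nat \<lfloor>x\<rfloor>" and "n = nat \<lfloor>y\<rfloor>"
    have m: "1 \<le> m" "real m \<le> x" and n: "1 \<le> n" "m \<le> n"
      using xy unfolding m_def n_def by (auto simp: le_nat_iff floor_mono nat_mono)
    have "y < real n + 1" using xy unfolding n_def by simp
    then have ny: "y < 2 * real n" using n(1) by simp
    have iff: "m < d \<longleftrightarrow> x < real d" "d \<le> n \<longleftrightarrow> real d \<le> y" for d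
      using xy unfolding m_def n_def by (auto simp: nat_less_iff le_nat_iff floor_less_iff le_floor_iff)
    let ?f = "\<lambda>d. mangoldt d / real d :: real"
    have "ln (real m) \<le> ln x" using m by simp
    moreover have "ln y \<le> ln (2 * real n)" using n ny xy by (subst ln_le_cancel_iff) auto
    moreover have "ln (2 * real n) = ln 2 + ln (real n)" using n by (simp add: ln_mult)
    moreover have "(\<Sum>d=1..n. ?f d) = (\<Sum>d=1..m. ?f d) + (\<Sum>d=m+1..n. ?f d)"
      using m n by (subst sum.union_disjoint[symmetric]) (auto intro!: sum.cong)
    moreover have "(\<Sum>d=m+1..n. ?f d) = (\<Sum>d | d \<in> {m+1..n} \<and> prime d. ?f d) + (\<Sum>d | d \<in> {m+1..n} \<and> \<not> prime d. ?f d)"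
      by (subst sum.union_disjoint[symmetric]) (auto intro!: sum.cong)
    moreover have "(\<Sum>d | d \<in> {m+1..n} \<and> \<not> prime d. ?f d) \<le> (\<Sum>d | d \<in> {1..n} \<and> \<not> prime d. ?f d)"
      by (intro sum_mono2) (auto intro!: divide_nonneg_nonneg mangoldt_nonneg)
    moreover have "(\<Sum>d | d \<in> {m+1..n} \<and> prime d. ?f d)
        = (\<Sum>p | prime p \<and> x < real p \<and> real p \<le> y. ln (real p) / real p)"
      by (intro sum.cong) (auto simp: Suc_le_eq iff)
    moreover note C(2)[of n] mangoldt_div_sum_bounds(1)[OF n(1)] mangoldt_div_sum_bounds(2)[OF m(1)] ln_2_less_1
    ultimately show "(\<Sum>p | prime p \<and> x < real p \<and> real p \<le> y. ln (real p) / real p) \<ge> ln y - ln x - (C + 6)"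
      by linarith
  qed
qed

section \<open>A resonator built from blocks of primes\<close>

text \<open>Counts the pairs of a set with \<open>j + 1\<close> elements and one of its elements in two ways.\<close>
lemma esym_double_count:
  fixes w :: "'a \<Rightarrow> real"
  assumes "finite P"
  shows "real (Suc j) * (\<Sum>X | X \<subseteq> P \<and> card X = Suc j. prod w X)
       = (\<Sum>Y | Y \<subseteq> P \<and> card Y = j. prod w Y * sum w (P - Y))"
proof -
  have "real (Suc j) * (\<Sum>X | X \<subseteq> P \<and> card X = Suc j. prod w X)
      = (\<Sum>X | X \<subseteq> P \<and> card X = Suc j. \<Sum>p\<in>X. prod w X)"
    by (simp add: sum_distrib_left)
  also have "\<dots> = (\<Sum>(X,p)\<in>(SIGMA X:{X. X \<subseteq> P \<and> card X = Suc j}. X). prod w X)"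
    using assms by (subst sum.Sigma) (auto intro: finite_subset)
  also have "\<dots> = (\<Sum>(Y,p)\<in>(SIGMA Y:{Y. Y \<subseteq> P \<and> card Y = j}. P - Y). prod w Y * w p)"
    using assms
    by (intro sum.reindex_bij_witness[where i = "\<lambda>(Y,p). (insert p Y, p)" and j = "\<lambda>(X,p). (X - {p}, p)"])
       (auto simp: insert_absorb card_Diff_singleton prod.remove finite_subset mult.commute card_insert_if)
  also have "\<dots> = (\<Sum>Y | Y \<subseteq> P \<and> card Y = j. \<Sum>p\<in>P - Y. prod w Y * w p)"
    using assms by (subst sum.Sigma) auto
  finally show ?thesis by (simp add: sum_distrib_left)
qed

text \<open>Elementary symmetric sums increase as long as the index stays below the total weight, the individual
  weights being small: a set with \<open>j\<close> elements leaves at least the weight \<open>j + 1\<close> for a further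
  element.\<close>
lemma esym_Suc_ge:
  fixes w :: "'a \<Rightarrow> real"
  assumes "finite P" "\<And>p. p \<in> P \<Longrightarrow> 0 \<le> w p" "\<And>p. p \<in> P \<Longrightarrow> w p \<le> \<mu>" "0 \<le> \<mu>"
    and large: "real J * (1 + \<mu>) \<le> sum w P" and "j < J"
  shows "(\<Sum>X | X \<subseteq> P \<and> card X = j. prod w X) \<le> (\<Sum>X | X \<subseteq> P \<and> card X = Suc j. prod w X)"
proof -
  have "real (Suc j) * (\<Sum>X | X \<subseteq> P \<and> card X = j. prod w X)
      = (\<Sum>X | X \<subseteq> P \<and> card X = j. prod w X * real (Suc j))"
    by (simp add: sum_distrib_left mult.commute)
  also have "\<dots> \<le> (\<Sum>X | X \<subseteq> P \<and> card X = j. prod w X * sum w (P - X))"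
  proof (intro sum_mono mult_left_mono prod_nonneg)
    fix X assume X: "X \<in> {X. X \<subseteq> P \<and> card X = j}"
    have "sum w X \<le> real (card X) * \<mu>" using X assms by (intro sum_bounded_above) auto
    also have "\<dots> \<le> real J * \<mu>" using X assms by (intro mult_right_mono) auto
    finally have "sum w X \<le> real J * \<mu>" .
    moreover have "sum w P = sum w X + sum w (P - X)"
      using X assms by (subst sum.subset_diff[of X P]) auto
    moreover have "real (Suc j) \<le> real J" using assms by simp
    ultimately show "real (Suc j) \<le> sum w (P - X)" using large by (simp add: algebra_simps)
  next
    fix X p assume "X \<in> {X. X \<subseteq> P \<and> card X = j}" "p \<in> X"
    then show "0 \<le> w p" using assms by auto
  qed
  also have "\<dots> = real (Suc j) * (\<Sum>X | X \<subseteq> P \<and> card X = Suc j. prod w X)"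
    using esym_double_count[OF \<open>finite P\<close>] by metis
  finally show ?thesis by (simp del: of_nat_Suc)
qed

lemma sum_subsets_le_top_layer:
  fixes w :: "'a \<Rightarrow> real"
  assumes "finite P" "\<And>p. p \<in> P \<Longrightarrow> 0 \<le> w p" "\<And>p. p \<in> P \<Longrightarrow> w p \<le> \<mu>" "0 \<le> \<mu>"
    and "real J * (1 + \<mu>) \<le> sum w P"
  shows "(\<Sum>X | X \<subseteq> P \<and> card X \<le> J. prod w X) \<le> real (J + 1) * (\<Sum>X | X \<subseteq> P \<and> card X = J. prod w X)"
proof -
  define e where "e j = (\<Sum>X | X \<subseteq> P \<and> card X = j. prod w X)" for j
  have mono: "e j \<le> e J" if "j \<le> J" for j
    using that
  proof (induction rule: inc_induct)
    case (step n)
    have "e n \<le> e (Suc n)" unfolding e_def using assms step by (intro esym_Suc_ge) auto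
    then show ?case using step by linarith
  qed auto
  have "(\<Sum>X | X \<subseteq> P \<and> card X \<le> J. prod w X)
     = (\<Sum>j\<in>{..J}. \<Sum>X\<in>{X \<in> {X. X \<subseteq> P \<and> card X \<le> J}. card X = j}. prod w X)"
    using assms by (subst sum.group) (auto intro: finite_subset[of _ "Pow P"])
  also have "\<dots> = (\<Sum>j\<in>{..J}. e j)" unfolding e_def by (intro sum.cong) auto
  also have "\<dots> \<le> (\<Sum>j\<in>{..J}. e J)" by (intro sum_mono mono) auto
  finally show ?thesis by (simp add: e_def)
qed

text \<open>A set is determined by its traces on the disjoint blocks.\<close>
lemma sum_over_blocks_eq_prod:
  fixes w :: "'a \<Rightarrow> real"
  assumes "finite I" "\<And>i. i \<in> I \<Longrightarrow> finite (P i)" "disjoint_family_on P I"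
    and "\<And>i. i \<in> I \<Longrightarrow> \<B> i \<subseteq> Pow (P i)"
  shows "(\<Sum>A | A \<subseteq> (\<Union>i\<in>I. P i) \<and> (\<forall>i\<in>I. A \<inter> P i \<in> \<B> i). prod w A)
       = (\<Prod>i\<in>I. \<Sum>X\<in>\<B> i. prod w X)"
proof -
  have "(\<Prod>i\<in>I. \<Sum>X\<in>\<B> i. prod w X) = (\<Sum>G\<in>PiE I \<B>. \<Prod>i\<in>I. prod w (G i))"
    using assms by (intro prod_sum_PiE) (auto intro: finite_subset)
  also have "\<dots> = (\<Sum>A | A \<subseteq> (\<Union>i\<in>I. P i) \<and> (\<forall>i\<in>I. A \<inter> P i \<in> \<B> i). prod w A)"
  proof (rule sum.reindex_bij_witness[where j = "\<lambda>G. \<Union>i\<in>I. G i" and i = "\<lambda>A. restrict (\<lambda>i. A \<inter> P i) I"])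
    fix G assume G: "G \<in> PiE I \<B>"
    have Gs: "G i \<subseteq> P i" if "i \<in> I" for i using G that assms(4)[of i] by auto
    have eq: "(\<Union>i\<in>I. G i) \<inter> P i = G i" if "i \<in> I" for i
    proof (intro equalityI subsetI)
      fix x assume "x \<in> (\<Union>i\<in>I. G i) \<inter> P i"
      then obtain j where j: "j \<in> I" "x \<in> G j" "x \<in> P i" by auto
      have "j = i"
        using disjoint_family_onD[OF assms(3) j(1) that] Gs[OF j(1)] j by auto
      then show "x \<in> G i" using j by simp
    qed (use Gs that in auto)
    show "restrict (\<lambda>i. (\<Union>i\<in>I. G i) \<inter> P i) I = G"
      using G eq by (auto simp: fun_eq_iff restrict_def PiE_def extensional_def)
    show "(\<Union>i\<in>I. G i) \<in> {A. A \<subseteq> (\<Union>i\<in>I. P i) \<and> (\<forall>i\<in>I. A \<inter> P i \<in> \<B> i)}"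
      using Gs eq G by auto
    show "prod w (\<Union>i\<in>I. G i) = (\<Prod>i\<in>I. prod w (G i))"
    proof (rule prod.UNION_disjoint)
      show "\<forall>i\<in>I. finite (G i)" using Gs assms(2) by (meson finite_subset)
      show "\<forall>i\<in>I. \<forall>j\<in>I. i \<noteq> j \<longrightarrow> G i \<inter> G j = {}"
      proof (intro ballI impI)
        fix i j assume ij: "i \<in> I" "j \<in> I" "i \<noteq> j"
        show "G i \<inter> G j = {}"
          using disjoint_family_onD[OF assms(3) ij] Gs[OF ij(1)] Gs[OF ij(2)] by auto
      qed
    qed fact
  next
    fix A assume A: "A \<in> {A. A \<subseteq> (\<Union>i\<in>I. P i) \<and> (\<forall>i\<in>I. A \<inter> P i \<in> \<B> i)}"
    show "(\<Union>i\<in>I. restrict (\<lambda>i. A \<inter> P i) I i) = A" using A by auto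
    show "restrict (\<lambda>i. A \<inter> P i) I \<in> PiE I \<B>" using A by auto
  qed
  finally show ?thesis ..
qed

text \<open>Comparison of the number of subsets with the binomial expansion of \<open>(1 + x)^n\<close> at \<open>x = J/n\<close>.\<close>
lemma card_subsets_le_exp:
  fixes J :: nat and n :: real
  assumes "finite P" "real (card P) \<le> n" "real J \<le> n" "1 \<le> J"
  shows "real (card {X. X \<subseteq> P \<and> card X \<le> J}) \<le> exp (real J * (1 + ln (n / real J)))"
proof -
  define x where "x = real J / n"
  have x: "0 < x" "x \<le> 1" "x * n = real J" using assms by (auto simp: x_def)
  have "real (card {X. X \<subseteq> P \<and> card X \<le> J}) * x ^ J = (\<Sum>X | X \<subseteq> P \<and> card X \<le> J. x ^ J)"
    by simp
  also have "\<dots> \<le> (\<Sum>X | X \<subseteq> P \<and> card X \<le> J. x ^ card X)"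
    using x by (intro sum_mono power_decreasing) auto
  also have "\<dots> \<le> (\<Sum>X\<in>Pow P. x ^ card X)"
    using assms x by (intro sum_mono2) auto
  also have "\<dots> = (\<Prod>p\<in>P. x + 1)"
    using assms by (subst prod_add) auto
  also have "\<dots> \<le> (exp x) ^ card P"
    using x by (simp add: power_mono add.commute exp_ge_add_one_self)
  also have "\<dots> = exp (x * card P)" by (simp add: exp_of_nat2_mult)
  also have "\<dots> \<le> exp (real J)"
    using x assms by (metis exp_le_cancel_iff mult_left_mono less_imp_le)
  finally have "real (card {X. X \<subseteq> P \<and> card X \<le> J}) \<le> exp (real J) / x ^ J"
    using x by (simp add: field_simps)
  also have "\<dots> = exp (real J) * (n / real J) ^ J" by (simp add: x_def power_divide field_simps)
  also have "(n / real J) ^ J = exp (real J * ln (n / real J))"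
  proof -
    have "n / real J > 0" using assms by simp
    then show ?thesis by (simp add: exp_of_nat_mult)
  qed
  finally show ?thesis by (simp add: exp_add[symmetric] algebra_simps)
qed

text \<open>The full sum over subsets is the product. Weighting a subset by \<open>2^card\<close> multiplies the sum by at
  most \<open>exp (sum u C)\<close>, so the subsets with more than \<open>b\<close> elements contribute at most half.\<close>
lemma sum_small_subsets_ge_half_prod:
  fixes u :: "'a \<Rightarrow> real"
  assumes "finite C" "\<And>p. p \<in> C \<Longrightarrow> 0 \<le> u p" "real b \<ge> 2 * sum u C + 1"
  shows "(\<Sum>B | B \<subseteq> C \<and> card B \<le> b. prod u B) \<ge> (\<Prod>p\<in>C. 1 + u p) / 2"
proof -
  define G where "G = sum u C"
  have "2 ^ b * (\<Sum>B | B \<subseteq> C \<and> \<not> card B \<le> b. prod u B) = (\<Sum>B | B \<subseteq> C \<and> \<not> card B \<le> b. 2 ^ b * prod u B)"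
    by (simp add: sum_distrib_left)
  also have "\<dots> \<le> (\<Sum>B | B \<subseteq> C \<and> \<not> card B \<le> b. 2 ^ card B * prod u B)"
    using assms by (intro sum_mono mult_right_mono prod_nonneg power_increasing) auto
  also have "\<dots> \<le> (\<Sum>B\<in>Pow C. 2 ^ card B * prod u B)"
    using assms by (intro sum_mono2 mult_nonneg_nonneg prod_nonneg) auto
  also have "\<dots> = (\<Prod>p\<in>C. 2 * u p + 1)"
    using assms by (subst prod_add) (auto simp: prod.distrib)
  also have "\<dots> \<le> (\<Prod>p\<in>C. (1 + u p) * exp (u p))"
  proof (intro prod_mono conjI)
    fix p assume "p \<in> C"
    then have u: "0 \<le> u p" using assms by auto
    then show "0 \<le> 2 * u p + 1" by simp
    have "2 * u p + 1 \<le> (1 + u p) * (1 + u p)" using u by (simp add: algebra_simps)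
    also have "\<dots> \<le> (1 + u p) * exp (u p)" using u by (intro mult_left_mono) auto
    finally show "2 * u p + 1 \<le> (1 + u p) * exp (u p)" .
  qed
  also have "\<dots> = (\<Prod>p\<in>C. 1 + u p) * exp G"
    using assms by (simp add: prod.distrib G_def exp_sum)
  finally have 1: "2 ^ b * (\<Sum>B | B \<subseteq> C \<and> \<not> card B \<le> b. prod u B) \<le> (\<Prod>p\<in>C. 1 + u p) * exp G" .
  have G0: "0 \<le> G" using assms by (auto simp: G_def intro: sum_nonneg)
  have "exp G * 2 \<le> 2 ^ b"
  proof -
    have "ln 2 \<ge> (1/2::real)" using ln_2_less_1 ln_ge_iff[of 2 "1/2"] exp_half_le2 by simp
    then have "2 * G * ln 2 \<ge> 2 * G * (1/2)" using G0 by (intro mult_left_mono) auto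
    moreover have "real b * ln 2 \<ge> (2 * G + 1) * ln 2" using assms by (intro mult_right_mono) (auto simp: G_def)
    ultimately have "G + ln 2 \<le> real b * ln 2" by (simp add: algebra_simps)
    then have "exp (G + ln 2) \<le> exp (real b * ln 2)" by simp
    then show ?thesis by (simp add: exp_add exp_of_nat_mult)
  qed
  then have "(\<Prod>p\<in>C. 1 + u p) * exp G * 2 \<le> (\<Prod>p\<in>C. 1 + u p) * 2 ^ b"
    using assms by (simp add: mult.assoc prod_nonneg mult_left_mono)
  moreover have "2 ^ b * ((\<Sum>B | B \<subseteq> C \<and> \<not> card B \<le> b. prod u B) * 2)
      \<le> (\<Prod>p\<in>C. 1 + u p) * exp G * 2"
    using 1 by simp
  ultimately have "2 ^ b * ((\<Sum>B | B \<subseteq> C \<and> \<not> card B \<le> b. prod u B) * 2) \<le> 2 ^ b * (\<Prod>p\<in>C. 1 + u p)"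
    by (simp only: mult.commute[of "2 ^ b" "\<Prod>p\<in>C. 1 + u p"])
  then have 2: "(\<Sum>B | B \<subseteq> C \<and> \<not> card B \<le> b. prod u B) * 2 \<le> (\<Prod>p\<in>C. 1 + u p)"
    by (simp only: mult_le_cancel_left_pos zero_less_power zero_less_numeral)
  have "(\<Prod>p\<in>C. 1 + u p) = (\<Prod>p\<in>C. u p + 1)" by (simp add: add.commute)
  also have "\<dots> = (\<Sum>B\<in>Pow C. prod u B)" using assms by (subst prod_add) auto
  also have "Pow C = {B. B \<subseteq> C \<and> card B \<le> b} \<union> {B. B \<subseteq> C \<and> \<not> card B \<le> b}" by auto
  also have "sum (prod u) \<dots> = (\<Sum>B | B \<subseteq> C \<and> card B \<le> b. prod u B) + (\<Sum>B | B \<subseteq> C \<and> \<not> card B \<le> b. prod u B)"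
    using assms by (intro sum.union_disjoint) auto
  finally show ?thesis using 2 by linarith
qed


lemma prime_divisors_prod_primes:
  assumes "finite A" "\<And>p. p \<in> A \<Longrightarrow> prime (p::nat)"
  shows "{p. prime p \<and> p dvd \<Prod>A} = A"
  using assms by (auto simp: prime_dvd_prod_iff) (metis primes_dvd_imp_eq)

text \<open>The integers are the products of sets \<open>A\<close> of primes with at most \<open>J_i\<close> elements in each block, and \<open>f\<close> is
  multiplicative with \<open>f(p) = c_i / sqrt p\<close>. Correlations are bounded below by keeping only the
  integers \<open>n m\<close> with exactly \<open>J_i\<close> primes in each block, and the divisors \<open>n\<close> with at most \<open>b\<close> primes;
  the latter restriction makes the smoothing weight at least \<open>\<omega>\<close>. Restricting to full integers costs
  the factor \<open>\<Prod> (J_i + 1)\<close>.\<close>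
lemma resonator_from_blocks:
  fixes P :: "'i \<Rightarrow> nat set" and J :: "'i \<Rightarrow> nat" and c \<mu> :: "'i \<Rightarrow> real"
  assumes fin: "finite I" "\<And>i. i \<in> I \<Longrightarrow> finite (P i)" and disj: "disjoint_family_on P I"
    and prime: "\<And>i p. i \<in> I \<Longrightarrow> p \<in> P i \<Longrightarrow> prime p"
    and c: "\<And>i. i \<in> I \<Longrightarrow> 0 < c i"
    and \<mu>: "\<And>i p. i \<in> I \<Longrightarrow> p \<in> P i \<Longrightarrow> (c i)\<^sup>2 / real p \<le> \<mu> i" "\<And>i. i \<in> I \<Longrightarrow> 0 \<le> \<mu> i"
    and large: "\<And>i. i \<in> I \<Longrightarrow> real (J i) * (1 + \<mu> i) \<le> (\<Sum>p\<in>P i. (c i)\<^sup>2 / real p)"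
    and b: "real b \<ge> 2 * (\<Sum>i\<in>I. real (J i) / c i) + 1"
    and L: "\<And>i p. i \<in> I \<Longrightarrow> p \<in> P i \<Longrightarrow> ln (real p) \<le> L"
    and w: "\<And>n. 0 \<le> w n" "\<And>n. 1 \<le> n \<Longrightarrow> ln (real n) \<le> real b * L \<Longrightarrow> \<omega> \<le> w n" "0 \<le> \<omega>" "0 \<le> L"
  shows "\<exists>M f Q. resonates w M f Q (\<omega> / 2 * (\<Prod>i\<in>I. (1 + 1 / c i) ^ J i / real (J i + 1))) \<and>
      card M = (\<Prod>i\<in>I. card {X. X \<subseteq> P i \<and> card X \<le> J i})"
proof -
  define U where "U = (\<Union>i\<in>I. P i)"
  define cc where "cc p = (if p \<in> U then c (THE i. i \<in> I \<and> p \<in> P i) else 1)" for p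
  define g where "g p = cc p / sqrt (real p)" for p
  define f where "f n = (\<Prod>p | prime p \<and> p dvd n. g p)" for n :: nat
  define \<C> where "\<C> = {A. A \<subseteq> U \<and> (\<forall>i\<in>I. A \<inter> P i \<in> {X. X \<subseteq> P i \<and> card X \<le> J i})}"
  define Top where "Top = {A. A \<subseteq> U \<and> (\<forall>i\<in>I. A \<inter> P i \<in> {X. X \<subseteq> P i \<and> card X = J i})}"
  define \<B> where "\<B> = {B. B \<subseteq> U \<and> card B \<le> b}"
  have finU: "finite U" using fin by (auto simp: U_def)
  have primeU: "prime p" if "p \<in> U" for p using that prime by (auto simp: U_def)
  have cc: "cc p = c i" if "i \<in> I" "p \<in> P i" for i p
  proof -
    have "(THE i. i \<in> I \<and> p \<in> P i) = i"
      using that disj by (intro the_equality) (auto simp: disjoint_family_on_def)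
    then show ?thesis using that by (auto simp: cc_def U_def)
  qed
  have ccpos: "0 < cc p" if "p \<in> U" for p using that cc c by (auto simp: U_def)
  have gpos: "0 < g p" if "p \<in> U" for p
    using ccpos[OF that] primeU[OF that] by (auto simp: g_def prime_gt_0_nat)
  have cc0: "0 \<le> cc p" for p using ccpos[of p] by (cases "p \<in> U") (auto simp: cc_def)
  have f0: "0 \<le> f n" for n unfolding f_def g_def using cc0 by (intro prod_nonneg) auto
  have supp: "{p. prime p \<and> p dvd \<Prod>A} = A" if "A \<subseteq> U" for A
    using that finU primeU by (intro prime_divisors_prod_primes) (auto intro: finite_subset)
  have f_prod: "f (\<Prod>A) = prod g A" if "A \<subseteq> U" for A
    unfolding f_def supp[OF that] ..
  have inj: "inj_on (\<lambda>A. \<Prod>A) (Pow U)"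
    by (rule inj_onI) (metis supp PowD)
  have pos: "0 < \<Prod>A" if "A \<subseteq> U" for A
    using that primeU by (intro prod_pos) (auto simp: prime_gt_0_nat)
  have fin\<C>: "finite \<C>" "finite \<B>" "finite Top"
    using finU by (auto simp: \<C>_def \<B>_def Top_def intro: finite_subset[of _ "Pow U"])
  have TopC: "Top \<subseteq> \<C>" unfolding Top_def \<C>_def by auto
  have CU: "\<C> \<subseteq> Pow U" and BU: "\<B> \<subseteq> Pow U" by (auto simp: \<C>_def \<B>_def)
  have down: "A \<in> \<C>" if "C \<in> \<C>" "A \<subseteq> C" for A C
  proof -
    have "card (A \<inter> P i) \<le> J i" if "i \<in> I" for i
    proof -
      have "card (A \<inter> P i) \<le> card (C \<inter> P i)"
        using that fin \<open>A \<subseteq> C\<close> by (intro card_mono) auto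
      also have "\<dots> \<le> J i" using \<open>C \<in> \<C>\<close> that by (auto simp: \<C>_def)
      finally show ?thesis .
    qed
    then show ?thesis using that by (auto simp: \<C>_def)
  qed
  define M where "M = (\<lambda>A. \<Prod>A) ` \<C>"
  define Q where "Q = (\<lambda>A. \<Prod>A) ` \<B>"
  have sumM: "(\<Sum>m\<in>M. h m) = (\<Sum>A\<in>\<C>. h (\<Prod>A))" for h :: "nat \<Rightarrow> real"
    unfolding M_def using inj CU by (subst sum.reindex) (auto intro: inj_on_subset)
  have sumQ: "(\<Sum>m\<in>Q. h m) = (\<Sum>A\<in>\<B>. h (\<Prod>A))" for h :: "nat \<Rightarrow> real"
    unfolding Q_def using inj BU by (subst sum.reindex) (auto intro: inj_on_subset)
  have g2: "(g p)\<^sup>2 = (c i)\<^sup>2 / real p" if "i \<in> I" "p \<in> P i" for i p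
    using cc[OF that] by (simp add: g_def power_divide)
  have f2: "(f (\<Prod>A))\<^sup>2 = (\<Prod>p\<in>A. (g p)\<^sup>2)" if "A \<subseteq> U" for A
    by (simp add: f_prod[OF that] prod_power_distrib)

  have S: "(\<Sum>m\<in>M. (f m)\<^sup>2) = (\<Prod>i\<in>I. \<Sum>X | X \<subseteq> P i \<and> card X \<le> J i. \<Prod>p\<in>X. (g p)\<^sup>2)"
  proof -
    have "(\<Sum>m\<in>M. (f m)\<^sup>2) = (\<Sum>A\<in>\<C>. \<Prod>p\<in>A. (g p)\<^sup>2)"
      unfolding sumM using CU by (intro sum.cong refl f2) auto
    also have "\<dots> = (\<Prod>i\<in>I. \<Sum>X | X \<subseteq> P i \<and> card X \<le> J i. \<Prod>p\<in>X. (g p)\<^sup>2)"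
      unfolding \<C>_def U_def using fin disj by (intro sum_over_blocks_eq_prod) auto
    finally show ?thesis .
  qed
  have T: "(\<Sum>A\<in>Top. (f (\<Prod>A))\<^sup>2) = (\<Prod>i\<in>I. \<Sum>X | X \<subseteq> P i \<and> card X = J i. \<Prod>p\<in>X. (g p)\<^sup>2)"
  proof -
    have "(\<Sum>A\<in>Top. (f (\<Prod>A))\<^sup>2) = (\<Sum>A\<in>Top. \<Prod>p\<in>A. (g p)\<^sup>2)"
      using CU TopC by (intro sum.cong refl f2) auto
    also have "\<dots> = (\<Prod>i\<in>I. \<Sum>X | X \<subseteq> P i \<and> card X = J i. \<Prod>p\<in>X. (g p)\<^sup>2)"
      unfolding Top_def U_def using fin disj by (intro sum_over_blocks_eq_prod) auto
    finally show ?thesis .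
  qed
  have ST: "(\<Sum>m\<in>M. (f m)\<^sup>2) \<le> (\<Prod>i\<in>I. real (J i + 1)) * (\<Sum>A\<in>Top. (f (\<Prod>A))\<^sup>2)"
    unfolding S T prod.distrib[symmetric]
  proof (intro prod_mono conjI sum_nonneg prod_nonneg)
    fix i assume i: "i \<in> I"
    show "(\<Sum>X | X \<subseteq> P i \<and> card X \<le> J i. \<Prod>p\<in>X. (g p)\<^sup>2)
        \<le> real (J i + 1) * (\<Sum>X | X \<subseteq> P i \<and> card X = J i. \<Prod>p\<in>X. (g p)\<^sup>2)"
      using fin i g2[OF i] \<mu>[OF i] large[OF i] by (intro sum_subsets_le_top_layer[where \<mu> = "\<mu> i"]) auto
  qed auto

  have prod_cc: "(\<Prod>p\<in>C. 1 + 1 / cc p) = (\<Prod>i\<in>I. (1 + 1 / c i) ^ J i)"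
    and sum_cc: "(\<Sum>p\<in>C. 1 / cc p) = (\<Sum>i\<in>I. real (J i) / c i)" if C: "C \<in> Top" for C
  proof -
    have CI: "C = (\<Union>i\<in>I. C \<inter> P i)" using C by (auto simp: Top_def U_def)
    have d: "\<forall>i\<in>I. \<forall>j\<in>I. i \<noteq> j \<longrightarrow> (C \<inter> P i) \<inter> (C \<inter> P j) = {}"
      using disjoint_family_onD[OF disj] by (simp add: Int_assoc Int_left_commute)
    have cJ: "card (C \<inter> P i) = J i" if "i \<in> I" for i using C that by (auto simp: Top_def)
    have "(\<Prod>p\<in>C. 1 + 1 / cc p) = (\<Prod>i\<in>I. \<Prod>p\<in>C \<inter> P i. 1 + 1 / cc p)"
      using fin d by (subst CI, intro prod.UNION_disjoint) auto
    also have "\<dots> = (\<Prod>i\<in>I. (1 + 1 / c i) ^ J i)"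
      using cJ cc by (intro prod.cong refl) (simp add: prod.cong)
    finally show "(\<Prod>p\<in>C. 1 + 1 / cc p) = (\<Prod>i\<in>I. (1 + 1 / c i) ^ J i)" .
    have "(\<Sum>p\<in>C. 1 / cc p) = (\<Sum>i\<in>I. \<Sum>p\<in>C \<inter> P i. 1 / cc p)"
      using fin d by (subst CI, intro sum.UNION_disjoint) auto
    also have "\<dots> = (\<Sum>i\<in>I. real (J i) / c i)"
      using cJ cc by (intro sum.cong refl) (simp add: sum.cong)
    finally show "(\<Sum>p\<in>C. 1 / cc p) = (\<Sum>i\<in>I. real (J i) / c i)" .
  qed

  define D where "D = (\<Prod>i\<in>I. (1 + 1 / c i) ^ J i)"
  have w\<omega>: "\<omega> \<le> w (\<Prod>B)" if B: "B \<in> \<B>" for B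
  proof (rule w(2))
    have BsU: "B \<subseteq> U" using B by (auto simp: \<B>_def)
    show "1 \<le> \<Prod>B" using pos[OF BsU] by simp
    have "ln (real (\<Prod>B)) = (\<Sum>p\<in>B. ln (real p))"
      using BsU primeU finU by (simp add: ln_prod finite_subset prime_gt_0_nat subset_eq)
    also have "\<dots> \<le> real (card B) * L"
      using BsU L by (intro sum_bounded_above) (auto simp: U_def)
    also have "\<dots> \<le> real b * L" using B w by (intro mult_right_mono) (auto simp: \<B>_def)
    finally show "ln (real (\<Prod>B)) \<le> real b * L" .
  qed
  have "\<omega> * (D / 2) * (\<Sum>A\<in>Top. (f (\<Prod>A))\<^sup>2) = (\<Sum>C\<in>Top. \<omega> * (f (\<Prod>C))\<^sup>2 * (D / 2))"
    by (simp add: sum_distrib_left mult_ac)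
  also have "\<dots> \<le> (\<Sum>C\<in>Top. \<omega> * (f (\<Prod>C))\<^sup>2 * (\<Sum>B | B \<subseteq> C \<and> card B \<le> b. \<Prod>p\<in>B. 1 / cc p))"
  proof (intro sum_mono mult_left_mono mult_nonneg_nonneg)
    fix C assume C: "C \<in> Top"
    show "D / 2 \<le> (\<Sum>B | B \<subseteq> C \<and> card B \<le> b. \<Prod>p\<in>B. 1 / cc p)"
      unfolding D_def prod_cc[OF C, symmetric]
      using C b sum_cc[OF C] cc0 finU
      by (intro sum_small_subsets_ge_half_prod) (auto simp: Top_def intro: finite_subset)
  qed (use w in auto)
  also have "\<dots> = (\<Sum>C\<in>Top. \<Sum>B | B \<in> \<B> \<and> B \<subseteq> C. \<omega> * ((f (\<Prod>C))\<^sup>2 * (\<Prod>p\<in>B. 1 / cc p)))"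
    unfolding sum_distrib_left
    by (intro sum.cong) (auto simp: \<B>_def Top_def mult_ac)
  also have "\<dots> = (\<Sum>B\<in>\<B>. \<Sum>C | C \<in> Top \<and> B \<subseteq> C. \<omega> * ((f (\<Prod>C))\<^sup>2 * (\<Prod>p\<in>B. 1 / cc p)))"
    using fin\<C> by (intro sum.swap_restrict) auto
  also have "\<dots> \<le> (\<Sum>B\<in>\<B>. \<Sum>C | C \<in> Top \<and> B \<subseteq> C. w (\<Prod>B) / sqrt (real (\<Prod>B)) * (f (\<Prod>(C - B)) * f (\<Prod>C)))"
  proof (intro sum_mono)
    fix B C assume B: "B \<in> \<B>" and C: "C \<in> {C. C \<in> Top \<and> B \<subseteq> C}"
    have sub: "C \<subseteq> U" "B \<subseteq> U" "B \<subseteq> C" "C - B \<subseteq> U" using B C by (auto simp: Top_def \<B>_def)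
    have fC: "f (\<Prod>C) = f (\<Prod>(C - B)) * prod g B"
      unfolding f_prod[OF sub(1)] f_prod[OF sub(4)]
      using sub finU by (intro prod.subset_diff) (auto intro: finite_subset)
    have gB: "prod g B * (\<Prod>p\<in>B. 1 / cc p) = 1 / sqrt (real (\<Prod>B))"
    proof -
      have "prod g B * (\<Prod>p\<in>B. 1 / cc p) = (\<Prod>p\<in>B. 1 / sqrt (real p))"
        unfolding prod.distrib[symmetric] g_def using ccpos sub
        by (intro prod.cong refl) (force simp: field_simps)
      also have "\<dots> = 1 / sqrt (real (\<Prod>B))"
      proof -
        have "sqrt (real (\<Prod>B)) = (\<Prod>p\<in>B. sqrt (real p))"
          by (induction B rule: infinite_finite_induct) (auto simp: real_sqrt_mult)
        then show ?thesis by (simp add: prod_dividef)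
      qed
      finally show ?thesis .
    qed
    have "(f (\<Prod>C))\<^sup>2 * (\<Prod>p\<in>B. 1 / cc p) = (f (\<Prod>C) * (\<Prod>p\<in>B. 1 / cc p)) * f (\<Prod>C)"
      by (simp only: power2_eq_square mult_ac)
    also have "f (\<Prod>C) * (\<Prod>p\<in>B. 1 / cc p) = f (\<Prod>(C - B)) * (1 / sqrt (real (\<Prod>B)))"
      by (simp only: fC mult.assoc gB)
    also have "\<dots> * f (\<Prod>C) = 1 / sqrt (real (\<Prod>B)) * (f (\<Prod>(C - B)) * f (\<Prod>C))"
      by (simp only: mult_ac)
    finally have "(f (\<Prod>C))\<^sup>2 * (\<Prod>p\<in>B. 1 / cc p)
        = 1 / sqrt (real (\<Prod>B)) * (f (\<Prod>(C - B)) * f (\<Prod>C))" .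
    then have "\<omega> * ((f (\<Prod>C))\<^sup>2 * (\<Prod>p\<in>B. 1 / cc p))
        = \<omega> * (1 / sqrt (real (\<Prod>B)) * (f (\<Prod>(C - B)) * f (\<Prod>C)))" by (rule arg_cong)
    also have "\<dots> \<le> w (\<Prod>B) * (1 / sqrt (real (\<Prod>B)) * (f (\<Prod>(C - B)) * f (\<Prod>C)))"
      using w\<omega>[OF B] f0 by (intro mult_right_mono mult_nonneg_nonneg) (auto intro!: prod_nonneg)
    finally show "\<omega> * ((f (\<Prod>C))\<^sup>2 * (\<Prod>p\<in>B. 1 / cc p))
        \<le> w (\<Prod>B) / sqrt (real (\<Prod>B)) * (f (\<Prod>(C - B)) * f (\<Prod>C))" by simp
  qed
  also have "\<dots> \<le> (\<Sum>B\<in>\<B>. w (\<Prod>B) / sqrt (real (\<Prod>B)) * dilation_sum M f (\<Prod>B))"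
    unfolding sum_distrib_left[symmetric]
  proof (intro sum_mono mult_left_mono)
    fix B assume B: "B \<in> \<B>"
    have fB: "finite B" using B finU by (auto simp: \<B>_def intro: finite_subset)
    have prod_eq: "\<Prod>B * \<Prod>(C - B) = \<Prod>C" if "C \<in> Top" "B \<subseteq> C" for C
    proof -
      have "finite C" using that finU by (auto simp: Top_def intro: finite_subset)
      then show ?thesis using that prod.subset_diff[of B C "\<lambda>x. x"] by (simp add: mult.commute)
    qed
    have "(\<Sum>C | C \<in> Top \<and> B \<subseteq> C. f (\<Prod>(C - B)) * f (\<Prod>C))
        = (\<Sum>C | C \<in> Top \<and> B \<subseteq> C. f (\<Prod>(C - B)) * f (\<Prod>B * \<Prod>(C - B)))"
      by (intro sum.cong refl) (simp add: prod_eq)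
    also have "\<dots> = (\<Sum>m\<in>(\<lambda>C. \<Prod>(C - B)) ` {C. C \<in> Top \<and> B \<subseteq> C}. f m * f (\<Prod>B * m))"
    proof (subst sum.reindex)
      show "inj_on (\<lambda>C. \<Prod>(C - B)) {C. C \<in> Top \<and> B \<subseteq> C}"
      proof (rule inj_onI)
        fix C C' assume C: "C \<in> {C. C \<in> Top \<and> B \<subseteq> C}" "C' \<in> {C. C \<in> Top \<and> B \<subseteq> C}"
          and e: "\<Prod>(C - B) = \<Prod>(C' - B)"
        have "C - B = C' - B"
          using C by (intro inj_onD[OF inj e]) (auto simp: Top_def)
        then show "C = C'" using C by auto
      qed
    qed simp
    also have "\<dots> \<le> dilation_sum M f (\<Prod>B)"
    proof (intro sum_mono2 mult_nonneg_nonneg f0)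
      show "finite {m. m \<in> M \<and> (\<Prod>B) * m \<in> M}" using fin\<C> by (auto simp: M_def)
      show "(\<lambda>C. \<Prod>(C - B)) ` {C. C \<in> Top \<and> B \<subseteq> C} \<subseteq> {m. m \<in> M \<and> (\<Prod>B) * m \<in> M}"
      proof safe
        fix C assume C: "C \<in> Top" "B \<subseteq> C"
        show "\<Prod>(C - B) \<in> M" unfolding M_def using C TopC down[of C "C - B"] by auto
        show "\<Prod>B * \<Prod>(C - B) \<in> M" unfolding M_def prod_eq[OF C] using C TopC by auto
      qed
    qed
    finally show "(\<Sum>C | C \<in> Top \<and> B \<subseteq> C. f (\<Prod>(C - B)) * f (\<Prod>C))
      \<le> dilation_sum M f (\<Prod>B)" .
  qed (use w in \<open>auto intro!: divide_nonneg_nonneg prod_nonneg\<close>)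
  also have "\<dots> = (\<Sum>n\<in>Q. w n / sqrt (real n) * dilation_sum M f n)"
    by (simp only: sumQ)
  finally have main: "\<omega> * (D / 2) * (\<Sum>A\<in>Top. (f (\<Prod>A))\<^sup>2)
    \<le> (\<Sum>n\<in>Q. w n / sqrt (real n) * dilation_sum M f n)" .

  have D0: "0 \<le> D"
    unfolding D_def
  proof (intro prod_nonneg zero_le_power)
    fix i assume "i \<in> I"
    then have "0 < 1 / c i" using c by simp
    then show "0 \<le> 1 + 1 / c i" by linarith
  qed
  have Jp: "0 < (\<Prod>i\<in>I. real (J i + 1))" by (intro prod_pos) auto
  have "\<omega> / 2 * (\<Prod>i\<in>I. (1 + 1 / c i) ^ J i / real (J i + 1)) * (\<Sum>m\<in>M. (f m)\<^sup>2)
     = \<omega> * (D / 2) * ((\<Sum>m\<in>M. (f m)\<^sup>2) / (\<Prod>i\<in>I. real (J i + 1)))"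
    by (simp add: D_def prod_dividef)
  also have "\<dots> \<le> \<omega> * (D / 2) * (\<Sum>A\<in>Top. (f (\<Prod>A))\<^sup>2)"
    using ST D0 Jp w by (intro mult_left_mono) (simp_all add: divide_le_eq mult.commute)
  also note main
  finally have fin_ineq: "\<omega> / 2 * (\<Prod>i\<in>I. (1 + 1 / c i) ^ J i / real (J i + 1)) * (\<Sum>m\<in>M. (f m)\<^sup>2)
     \<le> (\<Sum>n\<in>Q. w n / sqrt (real n) * dilation_sum M f n)" .

  have cardM: "card M = (\<Prod>i\<in>I. card {X. X \<subseteq> P i \<and> card X \<le> J i})"
  proof -
    have CM: "card M = card \<C>" unfolding M_def using inj CU by (intro card_image) (auto intro: inj_on_subset)
    have "real (card \<C>) = (\<Sum>A\<in>\<C>. \<Prod>p\<in>A. 1)" by simp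
    also have "\<dots> = (\<Prod>i\<in>I. \<Sum>X | X \<subseteq> P i \<and> card X \<le> J i. \<Prod>p\<in>X. 1)"
      unfolding \<C>_def U_def using fin disj by (intro sum_over_blocks_eq_prod) auto
    finally have "real (card \<C>) = real (\<Prod>i\<in>I. card {X. X \<subseteq> P i \<and> card X \<le> J i})" by simp
    then show ?thesis unfolding CM by (rule of_nat_eq_iff[THEN iffD1])
  qed
  have Spos: "(\<Sum>m\<in>M. (f m)\<^sup>2) > 0"
  proof -
    have "{} \<in> \<C>" by (auto simp: \<C>_def)
    then have "1 \<in> M" unfolding M_def by (intro image_eqI[of _ _ "{}"]) auto
    moreover have "f 1 = 1" using f_prod[of "{}"] by simp
    moreover have "finite M" using fin\<C> by (simp add: M_def)
    ultimately show ?thesis by (intro sum_pos2[of _ 1]) auto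
  qed
  have fin': "finite M" "finite Q" using fin\<C> by (auto simp: M_def Q_def)
  have nz: "0 \<notin> M"
  proof
    assume "0 \<in> M"
    then obtain A where "A \<in> \<C>" "\<Prod>A = 0" by (metis M_def imageE)
    then show False using pos[of A] CU by auto
  qed
  have nzQ: "0 \<notin> Q"
  proof
    assume "0 \<in> Q"
    then obtain A where "A \<in> \<B>" "\<Prod>A = 0" by (metis Q_def imageE)
    then show False using pos[of A] BU by auto
  qed
  show ?thesis
    unfolding resonates_def by (intro exI conjI allI) (rule fin' nz nzQ f0 Spos cardM fin_ineq)+
qed

section \<open>Choosing the blocks\<close>

text \<open>Since \<open>log p \<le> B\<close> throughout the window, \<open>1/p \<ge> (log p / p) / B\<close>.\<close>
lemma reciprocal_primes_window:
  "\<exists>C\<ge>0. \<forall>x h h' B::real. 1 \<le> x \<longrightarrow> 0 \<le> h \<longrightarrow> h \<le> h' \<longrightarrow> 0 < B \<longrightarrow> ln x + h' \<le> B \<longrightarrow>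
     (\<Sum>p | prime p \<and> x * exp h < real p \<and> real p \<le> x * exp h'. 1 / real p) \<ge> (h' - h - C) / B"
proof -
  obtain C where C: "C \<ge> 0" "\<And>x y::real. 1 \<le> x \<Longrightarrow> x \<le> y \<Longrightarrow>
      (\<Sum>p | prime p \<and> x < real p \<and> real p \<le> y. ln (real p) / real p) \<ge> ln y - ln x - C"
    using mertens_interval_lower by blast
  show ?thesis
  proof (intro exI[of _ C] conjI allI impI C(1))
    fix x h h' B :: real
    assume H: "1 \<le> x" "0 \<le> h" "h \<le> h'" "0 < B" "ln x + h' \<le> B"
    have "1 * 1 \<le> x * exp h" using H by (intro mult_mono) auto
    moreover have "x * exp h \<le> x * exp h'" using H by (intro mult_left_mono) auto
    ultimately have "h' - h - C \<le> (\<Sum>p | prime p \<and> x * exp h < real p \<and> real p \<le> x * exp h'. ln (real p) / real p)"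
      using C(2)[of "x * exp h" "x * exp h'"] H by (simp add: ln_mult)
    also have "\<dots> \<le> (\<Sum>p | prime p \<and> x * exp h < real p \<and> real p \<le> x * exp h'. B * (1 / real p))"
    proof (intro sum_mono)
      fix p assume p: "p \<in> {p. prime p \<and> x * exp h < real p \<and> real p \<le> x * exp h'}"
      then have p0: "0 < real p" by (auto simp: prime_gt_0_nat)
      have "ln (real p) \<le> ln (x * exp h')" using p p0 by (subst ln_le_cancel_iff) auto
      also have "\<dots> \<le> B" using H by (simp add: ln_mult)
      finally show "ln (real p) / real p \<le> B * (1 / real p)" using p0 by (simp add: divide_right_mono)
    qed
    also have "\<dots> = B * (\<Sum>p | prime p \<and> x * exp h < real p \<and> real p \<le> x * exp h'. 1 / real p)"
      by (simp add: sum_distrib_left)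
    finally show "(\<Sum>p | prime p \<and> x * exp h < real p \<and> real p \<le> x * exp h'. 1 / real p) \<ge> (h' - h - C) / B"
      using H by (simp add: divide_le_eq mult.commute)
  qed
qed

text \<open>The proportion of the optimal exponent that survives the roundings when all relative errors are
  governed by \<open>\<delta>\<close>; it tends to \<open>1\<close> as \<open>\<delta> \<rightarrow> 0\<close>.\<close>
definition gain :: "real \<Rightarrow> real" where
  "gain \<delta> = (1 - \<delta>)\<^sup>2 * sqrt ((1 - \<delta>)\<^sup>2 * (1 - 3 * \<delta>) / ((1 + 2 * \<delta>) * (1 + \<delta>)))"

text \<open>The choice of the blocks. Here \<open>l\<close> stands for \<open>log T\<close>, and \<open>y = log l\<close>, \<open>z = log y\<close>. Because \<open>h_i\<close> is at
  least a power of \<open>y\<close>, quantities of the size of \<open>z\<close> are negligible compared with it, and the number of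
  primes in a block may be bounded by the number of integers.\<close>
lemma large_correlations:
  fixes \<kappa> \<delta> :: real
  assumes \<kappa>: "0 < \<kappa>" "\<kappa> \<le> 1" and \<delta>: "0 < \<delta>" "\<delta> < 1 / 4"
  shows "\<forall>\<^sub>F l in at_top. \<exists>M f Q. real (card M) \<le> exp (\<kappa> * l) \<and>
      resonates (log_gauss (l powr (3/4))) M f Q (exp (gain \<delta> * sqrt \<kappa> * sqrt (l * ln (ln l) / ln l)))"
proof -
  obtain C where C: "C \<ge> 0" "\<And>x h h' B::real. 1 \<le> x \<Longrightarrow> 0 \<le> h \<Longrightarrow> h \<le> h' \<Longrightarrow> 0 < B \<Longrightarrow> ln x + h' \<le> B \<Longrightarrow>
     (\<Sum>p | prime p \<and> x * exp h < real p \<and> real p \<le> x * exp h'. 1 / real p) \<ge> (h' - h - C) / B"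
    using reciprocal_primes_window by blast
  define \<theta> where "\<theta> = sqrt ((1 - \<delta>)\<^sup>2 * (1 - 3 * \<delta>) / ((1 + 2 * \<delta>) * (1 + \<delta>)))"
  have \<theta>: "\<theta> > 0" using \<delta> by (simp add: \<theta>_def)
  define \<epsilon> where "\<epsilon> = \<delta> * (1 - \<delta>) * \<theta> * sqrt \<kappa>"
  have \<epsilon>: "\<epsilon> > 0" using \<delta> \<theta> \<kappa> by (simp add: \<epsilon>_def)
  define D where "D = ln (1 + \<delta>)"
  have D: "0 < D" "D \<le> \<delta>" using \<delta> ln_add_one_self_le_self[of \<delta>] by (auto simp: D_def)
  have a1: "\<forall>\<^sub>F l::real in at_top. ln (ln l) \<ge> 1" by real_asymp
  have a1': "\<forall>\<^sub>F l::real in at_top. ln l \<ge> 1" by real_asymp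
  have a2: "\<forall>\<^sub>F l in at_top. C \<le> \<delta>\<^sup>2 / 2 * ln l powr \<delta>" using \<delta> by real_asymp
  have a3: "\<forall>\<^sub>F l in at_top. ln l powr (1 - \<delta>) \<le> \<delta> / 2 * ln l" using \<delta> by real_asymp
  have a4: "\<forall>\<^sub>F l in at_top. ln (ln l) / D \<le> ln l" using D by real_asymp
  have a4': "\<forall>\<^sub>F l in at_top. (1 - 2 * \<delta>) * ln (ln l) / D \<ge> 1" using D \<delta> by real_asymp
  have a6: "\<forall>\<^sub>F l in at_top. 4 * ln l \<le> \<delta>\<^sup>2 * exp (ln l powr \<delta>)" using \<delta> by real_asymp
  have a7: "\<forall>\<^sub>F l in at_top. 4 * (ln l)\<^sup>2 \<le> \<kappa> * l * \<delta>\<^sup>2" using \<delta> \<kappa> by real_asymp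
  have a8: "\<forall>\<^sub>F l in at_top. 32 * (ln l) ^ 4 * l powr (1/4) + 1 + 2 * (ln l)\<^sup>2 \<le> \<epsilon> * sqrt (l * ln (ln l) / ln l)"
    using \<epsilon> by real_asymp
  have a9: "\<forall>\<^sub>F l in at_top. 1 + ln (4 / \<kappa>) + 2 * ln (ln l) \<le> \<delta> * ln l powr \<delta>" using \<delta> by real_asymp
  show ?thesis
    using eventually_ge_at_top[of 1] a1 a1' a2 a3 a4 a4' a6 a7 a8 a9
  proof eventually_elim
    fix l :: real
    define y where "y = ln l"
    define z where "z = ln y"
    assume l1: "1 \<le> l" and "1 \<le> ln (ln l)" "1 \<le> ln l" "C \<le> \<delta>\<^sup>2 / 2 * ln l powr \<delta>"
      "ln l powr (1 - \<delta>) \<le> \<delta> / 2 * ln l" "ln (ln l) / D \<le> ln l" "(1 - 2 * \<delta>) * ln (ln l) / D \<ge> 1"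
      "4 * ln l \<le> \<delta>\<^sup>2 * exp (ln l powr \<delta>)" "4 * (ln l)\<^sup>2 \<le> \<kappa> * l * \<delta>\<^sup>2"
      "32 * (ln l) ^ 4 * l powr (1/4) + 1 + 2 * (ln l)\<^sup>2 \<le> \<epsilon> * sqrt (l * ln (ln l) / ln l)"
      "1 + ln (4 / \<kappa>) + 2 * ln (ln l) \<le> \<delta> * ln l powr \<delta>"
    then have A1: "1 \<le> z" "1 \<le> y" and A2: "C \<le> \<delta>\<^sup>2 / 2 * y powr \<delta>" and A3: "y powr (1 - \<delta>) \<le> \<delta> / 2 * y"
      and A4: "z / D \<le> y" "1 \<le> (1 - 2 * \<delta>) * z / D" and A6: "4 * y \<le> \<delta>\<^sup>2 * exp (y powr \<delta>)"
      and A7: "4 * y\<^sup>2 \<le> \<kappa> * l * \<delta>\<^sup>2"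
      and A8: "32 * y ^ 4 * l powr (1/4) + 1 + 2 * y\<^sup>2 \<le> \<epsilon> * sqrt (l * z / y)"
      and A9: "1 + ln (4 / \<kappa>) + 2 * z \<le> \<delta> * y powr \<delta>"
      unfolding y_def z_def by auto
    have l0: "l > 0" using l1 by simp
    have y0: "y > 0" "z > 0" using A1 by auto

    \<comment> \<open>The number of blocks is maximal subject to \<open>h_K \<le> y^(1 - \<delta>)\<close>, so that \<open>log p\<close> is asymptotic to \<open>y\<close> on all of them.\<close>
    define K where "K = nat \<lfloor>(1 - 2 * \<delta>) * z / D\<rfloor>"
    have "real K \<le> (1 - 2 * \<delta>) * z / D" "(1 - 2 * \<delta>) * z / D < real K + 1" "1 \<le> K"
      unfolding K_def using A4(2) by (auto simp: le_nat_iff)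
    then have K: "1 \<le> real K" "real K \<le> y" "real K * D \<le> (1 - 2 * \<delta>) * z" "(1 - 3 * \<delta>) * z \<le> \<delta> * real K"
    proof -
      show "1 \<le> real K" using \<open>1 \<le> K\<close> by simp
      have "(1 - 2 * \<delta>) * z / D \<le> z / D" using D \<delta> y0 by (intro divide_right_mono) (auto simp: mult_le_cancel_right1)
      then show "real K \<le> y" using A4(1) \<open>real K \<le> (1 - 2 * \<delta>) * z / D\<close> by linarith
      show "real K * D \<le> (1 - 2 * \<delta>) * z"
        using \<open>real K \<le> (1 - 2 * \<delta>) * z / D\<close> D by (simp add: le_divide_eq)
      have "(1 - 2 * \<delta>) * z < (real K + 1) * D"
        using \<open>(1 - 2 * \<delta>) * z / D < real K + 1\<close> D by (simp add: divide_less_eq)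
      also have "\<dots> \<le> (real K + 1) * \<delta>" using D by (intro mult_left_mono) auto
      finally have "(1 - 2 * \<delta>) * z \<le> \<delta> * real K + \<delta> * 1" by (simp add: algebra_simps)
      also have "\<delta> * 1 \<le> \<delta> * z" using A1 \<delta> by (intro mult_left_mono) auto
      finally show "(1 - 3 * \<delta>) * z \<le> \<delta> * real K" by (simp add: algebra_simps)
    qed
    have K0: "real K > 0" using K by simp

    define h where "h i = y powr \<delta> * (1 + \<delta>) ^ i" for i :: nat
    have yd: "y powr \<delta> \<ge> 1" using A1 \<delta> by (simp add: ge_one_powr_ge_zero)
    have h_ge: "y powr \<delta> \<le> h i" for i
    proof -
      have "1 \<le> (1 + \<delta>) ^ i" using \<delta> by (intro one_le_power) auto
      then have "y powr \<delta> * 1 \<le> y powr \<delta> * (1 + \<delta>) ^ i" by (intro mult_left_mono) auto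
      then show ?thesis by (simp add: h_def)
    qed
    have h1: "1 \<le> h i" for i using yd h_ge[of i] by linarith
    have h0: "0 < h i" for i using h1[of i] by linarith
    have hSuc: "h (Suc i) = (1 + \<delta>) * h i" for i by (simp add: h_def)
    have h_mono: "h i \<le> h j" if "i \<le> j" for i j
      unfolding h_def using that \<delta> by (intro mult_left_mono power_increasing) auto
    have hK: "h i \<le> \<delta> / 2 * y" if "i \<le> K" for i
    proof -
      have "h i \<le> h K" using that by (rule h_mono)
      also have "h K = y powr \<delta> * exp (real K * D)"
        using \<delta> by (simp add: h_def D_def exp_of_nat_mult)
      also have "\<dots> \<le> y powr \<delta> * exp ((1 - 2 * \<delta>) * z)" using K by (intro mult_left_mono) auto
      also have "exp ((1 - 2 * \<delta>) * z) = y powr (1 - 2 * \<delta>)" using y0 by (simp add: z_def powr_def)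
      also have "y powr \<delta> * y powr (1 - 2 * \<delta>) = y powr (1 - \<delta>)" by (simp add: powr_add[symmetric])
      finally show ?thesis using A3 by linarith
    qed
    have hy: "h i \<le> y" if "i \<le> K" for i
    proof -
      have "\<delta> / 2 * y \<le> 1 * y" using \<delta> y0 by (intro mult_right_mono) auto
      then show ?thesis using hK[OF that] by linarith
    qed

    define P where "P i = {p. prime p \<and> l * exp (h i) < real p \<and> real p \<le> l * exp (h (Suc i))}" for i
    \<comment> \<open>A lower bound for \<open>\<Sum> 1/p\<close> over the block: nearly its logarithmic length \<open>\<delta> h_i\<close> divided by \<open>log p\<close>.\<close>
    define s where "s i = (1 - \<delta>) * \<delta> * h i / y" for i
    have s0: "0 < s i" for i using \<delta> h0[of i] y0 by (simp add: s_def)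
    have sP: "s i \<le> (\<Sum>p\<in>P i. 1 / real p)" if i: "i < K" for i
    proof -
      have hs: "h (Suc i) \<le> \<delta> / 2 * y" using hK[of "Suc i"] i by simp
      have "s i \<le> (h (Suc i) - h i - C) / (y * (1 + \<delta> / 2))"
      proof -
        have "\<delta>\<^sup>2 / 2 * y powr \<delta> \<le> \<delta>\<^sup>2 / 2 * h i" using h_ge[of i] by (intro mult_left_mono) auto
        then have "C \<le> \<delta>\<^sup>2 / 2 * h i" using A2 by linarith
        moreover have "h (Suc i) - h i - \<delta>\<^sup>2 / 2 * h i = (1 - \<delta> / 2) * (\<delta> * h i)"
          by (simp add: hSuc power2_eq_square field_simps)
        moreover have "(1 - \<delta>) * (1 + \<delta> / 2) * (\<delta> * h i) \<le> (1 - \<delta> / 2) * (\<delta> * h i)"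
        proof (intro mult_right_mono)
          have "(1 - \<delta>) * (1 + \<delta> / 2) = 1 - \<delta> / 2 - \<delta> * \<delta> / 2" by (simp add: field_simps)
          then show "(1 - \<delta>) * (1 + \<delta> / 2) \<le> 1 - \<delta> / 2" using \<delta> by simp
        qed (use \<delta> h0[of i] in auto)
        ultimately have "(1 - \<delta>) * (1 + \<delta> / 2) * (\<delta> * h i) \<le> h (Suc i) - h i - C" by linarith
        moreover have "(1 - \<delta>) * (1 + \<delta> / 2) * (\<delta> * h i) = (1 - \<delta>) * \<delta> * h i * (1 + \<delta> / 2)"
          by (simp only: mult_ac)
        ultimately have "(1 - \<delta>) * \<delta> * h i * (1 + \<delta> / 2) \<le> h (Suc i) - h i - C" by linarith
        then have "(1 - \<delta>) * \<delta> * h i * (1 + \<delta> / 2) / (y * (1 + \<delta> / 2)) \<le> (h (Suc i) - h i - C) / (y * (1 + \<delta> / 2))"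
          using y0 \<delta> by (intro divide_right_mono) auto
        moreover have "(1 - \<delta>) * \<delta> * h i * (1 + \<delta> / 2) / (y * (1 + \<delta> / 2)) = s i"
          using \<delta> by (simp add: s_def)
        ultimately show ?thesis by simp
      qed
      also have "\<dots> \<le> (\<Sum>p\<in>P i. 1 / real p)"
        unfolding P_def
      proof (rule C(2))
        show "ln l + h (Suc i) \<le> y * (1 + \<delta> / 2)" using hs by (simp add: y_def algebra_simps)
      qed (use l1 h0[of i] y0 \<delta> h_mono[of i "Suc i"] in auto)
      finally show ?thesis .
    qed
    have finP: "finite (P i)" for i
      by (rule finite_subset[of _ "{..nat \<lfloor>l * exp (h (Suc i))\<rfloor>}"]) (auto simp: P_def le_nat_floor)
    have cardP: "real (card (P i)) \<le> l * exp (h (Suc i))" for i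
    proof -
      have "card (P i) \<le> card {1..nat \<lfloor>l * exp (h (Suc i))\<rfloor>}"
        by (intro card_mono) (auto simp: P_def le_nat_floor Suc_le_eq prime_gt_0_nat)
      then have "real (card (P i)) \<le> real (nat \<lfloor>l * exp (h (Suc i))\<rfloor>)" by simp
      also have "\<dots> \<le> l * exp (h (Suc i))" using l0 by simp
      finally show ?thesis .
    qed

    \<comment> \<open>Each prime of block \<open>i\<close> costs about \<open>h_i\<close> in the logarithm of the number of integers, so the budget \<open>\<kappa> l\<close> is divided equally.\<close>
    define X where "X i = \<kappa> * l / (real K * h i * (1 + 2 * \<delta>))" for i
    define J where "J i = nat \<lfloor>X i\<rfloor>" for i
    have X0: "0 < X i" for i using \<kappa> l0 K0 h0[of i] \<delta> by (simp add: X_def)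
    have Xl: "X i \<le> l" for i
    proof -
      have "1 * 1 * 1 \<le> real K * h i * (1 + 2 * \<delta>)" using K h1[of i] \<delta> by (intro mult_mono) auto
      then have "X i \<le> \<kappa> * l / 1" unfolding X_def using \<kappa> l0 by (intro divide_left_mono) auto
      also have "\<dots> \<le> 1 * l" using \<kappa> l0 by simp
      finally show ?thesis by simp
    qed
    have X_ge: "\<kappa> * l / (2 * y\<^sup>2) \<le> X i" if "i \<le> K" for i
    proof -
      have "real K * h i * (1 + 2 * \<delta>) \<le> y * y * 2" using K hy[OF that] h0[of i] \<delta> y0 by (intro mult_mono) auto
      then have "real K * h i * (1 + 2 * \<delta>) \<le> 2 * y\<^sup>2" by (simp add: power2_eq_square)
      moreover have "0 < real K * h i * (1 + 2 * \<delta>)" using K0 h0[of i] \<delta> by (intro mult_pos_pos) auto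
      moreover have "0 \<le> \<kappa> * l" using \<kappa> l0 by simp
      moreover have "0 < 2 * y\<^sup>2" using y0 by simp
      ultimately show ?thesis unfolding X_def by (simp only: divide_left_mono mult_pos_pos)
    qed
    have X_big: "1 / \<delta>\<^sup>2 \<le> X i / 2" if "i \<le> K" for i
    proof -
      have "1 / \<delta>\<^sup>2 \<le> \<kappa> * l / (4 * y\<^sup>2)" using A7 \<delta> y0 by (simp add: divide_simps mult_ac)
      then show ?thesis using X_ge[OF that] by simp
    qed
    have J_le: "real (J i) \<le> X i" for i unfolding J_def using X0[of i] by simp
    have d2: "\<delta>\<^sup>2 \<le> \<delta>" using \<delta> by (simp add: power2_eq_square mult_left_le)
    have J_ge: "(1 - \<delta>) * X i \<le> real (J i)" if "i \<le> K" for i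
    proof -
      have "1 \<le> \<delta> * X i"
      proof -
        have "1 \<le> X i / 2 * \<delta>\<^sup>2" using X_big[OF that] \<delta> by (simp add: divide_le_eq)
        also have "\<dots> \<le> X i * \<delta>" using d2 X0[of i] by (intro mult_mono) auto
        finally show ?thesis by (simp add: mult.commute)
      qed
      moreover have "X i - 1 < real (J i)" unfolding J_def using X0[of i] by linarith
      ultimately show ?thesis by (simp add: algebra_simps)
    qed
    have J_big: "1 / \<delta>\<^sup>2 \<le> real (J i)" if "i \<le> K" for i
    proof -
      have "1 / 2 * X i \<le> (1 - \<delta>) * X i" using \<delta> X0[of i] by (intro mult_right_mono) auto
      then show ?thesis using J_ge[OF that] X_big[OF that] by simp
    qed
    have J1: "1 \<le> real (J i)" if "i \<le> K" for i
    proof -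
      have "1 \<le> 1 / \<delta>\<^sup>2" using \<delta> d2 by simp
      then show ?thesis using J_big[OF that] by linarith
    qed

    \<comment> \<open>The smallest \<open>c_i\<close> for which the total weight \<open>c_i^2 \<Sum> 1/p\<close> is known to be at least \<open>1 + \<delta>\<close> times \<open>J_i\<close>.\<close>
    define c where "c i = sqrt ((1 + \<delta>) * real (J i) / s i)" for i
    have c2: "(c i)\<^sup>2 = (1 + \<delta>) * real (J i) / s i" for i
      using \<delta> s0[of i] by (simp add: c_def)
    have c0: "0 < c i" if "i \<le> K" for i
      using J1[OF that] s0[of i] \<delta> by (simp add: c_def)
    have s1: "s i \<le> \<delta> * h i / y" for i
    proof -
      have "(1 - \<delta>) * (\<delta> * h i) \<le> 1 * (\<delta> * h i)" using \<delta> h0[of i] by (intro mult_right_mono) auto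
      then show ?thesis using y0 by (simp add: s_def divide_right_mono mult_ac)
    qed
    have s_le_1: "s i \<le> 1" if "i \<le> K" for i
    proof -
      have "\<delta> * h i \<le> 1 * y" using \<delta> hy[OF that] h0[of i] by (intro mult_mono) auto
      then have "\<delta> * h i / y \<le> 1" using y0 by simp
      then show ?thesis using s1[of i] by linarith
    qed
    have c_inv: "1 / c i \<le> \<delta>" if "i \<le> K" for i
    proof -
      have "1 / \<delta>\<^sup>2 \<le> 1 * real (J i) / 1" using J_big[OF that] by simp
      also have "\<dots> \<le> (1 + \<delta>) * real (J i) / s i"
        using \<delta> s0[of i] s_le_1[OF that] by (intro frac_le mult_right_mono) auto
      finally have "(1 / \<delta>)\<^sup>2 \<le> (c i)\<^sup>2" using c2[of i] by (simp add: power_divide)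
      then have "1 / \<delta> \<le> c i" by (rule power2_le_imp_le) (use c0[OF that] in simp)
      then have "1 \<le> c i * \<delta>" using \<delta> by (simp only: pos_divide_le_eq)
      then have "1 \<le> \<delta> * c i" by (simp only: mult.commute)
      then show ?thesis using c0[OF that] by (simp only: pos_divide_le_eq)
    qed
    have ratio_sq: "(real (J i) / c i)\<^sup>2 = real (J i) * s i / (1 + \<delta>)" if "i \<le> K" for i
      unfolding power_divide c2 using J1[OF that] s0[of i] \<delta> by (simp add: power2_eq_square)
    have \<mu>: "(c i)\<^sup>2 / real p \<le> \<delta>" if i: "i < K" and p: "p \<in> P i" for i p
    proof -
      have "1 / 2 * \<delta> * 1 / y \<le> s i"
        unfolding s_def using \<delta> h1[of i] y0 by (intro divide_right_mono mult_mono) auto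
      moreover have "(1 + \<delta>) * real (J i) \<le> 2 * l"
        using \<delta> J_le[of i] Xl[of i] by (intro mult_mono) auto
      ultimately have "(c i)\<^sup>2 \<le> 2 * l / (1 / 2 * \<delta> * 1 / y)"
        unfolding c2 using \<delta> l0 y0 by (intro frac_le) auto
      also have "\<dots> = l * (4 * y) / \<delta>" using \<delta> y0 by (simp add: field_simps)
      also have "\<dots> \<le> l * (\<delta>\<^sup>2 * exp (y powr \<delta>)) / \<delta>"
        using A6 l0 \<delta> by (intro divide_right_mono mult_left_mono) auto
      also have "\<dots> = \<delta> * (l * exp (y powr \<delta>))" using \<delta> by (simp add: power2_eq_square)
      also have "\<dots> \<le> \<delta> * (l * exp (h i))" using \<delta> l0 h_ge[of i] by (intro mult_left_mono) auto
      also have "\<dots> \<le> \<delta> * real p" using \<delta> p by (intro mult_left_mono) (auto simp: P_def)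
      finally have "(c i)\<^sup>2 \<le> \<delta> * real p" .
      moreover have "real p > 0" using p by (auto simp: P_def prime_gt_0_nat)
      ultimately show ?thesis by (simp add: divide_le_eq)
    qed
    have large: "real (J i) * (1 + \<delta>) \<le> (\<Sum>p\<in>P i. (c i)\<^sup>2 / real p)" if i: "i < K" for i
    proof -
      have "real (J i) * (1 + \<delta>) = (c i)\<^sup>2 * s i" unfolding c2 using s0[of i] by simp
      also have "\<dots> \<le> (c i)\<^sup>2 * (\<Sum>p\<in>P i. 1 / real p)" by (intro mult_left_mono sP i) auto
      finally show ?thesis by (simp add: sum_distrib_left)
    qed

    define G where "G = (\<Sum>i<K. real (J i) / c i)"
    have G_le: "G \<le> y * sqrt l"
    proof -
      have "real (J i) / c i \<le> sqrt l" if i: "i < K" for i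
      proof (rule real_le_rsqrt)
        have "(real (J i) / c i)\<^sup>2 = real (J i) * s i / (1 + \<delta>)" using ratio_sq i by simp
        also have "\<dots> \<le> l * 1 / 1"
          using J_le[of i] Xl[of i] s_le_1[of i] s0[of i] i l0 \<delta> by (intro frac_le mult_mono) auto
        finally show "(real (J i) / c i)\<^sup>2 \<le> l" by simp
      qed
      then have "G \<le> (\<Sum>i<K. sqrt l)" unfolding G_def by (intro sum_mono) auto
      also have "\<dots> = real K * sqrt l" by simp
      also have "\<dots> \<le> y * sqrt l" using K l0 by (intro mult_right_mono) auto
      finally show ?thesis .
    qed
    have G_ge: "\<theta> * sqrt \<kappa> * sqrt (l * z / y) \<le> G"
    proof -
      define g where "g = sqrt ((1 - \<delta>)\<^sup>2 * \<kappa> * l * \<delta> / (real K * (1 + 2 * \<delta>) * (1 + \<delta>) * y))"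
      have "g \<le> real (J i) / c i" if i: "i < K" for i
      proof -
        have "(1 - \<delta>)\<^sup>2 * \<kappa> * l * \<delta> / (real K * (1 + 2 * \<delta>) * (1 + \<delta>) * y) = (1 - \<delta>) * X i * s i / (1 + \<delta>)"
          using h0[of i] K0 y0 \<delta> by (simp add: X_def s_def divide_simps power2_eq_square)
        also have "\<dots> \<le> real (J i) * s i / (1 + \<delta>)"
          using J_ge[of i] i s0[of i] \<delta> by (intro divide_right_mono mult_right_mono) auto
        also have "\<dots> = (real (J i) / c i)\<^sup>2" using ratio_sq[of i] i by simp
        finally have "g \<le> sqrt ((real (J i) / c i)\<^sup>2)" unfolding g_def by (rule real_sqrt_le_mono)
        then show ?thesis using c0[of i] i by simp
      qed
      then have "(\<Sum>i<K. g) \<le> G" unfolding G_def by (intro sum_mono) auto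
      then have "real K * g \<le> G" by simp
      moreover have "\<theta> * sqrt \<kappa> * sqrt (l * z / y) \<le> real K * g"
      proof -
        have "\<theta> * sqrt \<kappa> * sqrt (l * z / y)
           = sqrt ((1 - \<delta>)\<^sup>2 * ((1 - 3 * \<delta>) * z) * \<kappa> * l / ((1 + 2 * \<delta>) * (1 + \<delta>) * y))"
          unfolding \<theta>_def real_sqrt_mult[symmetric] by (rule arg_cong[of _ _ sqrt]) (simp add: mult_ac)
        also have "\<dots> \<le> sqrt ((1 - \<delta>)\<^sup>2 * (\<delta> * real K) * \<kappa> * l / ((1 + 2 * \<delta>) * (1 + \<delta>) * y))"
          using K(4) \<delta> \<kappa> l0 y0 by (intro real_sqrt_le_mono divide_right_mono mult_right_mono mult_left_mono) auto
        also have "\<dots> = sqrt ((real K)\<^sup>2 * ((1 - \<delta>)\<^sup>2 * \<kappa> * l * \<delta> / (real K * (1 + 2 * \<delta>) * (1 + \<delta>) * y)))"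
          using K0 by (intro arg_cong[of _ _ sqrt]) (simp add: power2_eq_square mult_ac)
        also have "\<dots> = real K * g" unfolding real_sqrt_mult g_def using K0 by simp
        finally show ?thesis .
      qed
      ultimately show ?thesis by linarith
    qed

    define b where "b = nat \<lceil>2 * G + 1\<rceil>"
    have b: "2 * G + 1 \<le> real b" unfolding b_def by linarith
    have G0: "0 \<le> G" unfolding G_def using c0 by (intro sum_nonneg divide_nonneg_nonneg) (auto intro: less_imp_le)
    have ys: "1 \<le> y * sqrt l"
    proof -
      have "1 * 1 \<le> y * sqrt l" using A1 l1 by (intro mult_mono) auto
      then show ?thesis by simp
    qed
    have b_le: "real b \<le> 4 * (y * sqrt l)"
    proof -
      have "real b \<le> 2 * G + 2" unfolding b_def using G0 by linarith
      then show ?thesis using G_le ys by linarith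
    qed
    \<comment> \<open>The value of the smoothing weight at \<open>log n = 8 y^2 sqrt l\<close>, an upper bound for \<open>b\<close> primes whose logarithms are at most \<open>2 y\<close>.\<close>
    define \<omega> where "\<omega> = exp (- (32 * y ^ 4 * l powr (1/4)))"
    have w_ge: "\<omega> \<le> exp (- (ln (real n))\<^sup>2 / (2 * l powr (3/4)))" if n: "1 \<le> n" "ln (real n) \<le> real b * (2 * y)" for n
    proof -
      have "ln (real n) \<le> 4 * (y * sqrt l) * (2 * y)"
        using n(2) b_le y0 by (meson mult_right_mono order_trans zero_le_mult_iff zero_le_numeral less_imp_le)
      then have "ln (real n) \<le> 8 * y\<^sup>2 * sqrt l" by (simp add: power2_eq_square mult_ac)
      then have "(ln (real n))\<^sup>2 \<le> (8 * y\<^sup>2 * sqrt l)\<^sup>2" using n by (intro power_mono) auto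
      also have "\<dots> = 64 * y ^ 4 * l" using l0 by (simp add: power_mult_distrib)
      finally have "(ln (real n))\<^sup>2 / (2 * l powr (3/4)) \<le> 64 * y ^ 4 * l / (2 * l powr (3/4))"
        by (intro divide_right_mono) auto
      also have "\<dots> = 32 * y ^ 4 * (l / l powr (3/4))" by simp
      also have "l / l powr (3/4) = l powr (1/4)"
        using l0 powr_diff[of l 1 "3/4"] by simp
      finally show ?thesis unfolding \<omega>_def by simp
    qed

    have "\<exists>M f Q. resonates (log_gauss (l powr (3/4))) M f Q
        (\<omega> / 2 * (\<Prod>i\<in>{..<K}. (1 + 1 / c i) ^ J i / real (J i + 1))) \<and>
      card M = (\<Prod>i\<in>{..<K}. card {X. X \<subseteq> P i \<and> card X \<le> J i})"
    proof (rule resonator_from_blocks[where \<mu> = "\<lambda>_. \<delta>" and b = b and L = "2 * y"])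
      show "disjoint_family_on P {..<K}"
      proof (unfold disjoint_family_on_def, intro ballI impI)
        have "P i \<inter> P j = {}" if "i < j" for i j
        proof -
          have "l * exp (h (Suc i)) \<le> l * exp (h j)" using l0 h_mono[of "Suc i" j] that by simp
          then show ?thesis by (auto simp: P_def)
        qed
        then show "P i \<inter> P j = {}" if "i \<noteq> j" for i j using that by (metis Int_commute nat_neq_iff)
      qed
      show "ln (real p) \<le> 2 * y" if "i \<in> {..<K}" "p \<in> P i" for i p
      proof -
        have "0 < real p" "real p \<le> l * exp (h (Suc i))" using that by (auto simp: P_def prime_gt_0_nat)
        then have "ln (real p) \<le> ln (l * exp (h (Suc i)))" using l0 by (subst ln_le_cancel_iff) auto
        also have "\<dots> = y + h (Suc i)" using l0 by (simp add: ln_mult y_def)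
        also have "\<dots> \<le> 2 * y" using hy[of "Suc i"] that by simp
        finally show ?thesis .
      qed
      show "real b \<ge> 2 * (\<Sum>i\<in>{..<K}. real (J i) / c i) + 1" using b by (simp add: G_def)
    qed (use finP c0 \<mu> large w_ge \<delta> y0 in \<open>auto simp: P_def \<omega>_def\<close>)
    then obtain M Q f where R: "resonates (log_gauss (l powr (3/4))) M f Q
        (\<omega> / 2 * (\<Prod>i\<in>{..<K}. (1 + 1 / c i) ^ J i / real (J i + 1)))"
      and cM: "card M = (\<Prod>i\<in>{..<K}. card {X. X \<subseteq> P i \<and> card X \<le> J i})"
      by blast

    have card: "real (card M) \<le> exp (\<kappa> * l)"
    proof -
      have "real (card M) = (\<Prod>i<K. real (card {X. X \<subseteq> P i \<and> card X \<le> J i}))" unfolding cM by simp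
      also have "\<dots> \<le> (\<Prod>i<K. exp (\<kappa> * l / real K))"
      proof (intro prod_mono conjI)
        fix i assume "i \<in> {..<K}"
        then have i: "i \<le> K" by simp
        have Jl: "real (J i) \<le> l" using J_le[of i] Xl[of i] by linarith
        have ll: "l \<le> l * exp (h (Suc i))" using l0 h0[of "Suc i"] by simp
        have Jn: "real (J i) \<le> l * exp (h (Suc i))" using Jl ll by linarith
        have "real (card {X. X \<subseteq> P i \<and> card X \<le> J i}) \<le> exp (real (J i) * (1 + ln (l * exp (h (Suc i)) / real (J i))))"
          using finP cardP Jn J1[OF i] by (intro card_subsets_le_exp) auto
        also have "\<dots> \<le> exp (\<kappa> * l / real K)"
        proof -
          have Jp: "real (J i) > 0" using J1[OF i] by linarith
          have "l / real (J i) \<le> 4 * y\<^sup>2 / \<kappa>"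
          proof -
            have "1 / 2 * X i \<le> (1 - \<delta>) * X i" using \<delta> X0[of i] by (intro mult_right_mono) auto
            then have "\<kappa> * l / (4 * y\<^sup>2) \<le> real (J i)" using J_ge[OF i] X_ge[OF i] by simp
            then show ?thesis using Jp \<kappa> y0 by (simp add: field_simps)
          qed
          then have "ln (l / real (J i)) \<le> ln (4 * y\<^sup>2 / \<kappa>)" using l0 Jp \<kappa> y0 by (subst ln_le_cancel_iff) auto
          also have "\<dots> = ln (4 / \<kappa>) + 2 * z" using \<kappa> y0 by (simp add: z_def ln_mult ln_div ln_realpow)
          finally have lnJ: "ln (l / real (J i)) \<le> ln (4 / \<kappa>) + 2 * z" .
          have "ln (l * exp (h (Suc i)) / real (J i)) = h (Suc i) + ln (l / real (J i))"
            using l0 Jp by (simp add: ln_mult ln_div)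
          then have "1 + ln (l * exp (h (Suc i)) / real (J i)) \<le> (1 + \<delta>) * h i + \<delta> * y powr \<delta>"
            using lnJ A9 by (simp add: hSuc)
          also have "\<dots> \<le> (1 + \<delta>) * h i + \<delta> * h i" using h_ge[of i] \<delta> by simp
          also have "\<dots> = (1 + 2 * \<delta>) * h i" by (simp add: algebra_simps)
          finally have "real (J i) * (1 + ln (l * exp (h (Suc i)) / real (J i))) \<le> X i * ((1 + 2 * \<delta>) * h i)"
          proof (intro mult_mono J_le)
            have "1 \<le> l * exp (h (Suc i)) / real (J i)" using Jn Jp by (simp only: pos_le_divide_eq mult_1_left)
            then have "0 \<le> ln (l * exp (h (Suc i)) / real (J i))" by (rule ln_ge_zero)
            then show "0 \<le> 1 + ln (l * exp (h (Suc i)) / real (J i))" by linarith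
          qed (use X0[of i] in auto)
          also have "\<dots> = \<kappa> * l / real K"
          proof -
            define d where "d = h i * (1 + 2 * \<delta>)"
            have "d \<noteq> 0" using h0[of i] \<delta> by (simp add: d_def)
            moreover have "X i = \<kappa> * l / (real K * d)" by (simp only: X_def d_def mult.assoc)
            ultimately have "X i * d = \<kappa> * l / real K" by simp
            then show ?thesis by (simp only: d_def mult.commute[of "1 + 2 * \<delta>"])
          qed
          finally show ?thesis by simp
        qed
        finally show "real (card {X. X \<subseteq> P i \<and> card X \<le> J i}) \<le> exp (\<kappa> * l / real K)" .
      qed auto
      also have "\<dots> = exp (\<kappa> * l)" using K0 by (simp add: exp_of_nat_mult[symmetric])
      finally show ?thesis .
    qed

    have prod1: "exp ((1 - \<delta>) * G) \<le> (\<Prod>i<K. (1 + 1 / c i) ^ J i)"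
    proof -
      have "exp ((1 - \<delta>) * G) = (\<Prod>i<K. exp ((1 - \<delta>) * (real (J i) / c i)))"
        by (simp add: G_def sum_distrib_left exp_sum)
      also have "\<dots> \<le> (\<Prod>i<K. (1 + 1 / c i) ^ J i)"
      proof (intro prod_mono conjI)
        fix i assume "i \<in> {..<K}"
        then have i: "i \<le> K" by simp
        define u where "u = 1 / c i"
        have u: "0 < u" "u \<le> \<delta>" using c0[OF i] c_inv[OF i] by (auto simp: u_def)
        have "(1 - \<delta>) * u \<le> (1 - u) * u" using u by (intro mult_right_mono) auto
        also have "\<dots> = u - u\<^sup>2" by (simp add: power2_eq_square algebra_simps)
        also have "\<dots> \<le> ln (1 + u)" using u \<delta> by (intro ln_one_plus_pos_lower_bound) auto
        finally have "exp ((1 - \<delta>) * u) \<le> exp (ln (1 + u))" by simp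
        then have "exp ((1 - \<delta>) * u) \<le> 1 + u" using u by simp
        then have "exp ((1 - \<delta>) * u) ^ J i \<le> (1 + u) ^ J i" by (intro power_mono) auto
        also have "exp ((1 - \<delta>) * u) ^ J i = exp ((1 - \<delta>) * (real (J i) / c i))"
          by (simp add: exp_of_nat_mult[symmetric] u_def mult_ac)
        finally show "exp ((1 - \<delta>) * (real (J i) / c i)) \<le> (1 + 1 / c i) ^ J i" by (simp add: u_def)
      qed auto
      finally show ?thesis .
    qed
    have prod2: "(\<Prod>i<K. real (J i + 1)) \<le> exp (2 * y\<^sup>2)"
    proof -
      have "(\<Prod>i<K. real (J i + 1)) \<le> (\<Prod>i<K. exp (2 * y))"
      proof (intro prod_mono conjI)
        fix i
        have ey: "exp y = l" using l0 by (simp add: y_def)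
        have "real (J i + 1) \<le> 2 * l" using J_le[of i] Xl[of i] l1 by simp
        also have "\<dots> \<le> l * l"
        proof -
          have "2 \<le> exp (1 :: real)" using exp_ge_add_one_self[of 1] by simp
          also have "exp 1 \<le> exp y" using A1 by simp
          also note ey
          finally show ?thesis using l0 by (intro mult_right_mono) auto
        qed
        also have "\<dots> = exp (2 * y)" by (simp only: mult_2 exp_add ey)
        finally show "real (J i + 1) \<le> exp (2 * y)" .
      qed auto
      also have "\<dots> = exp (real K * (2 * y))" by (simp add: exp_of_nat_mult[symmetric])
      also have "\<dots> \<le> exp (2 * y\<^sup>2)" using K y0 by (simp add: power2_eq_square)
      finally show ?thesis .
    qed
    have main: "exp (gain \<delta> * sqrt \<kappa> * sqrt (l * z / y)) \<le> \<omega> / 2 * (\<Prod>i\<in>{..<K}. (1 + 1 / c i) ^ J i / real (J i + 1))"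
    proof -
      define Lam where "Lam = sqrt (l * z / y)"
      have "(1 - \<delta>) * (\<theta> * sqrt \<kappa> * Lam) \<le> (1 - \<delta>) * G"
        using G_ge \<delta> unfolding Lam_def by (intro mult_left_mono) auto
      moreover have "gain \<delta> * sqrt \<kappa> * Lam = (1 - \<delta>) * (\<theta> * sqrt \<kappa> * Lam) - \<epsilon> * Lam"
      proof -
        have gd: "gain \<delta> = (1 - \<delta>)\<^sup>2 * \<theta>" by (simp only: gain_def \<theta>_def)
        show ?thesis unfolding gd \<epsilon>_def by (simp add: power2_eq_square algebra_simps)
      qed
      ultimately have "gain \<delta> * sqrt \<kappa> * Lam \<le> (1 - \<delta>) * G - (32 * y ^ 4 * l powr (1/4) + 1 + 2 * y\<^sup>2)"
        using A8 unfolding Lam_def by linarith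
      then have "exp (gain \<delta> * sqrt \<kappa> * Lam) \<le> exp ((1 - \<delta>) * G - (32 * y ^ 4 * l powr (1/4) + 1 + 2 * y\<^sup>2))"
        by simp
      also have "\<dots> = \<omega> * exp (- 1) * exp ((1 - \<delta>) * G) / exp (2 * y\<^sup>2)"
        unfolding \<omega>_def by (simp add: exp_diff exp_add exp_minus field_simps)
      also have "\<dots> \<le> \<omega> * (1 / 2) * (\<Prod>i<K. (1 + 1 / c i) ^ J i) / (\<Prod>i<K. real (J i + 1))"
      proof -
        have "exp (- 1) \<le> (1 / 2 :: real)" using exp_ge_add_one_self[of 1] by (simp add: exp_minus field_simps)
        moreover have "0 < (\<Prod>i<K. real (J i + 1))" by (intro prod_pos) auto
        moreover have "0 \<le> (\<Prod>i<K. (1 + 1 / c i) ^ J i)" using prod1 by (rule order_trans[rotated]) simp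
        ultimately show ?thesis using prod1 prod2
          by (intro frac_le mult_mono) (auto simp: \<omega>_def intro!: mult_nonneg_nonneg)
      qed
      also have "\<dots> = \<omega> / 2 * (\<Prod>i\<in>{..<K}. (1 + 1 / c i) ^ J i / real (J i + 1))"
        by (simp add: prod_dividef)
      finally show ?thesis unfolding Lam_def .
    qed
    show "\<exists>M f Q. real (card M) \<le> exp (\<kappa> * l) \<and>
      resonates (log_gauss (l powr (3/4))) M f Q (exp (gain \<delta> * sqrt \<kappa> * sqrt (l * ln (ln l) / ln l)))"
      using card resonates_mono[OF R main] unfolding z_def y_def by blast
  qed
qed

section \<open>Large values of the real part\<close>

lemma gain_tendsto:
  fixes \<beta> :: real
  assumes "\<beta> < 1"
  shows "((\<lambda>\<rho>. gain \<rho> * sqrt (1 - \<beta> - 2 * \<rho>)) \<longlongrightarrow> sqrt (1 - \<beta>)) (at_right 0)"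
proof -
  have "((\<lambda>\<rho>. gain \<rho> * sqrt (1 - \<beta> - 2 * \<rho>)) \<longlongrightarrow> gain 0 * sqrt (1 - \<beta> - 2 * 0)) (at_right 0)"
    unfolding gain_def by (intro tendsto_intros) auto
  then show ?thesis by (simp add: gain_def)
qed

text \<open>If the real part of zeta stayed below \<open>V\<close> throughout, the resonator with \<open>\<kappa> = 1 - \<beta> - 2 \<rho>\<close> would force \<open>V\<close> to exceed a
  constant times \<open>exp (g \<Lambda>)\<close> with \<open>g\<close> close to \<open>sqrt (1 - \<beta>)\<close>. The exponent \<open>\<beta>\<close> is raised to \<open>\<beta> + \<rho>\<close> because the
  resonance method requires a positive one; this only shrinks the range.\<close>
lemma zre_large_values:
  fixes \<beta> e :: real
  assumes "0 \<le> \<beta>" "\<beta> < 1" "0 < e"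
  shows "\<forall>\<^sub>F T in at_top. \<exists>t\<in>{T powr \<beta>..T}.
    exp ((sqrt (1 - \<beta>) - e) * sqrt (ln T * ln (ln (ln T)) / ln (ln T))) \<le> zre t"
proof -
  define v where "v = max 0 (sqrt (1 - \<beta>) - e)"
  have "v < sqrt (1 - \<beta>)" using assms by (simp add: v_def)
  then have "\<forall>\<^sub>F \<rho> in at_right 0. v < gain \<rho> * sqrt (1 - \<beta> - 2 * \<rho>)"
    using gain_tendsto[OF assms(2)] by (rule order_tendstoD(1)[rotated])
  moreover have "\<forall>\<^sub>F \<rho> in at_right 0. \<rho> < min (1 / 4) ((1 - \<beta>) / 4)"
    using assms by (intro order_tendstoD[OF tendsto_ident_at]) auto
  moreover have "\<forall>\<^sub>F \<rho>::real in at_right 0. 0 < \<rho>" by (rule eventually_at_right_less)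
  ultimately have "\<forall>\<^sub>F \<rho> in at_right 0. v < gain \<rho> * sqrt (1 - \<beta> - 2 * \<rho>) \<and> \<rho> < min (1 / 4) ((1 - \<beta>) / 4) \<and> 0 < \<rho>"
    by eventually_elim auto
  then obtain \<rho> where \<rho>: "v < gain \<rho> * sqrt (1 - \<beta> - 2 * \<rho>)" "\<rho> < 1 / 4" "\<rho> < (1 - \<beta>) / 4" "0 < \<rho>"
    using eventually_happens[of _ "at_right (0::real)"] by (auto simp: trivial_limit_at_right_real)
  define \<beta>' where "\<beta>' = \<beta> + \<rho>"
  define \<kappa> where "\<kappa> = 1 - \<beta> - 2 * \<rho>"
  have par: "0 < \<beta>'" "0 < \<kappa>" "\<kappa> \<le> 1" "\<beta>' + \<kappa> < 1" "\<beta> \<le> \<beta>'"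
    using \<rho> assms by (auto simp: \<beta>'_def \<kappa>_def)
  define g where "g = gain \<rho> * sqrt \<kappa>"
  have g: "v < g" using \<rho> by (simp add: g_def \<kappa>_def)
  define \<Lambda> where "\<Lambda> T = sqrt (ln T * ln (ln (ln T)) / ln (ln T))" for T :: real
  obtain C where C: "C > 0" and ev1: "\<forall>\<^sub>F T in at_top. \<forall>V\<ge>1. (\<forall>w\<in>{T powr \<beta>'..T}. zre w \<le> V) \<longrightarrow>
    (\<forall>M f Q G. resonates (log_gauss (ln T powr (3/4))) M f Q G \<longrightarrow> real (card M) \<le> T powr \<kappa> \<longrightarrow> G \<le> C * V)"
    using zre_large_of_correlations[OF par(1,2,4)] by blast
  have ev2: "\<forall>\<^sub>F T in at_top. \<exists>M f Q. real (card M) \<le> exp (\<kappa> * ln T) \<and>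
      resonates (log_gauss (ln T powr (3/4))) M f Q (exp (gain \<rho> * sqrt \<kappa> * sqrt (ln T * ln (ln (ln T)) / ln (ln T))))"
    using large_correlations[OF par(2,3) \<rho>(4,2)] ln_at_top by (rule eventually_compose_filterlim)
  have ev3: "\<forall>\<^sub>F T in at_top. C < exp ((g - v) * \<Lambda> T)"
    unfolding \<Lambda>_def using g C by real_asymp
  have ev4: "\<forall>\<^sub>F T in at_top. 0 \<le> \<Lambda> T" unfolding \<Lambda>_def by real_asymp
  show ?thesis
    using ev1 ev2 ev3 ev4 eventually_ge_at_top[of 1]
  proof eventually_elim
    case (elim T)
    have T: "T > 0" using elim(5) by simp
    show ?case
    proof (rule ccontr)
      assume "\<not> (\<exists>t\<in>{T powr \<beta>..T}. exp ((sqrt (1 - \<beta>) - e) * sqrt (ln T * ln (ln (ln T)) / ln (ln T))) \<le> zre t)"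
      then have small: "zre w < exp ((sqrt (1 - \<beta>) - e) * \<Lambda> T)" if "w \<in> {T powr \<beta>..T}" for w
        using that unfolding \<Lambda>_def by force
      define V where "V = exp (v * \<Lambda> T)"
      have V: "V \<ge> 1" using elim(4) by (simp add: V_def v_def)
      have le: "\<forall>w\<in>{T powr \<beta>'..T}. zre w \<le> V"
      proof
        fix w assume w: "w \<in> {T powr \<beta>'..T}"
        have "T powr \<beta> \<le> T powr \<beta>'" using par elim(5) by (intro powr_mono) auto
        then have "zre w < exp ((sqrt (1 - \<beta>) - e) * \<Lambda> T)" using w by (intro small) auto
        also have "\<dots> \<le> V" unfolding V_def v_def using elim(4) by (simp add: mult_right_mono)
        finally show "zre w \<le> V" by simp
      qed
      obtain M Q f where R: "real (card M) \<le> exp (\<kappa> * ln T)"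
        "resonates (log_gauss (ln T powr (3/4))) M f Q (exp (g * \<Lambda> T))"
        using elim(2) unfolding g_def \<Lambda>_def by blast
      have cM: "real (card M) \<le> T powr \<kappa>" using R(1) T by (simp add: powr_def)
      have "exp (g * \<Lambda> T) \<le> C * V" using elim(1) V le R(2) cM by blast
      then have "exp (g * \<Lambda> T) / V \<le> C" using V by (simp add: divide_le_eq)
      moreover have "exp (g * \<Lambda> T) / V = exp ((g - v) * \<Lambda> T)"
        by (simp add: V_def exp_diff[symmetric] left_diff_distrib)
      ultimately show False using elim(3) by simp
    qed
  qed
qed

text \<open>Continuity gives a maximum. As the lower bound holds for every fixed loss \<open>e\<close> in the constant, the loss
  that the maximum actually exhibits, cut off at \<open>0\<close> from above, tends to \<open>0\<close>.\<close>
theorem theorem1p1: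
  fixes \<beta> :: real
  assumes "0 \<le> \<beta>" and "\<beta> < 1"
  shows "\<exists>\<epsilon> :: real \<Rightarrow> real. (\<epsilon> \<longlongrightarrow> 0) at_top \<and>
    (\<forall>\<^sub>F T in at_top. \<exists>t\<^sub>0 \<in> {T powr \<beta>..T}.
       (\<forall>t \<in> {T powr \<beta>..T}. Re (zeta (1 / 2 + \<i> * of_real t)) \<le> Re (zeta (1 / 2 + \<i> * of_real t\<^sub>0))) \<and>
       Re (zeta (1 / 2 + \<i> * of_real t\<^sub>0)) \<ge>
         exp ((sqrt (1 - \<beta>) + \<epsilon> T) * sqrt (ln T * ln (ln (ln T)) / ln (ln T))))"
proof -
  define \<Lambda> where "\<Lambda> T = sqrt (ln T * ln (ln (ln T)) / ln (ln T))" for T :: real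
  define mx where "mx T = (SUP t\<in>{T powr \<beta>..T}. zre t)" for T
  define \<epsilon> where "\<epsilon> T = min 0 (ln (mx T) / \<Lambda> T - sqrt (1 - \<beta>))" for T
  have attained: "\<exists>t\<^sub>0\<in>{T powr \<beta>..T}. (\<forall>t\<in>{T powr \<beta>..T}. zre t \<le> zre t\<^sub>0) \<and> mx T = zre t\<^sub>0" if "T \<ge> 1" for T
  proof -
    have "T powr \<beta> \<le> T powr 1" using that assms by (intro powr_mono) auto
    then have ne: "{T powr \<beta>..T} \<noteq> {}" using that by simp
    obtain t\<^sub>0 where t0: "t\<^sub>0 \<in> {T powr \<beta>..T}" "\<forall>t\<in>{T powr \<beta>..T}. zre t \<le> zre t\<^sub>0"
      using continuous_attains_sup[OF compact_Icc ne zre_continuous] by blast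
    have "mx T = zre t\<^sub>0"
      unfolding mx_def by (rule cSup_eq_maximum) (use t0 in auto)
    with t0 show ?thesis by blast
  qed
  have big: "\<forall>\<^sub>F T in at_top. exp ((sqrt (1 - \<beta>) - e) * \<Lambda> T) \<le> mx T" if "e > 0" for e
    using zre_large_values[OF assms that] eventually_ge_at_top[of 1]
  proof eventually_elim
    case (elim T)
    then obtain t where t: "t \<in> {T powr \<beta>..T}" "exp ((sqrt (1 - \<beta>) - e) * \<Lambda> T) \<le> zre t"
      unfolding \<Lambda>_def by blast
    then show ?case using attained[OF elim(2)] by force
  qed
  have pos: "\<forall>\<^sub>F T in at_top. 0 < \<Lambda> T" unfolding \<Lambda>_def by real_asymp
  have "(\<epsilon> \<longlongrightarrow> 0) at_top"
  proof (rule tendstoI)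
    fix e :: real assume e: "e > 0"
    have "\<forall>\<^sub>F T in at_top. exp ((sqrt (1 - \<beta>) - e / 2) * \<Lambda> T) \<le> mx T" using e by (intro big) simp
    then show "\<forall>\<^sub>F T in at_top. dist (\<epsilon> T) 0 < e"
      using pos
    proof eventually_elim
      case (elim T)
      have "0 < mx T" using elim(1) by (rule less_le_trans[OF exp_gt_zero])
      then have "(sqrt (1 - \<beta>) - e / 2) * \<Lambda> T \<le> ln (mx T)" using elim(1) by (simp add: ln_ge_iff)
      then have "sqrt (1 - \<beta>) - e / 2 \<le> ln (mx T) / \<Lambda> T" using elim(2) by (simp add: le_divide_eq)
      then show ?case using e by (simp add: \<epsilon>_def dist_real_def min_def)
    qed
  qed
  moreover have "\<forall>\<^sub>F T in at_top. \<exists>t\<^sub>0 \<in> {T powr \<beta>..T}.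
       (\<forall>t \<in> {T powr \<beta>..T}. zre t \<le> zre t\<^sub>0) \<and> zre t\<^sub>0 \<ge> exp ((sqrt (1 - \<beta>) + \<epsilon> T) * \<Lambda> T)"
    using big[of 1, OF zero_less_one] pos eventually_ge_at_top[of 1]
  proof eventually_elim
    case (elim T)
    obtain t\<^sub>0 where t0: "t\<^sub>0 \<in> {T powr \<beta>..T}" "\<forall>t\<in>{T powr \<beta>..T}. zre t \<le> zre t\<^sub>0" "mx T = zre t\<^sub>0"
      using attained[OF elim(3)] by blast
    have m: "0 < mx T" using elim(1) by (rule less_le_trans[OF exp_gt_zero])
    have "(sqrt (1 - \<beta>) + \<epsilon> T) * \<Lambda> T \<le> ln (mx T) / \<Lambda> T * \<Lambda> T"
      using elim(2) by (intro mult_right_mono) (auto simp: \<epsilon>_def)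
    then have "exp ((sqrt (1 - \<beta>) + \<epsilon> T) * \<Lambda> T) \<le> exp (ln (mx T))" using elim(2) by simp
    then have "exp ((sqrt (1 - \<beta>) + \<epsilon> T) * \<Lambda> T) \<le> zre t\<^sub>0" using m t0(3) by simp
    then show ?case using t0 by blast
  qed
  ultimately show ?thesis unfolding zre_def \<Lambda>_def by blast
qed

end
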